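(* Let $G$ be a finite group with $|C(G)|=\frac{|G|}{2}$. Then the following hold. (1) $\mathcal{O}_{2}(G)=1$ if and only if $G$ is isomorphic to one of $\mathbb{Z}_8$, $\mathbb{Z}_{12}$, $Q_{16}$, $\mathbb{Z}_{3}\rtimes Q_8$. (2) $\mathcal{O}_{2}(G)=3$ if and only if $G$ is isomorphic to one of $\mathbb{Z}_8\times\mathbb{Z}_2$, $M_{16}$, SmallGroup$[32,10]$ ($Q_8\rtimes\mathbb{Z}_4$), SmallGroup$[32,13]$ ($\mathbb{Z}_8\rtimes\mathbb{Z}_4$), SmallGroup$[32,14]$ ($\mathbb{Z}_8\rtimes\mathbb{Z}_4$), $Q_{16}\times\mathbb{Z}_2$, $\mathbb{Z}_{12}\times\mathbb{Z}_2$, $\mathbb{Z}_4\times(\mathbb{Z}_{3}\rtimes\mathbb{Z}_{4})$, SmallGroup$[48,12]$ ($(\mathbb{Z}_{3}\rtimes\mathbb{Z}_{4})\rtimes\mathbb{Z}_4$), SmallGroup$[48,13]$ ($\mathbb{Z}_{12}\rtimes\mathbb{Z}_4$), $\mathbb{Z}_2\times(\mathbb{Z}_{3}\rtimes Q_{8})$. (3) There is no such group $G$ with $\mathcal{O}_{2}(G)=\frac{|G|}{2}-1$ or $\mathcal{O}_{2}(G)=\frac{|G|}{2}-2$. (4) $\mathcal{O}_{2}(G)=\frac{|G|}{2}-3$ if and only if $G\cong\mathbb{Z}_8$.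
   Context: For a finite group $G$, $C(G)$ is the set of all cyclic subgroups of $G$ (including the trivial one), and $\mathcal{O}_2(G)$ is the number of elements of order $2$ in $G$. $\mathbb{Z}_n$ is the cyclic group of order $n$; $Q_{2^k}$ is the generalized quaternion group of order $2^k$; $M_{2^k}$ is the modular maximal-cyclic group of order $2^k$, so $M_{16}=\langle a,b\mid a^8=b^2=1,\ bab^{-1}=a^5\rangle$. $\mathbb{Z}_3\rtimes\mathbb{Z}_4$ and $\mathbb{Z}_3\rtimes Q_8$ denote the nontrivial semidirect products (each unique up to isomorphism; they are the dicyclic groups of order $12$ and $24$). SmallGroup$[i,j]$ is the $j$-th group of order $i$ in GAP's SmallGroups library. Presentations: SmallGroup$[32,10]=\langle a,b,c\mid a^4=c^4=1,\ b^2=a^2,\ bab^{-1}=cac^{-1}=a^{-1},\ cbc^{-1}=a^{-1}b\rangle$; SmallGroup$[32,13]=\langle a,b\mid a^8=b^4=1,\ bab^{-1}=a^{3}\rangle$; SmallGroup$[32,14]=\langle a,b\mid a^8=b^4=1,\ bab^{-1}=a^{-1}\rangle$; SmallGroup$[48,12]=\langle a,b,c\mid a^6=c^4=1,\ b^2=a^3,\ bab^{-1}=a^{-1},\ ac=ca,\ cbc^{-1}=a^3b\rangle$; SmallGroup$[48,13]=\langle a,b\mid a^{12}=b^4=1,\ bab^{-1}=a^{-1}\rangle$. *)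

theory Defs
  imports Complex_Main "HOL-Algebra.Algebra"
begin

section \<open>Cyclic subgroups and involutions\<close>

definition cyclic_subgroups :: "('a, 'b) monoid_scheme \<Rightarrow> 'a set set" where
  "cyclic_subgroups G = {H. subgroup H G \<and> cyclic_group (G\<lparr>carrier := H\<rparr>)}"

definition involution_count :: "('a, 'b) monoid_scheme \<Rightarrow> nat" where
  "involution_count G = card {x \<in> carrier G. group.ord G x = 2}"

section \<open>Groups given by generators and relations\<close>

text \<open>
  The elements of a type \<open>'g\<close> serve as generators, and a relation \<open>s = t\<close> is recorded as the
  pair \<open>s \<doteq> t\<close> of formal group expressions. All elements of \<open>'g\<close> are generators, so a
  presentation on \<open>n\<close> generators needs a type with exactly \<open>n\<close> elements.
\<close>

datatype 'g grp_term =
  Gen 'g | One | Mul "'g grp_term" "'g grp_term" | Inv "'g grp_term"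

instantiation grp_term :: (type) "{one, times, inverse}"
begin
definition one_grp_term :: "'a grp_term" where "1 = One"
definition times_grp_term :: "'a grp_term \<Rightarrow> 'a grp_term \<Rightarrow> 'a grp_term" where "s * t = Mul s t"
definition inverse_grp_term :: "'a grp_term \<Rightarrow> 'a grp_term" where "inverse s = Inv s"
definition divide_grp_term :: "'a grp_term \<Rightarrow> 'a grp_term \<Rightarrow> 'a grp_term"
  where "s div t = Mul s (Inv t)"
instance ..
end

instance grp_term :: (type) power ..

abbreviation relation :: "'g grp_term \<Rightarrow> 'g grp_term \<Rightarrow> 'g grp_term \<times> 'g grp_term"
  (infix "\<doteq>" 50) where
  "s \<doteq> t \<equiv> (s, t)"

text \<open>Equality of expressions as a consequence of the group axioms and the relations in \<open>R\<close>.\<close>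

inductive pres_eq :: "('g grp_term \<times> 'g grp_term) set \<Rightarrow> 'g grp_term \<Rightarrow> 'g grp_term \<Rightarrow> bool"
  for R where
  rel: "(s, t) \<in> R \<Longrightarrow> pres_eq R s t"
| refl: "pres_eq R s s"
| sym: "pres_eq R s t \<Longrightarrow> pres_eq R t s"
| trans: "pres_eq R s t \<Longrightarrow> pres_eq R t u \<Longrightarrow> pres_eq R s u"
| mult: "pres_eq R s s' \<Longrightarrow> pres_eq R t t' \<Longrightarrow> pres_eq R (s * t) (s' * t')"
| inverse: "pres_eq R s s' \<Longrightarrow> pres_eq R (inverse s) (inverse s')"
| assoc: "pres_eq R (s * t * u) (s * (t * u))"
| l_one: "pres_eq R (1 * s) s"
| l_inv: "pres_eq R (inverse s * s) 1"

definition pres_class :: "('g grp_term \<times> 'g grp_term) set \<Rightarrow> 'g grp_term \<Rightarrow> 'g grp_term set" where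
  "pres_class R s = {t. pres_eq R s t}"

definition presented_group :: "('g grp_term \<times> 'g grp_term) set \<Rightarrow> 'g grp_term set monoid" where
  "presented_group R =
     \<lparr>carrier = range (pres_class R),
      monoid.mult = (\<lambda>S T. \<Union>s\<in>S. \<Union>t\<in>T. pres_class R (s * t)),
      one = pres_class R 1\<rparr>"

lemma pres_class_eq_iff: "pres_class R s = pres_class R t \<longleftrightarrow> pres_eq R s t"
proof
  assume "pres_class R s = pres_class R t"
  moreover have "t \<in> pres_class R t"
    by (simp add: pres_class_def pres_eq.refl)
  ultimately show "pres_eq R s t"
    by (simp add: pres_class_def set_eq_iff)
next
  assume "pres_eq R s t"
  then show "pres_class R s = pres_class R t"
    unfolding pres_class_def by (blast intro: pres_eq.sym pres_eq.trans)
qed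

lemma mult_pres_class:
  "pres_class R s \<otimes>\<^bsub>presented_group R\<^esub> pres_class R t = pres_class R (s * t)"
proof -
  have "pres_class R (s' * t') = pres_class R (s * t)"
    if "s' \<in> pres_class R s" "t' \<in> pres_class R t" for s' t'
    using that unfolding pres_class_eq_iff
    by (simp add: pres_class_def pres_eq.mult pres_eq.sym)
  then have "(\<Union>s'\<in>pres_class R s. \<Union>t'\<in>pres_class R t. pres_class R (s' * t')) =
      (\<Union>s'\<in>pres_class R s. \<Union>t'\<in>pres_class R t. pres_class R (s * t))"
    by (intro SUP_cong HOL.refl)
  also have "\<dots> = pres_class R (s * t)"
  proof -
    have "pres_class R s \<noteq> {}" "pres_class R t \<noteq> {}"
      by (auto simp: pres_class_def intro: pres_eq.refl)
    then show ?thesis by simp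
  qed
  finally show ?thesis
    by (simp add: presented_group_def)
qed

lemma group_presented_group: "group (presented_group R)"
proof (rule groupI)
  fix x assume "x \<in> carrier (presented_group R)"
  then obtain s where "x = pres_class R s" by (auto simp: presented_group_def)
  moreover have "\<one>\<^bsub>presented_group R\<^esub> = pres_class R 1"
    by (simp add: presented_group_def)
  moreover have "pres_class R (inverse s) \<in> carrier (presented_group R)"
    by (auto simp: presented_group_def)
  ultimately show "\<one>\<^bsub>presented_group R\<^esub> \<otimes>\<^bsub>presented_group R\<^esub> x = x"
    and "\<exists>y\<in>carrier (presented_group R). y \<otimes>\<^bsub>presented_group R\<^esub> x = \<one>\<^bsub>presented_group R\<^esub>"
    by (simp add: mult_pres_class pres_class_eq_iff pres_eq.l_one,
        metis mult_pres_class pres_class_eq_iff pres_eq.l_inv)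
next
  fix x y z
  assume "x \<in> carrier (presented_group R)" "y \<in> carrier (presented_group R)"
    "z \<in> carrier (presented_group R)"
  then obtain s t u where "x = pres_class R s" "y = pres_class R t" "z = pres_class R u"
    by (auto simp: presented_group_def)
  then show "x \<otimes>\<^bsub>presented_group R\<^esub> y \<otimes>\<^bsub>presented_group R\<^esub> z =
      x \<otimes>\<^bsub>presented_group R\<^esub> (y \<otimes>\<^bsub>presented_group R\<^esub> z)"
    by (simp add: mult_pres_class pres_class_eq_iff pres_eq.assoc)
next
  fix x y
  assume "x \<in> carrier (presented_group R)" "y \<in> carrier (presented_group R)"
  then obtain s t where "x = pres_class R s" "y = pres_class R t"
    by (auto simp: presented_group_def)
  then have "x \<otimes>\<^bsub>presented_group R\<^esub> y = pres_class R (s * t)"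
    by (simp add: mult_pres_class)
  then show "x \<otimes>\<^bsub>presented_group R\<^esub> y \<in> carrier (presented_group R)"
    by (simp add: presented_group_def)
qed (simp add: presented_group_def)

text \<open>The universal property: an assignment of the generators satisfying the relations extends to
  a homomorphism, which is unique because the generators generate the group.\<close>

primrec term_val :: "('a, 'b) monoid_scheme \<Rightarrow> ('g \<Rightarrow> 'a) \<Rightarrow> 'g grp_term \<Rightarrow> 'a" where
  "term_val H f (Gen g) = f g"
| "term_val H f One = \<one>\<^bsub>H\<^esub>"
| "term_val H f (Mul s t) = term_val H f s \<otimes>\<^bsub>H\<^esub> term_val H f t"
| "term_val H f (Inv s) = inv\<^bsub>H\<^esub> term_val H f s"

theorem presented_group_universal:
  fixes H :: "('a, 'b) monoid_scheme" and f :: "'g \<Rightarrow> 'a"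
  assumes "group H" and f: "\<And>g. f g \<in> carrier H"
    and R: "\<And>s t. (s, t) \<in> R \<Longrightarrow> term_val H f s = term_val H f t"
  shows "\<exists>h \<in> hom (presented_group R) H. \<forall>g. h (pres_class R (Gen g)) = f g"
proof -
  interpret H: group H by fact
  have closed: "term_val H f s \<in> carrier H" for s
    by (induction s) (auto simp: f)
  have eq: "pres_eq R s t \<Longrightarrow> term_val H f s = term_val H f t" for s t
    by (induction rule: pres_eq.induct)
      (auto simp: R closed H.m_assoc times_grp_term_def one_grp_term_def inverse_grp_term_def)
  define h where "h = (\<lambda>S. term_val H f (SOME s. s \<in> S))"
  have h: "h (pres_class R s) = term_val H f s" for s
  proof -
    have "s \<in> pres_class R s" by (auto simp: pres_class_def intro: pres_eq.refl)
    then have "(SOME t. t \<in> pres_class R s) \<in> pres_class R s" by (rule someI)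
    then show ?thesis unfolding h_def using eq by (simp add: pres_class_def)
  qed
  have "h \<in> hom (presented_group R) H"
  proof (rule homI)
    fix x assume "x \<in> carrier (presented_group R)"
    then show "h x \<in> carrier H" by (auto simp: presented_group_def h closed)
  next
    fix x y
    assume "x \<in> carrier (presented_group R)" "y \<in> carrier (presented_group R)"
    then obtain s t where "x = pres_class R s" "y = pres_class R t"
      by (auto simp: presented_group_def)
    then show "h (x \<otimes>\<^bsub>presented_group R\<^esub> y) = h x \<otimes>\<^bsub>H\<^esub> h y"
      by (simp add: mult_pres_class h times_grp_term_def)
  qed
  moreover have "\<forall>g. h (pres_class R (Gen g)) = f g" by (simp add: h)
  ultimately show ?thesis by blast
qed

theorem presented_group_generated:
  "generate (presented_group R) (range (\<lambda>g. pres_class R (Gen g))) = carrier (presented_group R)"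
    (is "generate ?P ?S = _")
proof
  interpret P: group ?P by (rule group_presented_group)
  have S: "?S \<subseteq> carrier ?P" by (auto simp: presented_group_def)
  show "generate ?P ?S \<subseteq> carrier ?P" by (rule P.generate_incl [OF S])
  have "pres_class R s \<in> generate ?P ?S" for s
  proof (induction s)
    case (Gen g)
    show ?case by (rule generate.incl) (rule rangeI)
  next
    case One
    have "\<one>\<^bsub>?P\<^esub> = pres_class R One"
      by (simp add: presented_group_def one_grp_term_def)
    with generate.one [of ?P ?S] show ?case by (simp only:)
  next
    case (Mul s t)
    from generate.eng [OF Mul] show ?case
      by (simp only: mult_pres_class times_grp_term_def)
  next
    case (Inv s)
    have "inv\<^bsub>?P\<^esub> pres_class R s = pres_class R (Inv s)"
    proof (rule P.inv_equality)
      have "pres_class R (Inv s * s) = pres_class R 1"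
        unfolding pres_class_eq_iff using pres_eq.l_inv [of R s]
        by (simp only: inverse_grp_term_def)
      then show "pres_class R (Inv s) \<otimes>\<^bsub>?P\<^esub> pres_class R s = \<one>\<^bsub>?P\<^esub>"
        unfolding mult_pres_class by (simp add: presented_group_def)
    qed (auto simp: presented_group_def)
    with P.generate_m_inv_closed [OF S Inv] show ?case by (simp only:)
  qed
  then show "carrier ?P \<subseteq> generate ?P ?S" by (auto simp: presented_group_def)
qed

section \<open>Semidirect products\<close>

definition semidirect_product ::
  "('n, 'b) monoid_scheme \<Rightarrow> ('h, 'c) monoid_scheme \<Rightarrow> ('h \<Rightarrow> 'n \<Rightarrow> 'n) \<Rightarrow> ('n \<times> 'h) monoid" where
  "semidirect_product N H \<phi> =
     \<lparr>carrier = carrier N \<times> carrier H,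
      monoid.mult = (\<lambda>(n, h) (n', h'). (n \<otimes>\<^bsub>N\<^esub> \<phi> h n', h \<otimes>\<^bsub>H\<^esub> h')),
      one = (\<one>\<^bsub>N\<^esub>, \<one>\<^bsub>H\<^esub>)\<rparr>"

text \<open>
  Up to isomorphism \<open>\<int>\<^sub>3 \<rtimes> \<int>\<^sub>4\<close> and \<open>\<int>\<^sub>3 \<rtimes> Q\<^sub>8\<close> do not depend on the choice of a nontrivial
  action; for \<open>Q\<^sub>8\<close> there are three of them.
\<close>

definition nontrivial_actions ::
  "('h, 'c) monoid_scheme \<Rightarrow> ('n, 'b) monoid_scheme \<Rightarrow> ('h \<Rightarrow> 'n \<Rightarrow> 'n) set" where
  "nontrivial_actions H N =
     {\<phi> \<in> hom H (AutoGroup N). \<exists>h \<in> carrier H. \<phi> h \<noteq> \<one>\<^bsub>AutoGroup N\<^esub>}"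

lemma group_semidirect_product:
  assumes "group N" "group H" "\<phi> \<in> hom H (AutoGroup N)"
  shows "group (semidirect_product N H \<phi>)"
proof -
  interpret N: group N by fact
  interpret H: group H by fact
  interpret A: group "AutoGroup N" by (rule N.AutoGroup)
  interpret \<phi>: group_hom H "AutoGroup N" \<phi>
    by unfold_locales fact
  have aut: "\<phi> h \<in> hom N N" "\<phi> h \<in> Bij (carrier N)" if "h \<in> carrier H" for h
    using \<phi>.hom_closed [OF that] by (auto simp: AutoGroup_def auto_def)
  have closed: "\<phi> h n \<in> carrier N" if "h \<in> carrier H" "n \<in> carrier N" for h n
    using aut(1) that by (auto simp: hom_def)
  have mult: "\<phi> h (n \<otimes>\<^bsub>N\<^esub> n') = \<phi> h n \<otimes>\<^bsub>N\<^esub> \<phi> h n'"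
    if "h \<in> carrier H" "n \<in> carrier N" "n' \<in> carrier N" for h n n'
    using aut(1) that by (auto simp: hom_def)
  have one: "\<phi> \<one>\<^bsub>H\<^esub> n = n" if "n \<in> carrier N" for n
    using \<phi>.hom_one that by (simp add: AutoGroup_def BijGroup_def)
  have comp: "\<phi> (h \<otimes>\<^bsub>H\<^esub> h') n = \<phi> h (\<phi> h' n)"
    if "h \<in> carrier H" "h' \<in> carrier H" "n \<in> carrier N" for h h' n
    using \<phi>.hom_mult [OF that(1,2)] aut(2) that
    by (simp add: AutoGroup_def BijGroup_def compose_def)
  show ?thesis
  proof (rule groupI)
    fix x assume "x \<in> carrier (semidirect_product N H \<phi>)"
    then obtain n h where x: "x = (n, h)" and n: "n \<in> carrier N" and h: "h \<in> carrier H"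
      by (auto simp: semidirect_product_def)
    let ?y = "(\<phi> (inv\<^bsub>H\<^esub> h) (inv\<^bsub>N\<^esub> n), inv\<^bsub>H\<^esub> h)"
    have "\<phi> (inv\<^bsub>H\<^esub> h) (inv\<^bsub>N\<^esub> n) \<otimes>\<^bsub>N\<^esub> \<phi> (inv\<^bsub>H\<^esub> h) n = \<phi> (inv\<^bsub>H\<^esub> h) \<one>\<^bsub>N\<^esub>"
      using n h mult [of "inv\<^bsub>H\<^esub> h" "inv\<^bsub>N\<^esub> n" n] by (simp del: \<phi>.hom_inv)
    also have "\<dots> = \<one>\<^bsub>N\<^esub>"
      using aut(1) [of "inv\<^bsub>H\<^esub> h"] h hom_one [OF _ N.is_group N.is_group]
      by (simp del: \<phi>.hom_inv)
    finally have "?y \<otimes>\<^bsub>semidirect_product N H \<phi>\<^esub> x = \<one>\<^bsub>semidirect_product N H \<phi>\<^esub>"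
      using h by (simp add: x semidirect_product_def del: \<phi>.hom_inv)
    moreover have "?y \<in> carrier (semidirect_product N H \<phi>)"
      using n h by (simp add: semidirect_product_def closed del: \<phi>.hom_inv)
    ultimately show "\<exists>y\<in>carrier (semidirect_product N H \<phi>).
        y \<otimes>\<^bsub>semidirect_product N H \<phi>\<^esub> x = \<one>\<^bsub>semidirect_product N H \<phi>\<^esub>" by blast
  qed (auto simp: semidirect_product_def closed mult one comp N.m_assoc H.m_assoc
      simp del: \<phi>.hom_one \<phi>.hom_mult)
qed

section \<open>The groups of the classification\<close>

datatype gen2 = A2 | B2
datatype gen3 = A3 | B3 | C3

text \<open>The generalized quaternion group of order \<open>2 ^ k\<close>, for \<open>k \<ge> 3\<close>.\<close>

definition gen_quaternion :: "nat \<Rightarrow> gen2 grp_term set monoid" where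
  "gen_quaternion k = (let a = Gen A2; b = Gen B2 in presented_group
     {a ^ (2 ^ (k - 1)) \<doteq> 1, b\<^sup>2 \<doteq> a ^ (2 ^ (k - 2)), b * a * inverse b \<doteq> inverse a})"

text \<open>The modular maximal-cyclic group of order \<open>2 ^ k\<close>, for \<open>k \<ge> 4\<close>.\<close>

definition modular_max_cyclic :: "nat \<Rightarrow> gen2 grp_term set monoid" where
  "modular_max_cyclic k = (let a = Gen A2; b = Gen B2 in presented_group
     {a ^ (2 ^ (k - 1)) \<doteq> 1, b\<^sup>2 \<doteq> 1, b * a * inverse b \<doteq> a ^ (2 ^ (k - 2) + 1)})"

definition SmallGroup_32_10 :: "gen3 grp_term set monoid" where
  "SmallGroup_32_10 = (let a = Gen A3; b = Gen B3; c = Gen C3 in presented_group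
     {a ^ 4 \<doteq> 1, c ^ 4 \<doteq> 1, b\<^sup>2 \<doteq> a\<^sup>2, b * a * inverse b \<doteq> inverse a,
      c * a * inverse c \<doteq> inverse a, c * b * inverse c \<doteq> inverse a * b})"

definition SmallGroup_32_13 :: "gen2 grp_term set monoid" where
  "SmallGroup_32_13 = (let a = Gen A2; b = Gen B2 in presented_group
     {a ^ 8 \<doteq> 1, b ^ 4 \<doteq> 1, b * a * inverse b \<doteq> a ^ 3})"

definition SmallGroup_32_14 :: "gen2 grp_term set monoid" where
  "SmallGroup_32_14 = (let a = Gen A2; b = Gen B2 in presented_group
     {a ^ 8 \<doteq> 1, b ^ 4 \<doteq> 1, b * a * inverse b \<doteq> inverse a})"

definition SmallGroup_48_12 :: "gen3 grp_term set monoid" where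
  "SmallGroup_48_12 = (let a = Gen A3; b = Gen B3; c = Gen C3 in presented_group
     {a ^ 6 \<doteq> 1, c ^ 4 \<doteq> 1, b\<^sup>2 \<doteq> a ^ 3, b * a * inverse b \<doteq> inverse a,
      a * c \<doteq> c * a, c * b * inverse c \<doteq> a ^ 3 * b})"

definition SmallGroup_48_13 :: "gen2 grp_term set monoid" where
  "SmallGroup_48_13 = (let a = Gen A2; b = Gen B2 in presented_group
     {a ^ 12 \<doteq> 1, b ^ 4 \<doteq> 1, b * a * inverse b \<doteq> inverse a})"

end

theory Submission
  imports Defs "HOL-Number_Theory.Totient"
begin

text \<open>
  Summing \<open>\<phi>(|C|)\<close> over the cyclic subgroups \<open>C\<close> counts the elements of \<open>G\<close>, so \<open>|C(G)| = |G|/2\<close> says that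
  the average of \<open>\<phi>(|C|)\<close> is \<open>2\<close>. The subgroups of order \<open>1\<close> and \<open>2\<close> are \<open>1 + O\<^sub>2(G)\<close> many and have \<open>\<phi> = 1\<close>;
  this deficit is compensated exactly by the cyclic subgroups with \<open>\<phi> > 2\<close>, where \<open>\<phi> \<ge> 4\<close>.
  Hence \<open>O\<^sub>2(G) = 1\<close> leaves one such subgroup, and \<open>O\<^sub>2(G) = 3\<close> leaves one with \<open>\<phi> = 6\<close> or two with
  \<open>\<phi> = 4\<close>. Orders divisible by \<open>5\<close>, \<open>7\<close> or \<open>9\<close> are impossible: involutions would commute with an element
  of that order and produce too many big cyclic subgroups. So a big cyclic subgroup \<open>\<langle>a\<rangle>\<close> has order \<open>8\<close> or \<open>12\<close>.
  Apart from \<open>M\<^sub>1\<^sub>6\<close>, the group is \<open>A = \<langle>a, t\<rangle>\<close>, generated by \<open>a\<close> and the involutions, or an extension of \<open>A\<close> by an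
  element \<open>x\<close> of small order with \<open>x a x\<^sup>-\<^sup>1 = a\<^sup>-\<^sup>1 e\<close> and \<open>e\<close>, \<open>x\<^sup>2\<close> of exponent \<open>2\<close>, and finitely many cases remain.
  If \<open>O\<^sub>2(G) \<ge> |G|/2 - 3\<close>, the same count forces a cyclic subgroup \<open>C\<close> with \<open>\<phi>(|C|)\<close> so large that \<open>C = G\<close>.
\<close>

text \<open>Two cyclic subgroups with totient 4 may be exchanged by conjugation, so only squares are
  known to normalise each of them. The way out is that units modulo 8 and 12 square to 1: every g^4
  centralises \<open>a\<close>, and an element of order 3 is its own fourth power. This confines
  elements of order 3 to A. Everything outside A then has order 4; comparing the squares of y and a
  y shows that y inverts \<open>a\<close> modulo elements of square 1, and two such inversions
  cancel, so A has index at most 2. In M_16 \<open>a\<close> does not centralise \<open>t\<close>;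
  there a^2 and \<open>t\<close> span the abelian part and \<open>a\<close> itself takes the role of
  \<open>x\<close>. The named groups come as presentations and semidirect products. They and G are
  all matched with one family of models whose multiplication is integer arithmetic. Collapse of a
  presentation is excluded without enumerating its elements: the map from the model has the
  homomorphism of the universal property as a left inverse. As |C(G)| = |G|/2 is given, the
  converses only count involutions in the models.\<close>

section \<open>Arguments with small totient\<close>

text \<open>Totients respect divisibility, so a prime power p^(k+1) dividing \<open>n\<close> forces
  p^k (p - 1) to divide 4. This bounds the exponents of 2, 3, 5 by 3, 1, 1 and excludes larger
  primes; 120 is the product of these bounds.\<close>

lemma totient_dvd_4:
  assumes "totient n dvd 4"
  shows "n dvd 120"
proof -
  have "n > 0" using assms by (cases "n = 0") auto
  have nd: "\<not> m dvd n" if "\<not> totient m dvd 4" for m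
    using that totient_dvd [of m n] assms dvd_trans by blast
  have pp: "\<not> p ^ Suc k dvd n" if "Factorial_Ring.prime p" "\<not> p ^ k * (p - 1) dvd 4" for p k
    using nd [of "p ^ Suc k"] that by (simp add: totient_prime_power_Suc del: power_Suc)
  have "n dvd 2 ^ 3 * 3 * 5"
  proof (rule multiplicity_le_imp_dvd)
    fix p :: nat assume p: "Factorial_Ring.prime p"
    consider "p = 2" | "p = 3" | "p = 5" | "p > 5"
    proof -
      have "p \<noteq> 4" using p by auto
      then show thesis using that prime_ge_2_nat [OF p] by linarith
    qed
    then show "multiplicity p n \<le> multiplicity p (2 ^ 3 * 3 * 5)"
    proof cases
      case 1
      have "multiplicity p n < 4"
        using pp [of 2 3] \<open>n > 0\<close> 1 by (intro multiplicity_lessI) auto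
      moreover have "multiplicity p (2 ^ 3 * 3 * 5) \<ge> 3"
        using 1 by (intro multiplicity_geI) auto
      ultimately show ?thesis by linarith
    next
      case 2
      have "multiplicity p n < 2"
        using pp [of 3 1] \<open>n > 0\<close> 2 by (intro multiplicity_lessI) auto
      moreover have "multiplicity p (2 ^ 3 * 3 * 5) \<ge> 1"
        using 2 by (intro multiplicity_geI) auto
      ultimately show ?thesis by linarith
    next
      case 3
      have "\<not> (20::nat) dvd 4" by auto
      then have "multiplicity p n < 2"
        using pp [of 5 1] \<open>n > 0\<close> 3 by (intro multiplicity_lessI) auto
      moreover have "multiplicity p (2 ^ 3 * 3 * 5) \<ge> 1"
        using 3 by (intro multiplicity_geI) auto
      ultimately show ?thesis by linarith
    next
      case 4
      then have "\<not> p - 1 dvd 4" by (auto dest: dvd_imp_le)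
      then have "multiplicity p n < 1"
        using pp [of p 0] \<open>n > 0\<close> p by (intro multiplicity_lessI) auto
      then show ?thesis by linarith
    qed
  qed (use \<open>n > 0\<close> in auto)
  then show ?thesis by simp
qed

text \<open>As for 4: the exponents of 2, 3, 7 are at most 2, 2, 1, and 5 drops out because 4 does
  not divide 6.\<close>

lemma totient_dvd_6:
  assumes "totient n dvd 6"
  shows "n dvd 252"
proof -
  have "n > 0" using assms by (cases "n = 0") auto
  have nd: "\<not> m dvd n" if "\<not> totient m dvd 6" for m
    using that totient_dvd [of m n] assms dvd_trans by blast
  have pp: "\<not> p ^ Suc k dvd n" if "Factorial_Ring.prime p" "\<not> p ^ k * (p - 1) dvd 6" for p k
    using nd [of "p ^ Suc k"] that by (simp add: totient_prime_power_Suc del: power_Suc)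
  have p7: "Factorial_Ring.prime (7::nat)" by simp
  have "n dvd 2 ^ 2 * 3 ^ 2 * 7"
  proof (rule multiplicity_le_imp_dvd)
    fix p :: nat assume p: "Factorial_Ring.prime p"
    consider "p = 2" | "p = 3" | "p = 5" | "p = 7" | "p > 7"
    proof -
      have "p \<noteq> 4" "p \<noteq> 6" using p by auto
      then show thesis using that prime_ge_2_nat [OF p] by linarith
    qed
    then show "multiplicity p n \<le> multiplicity p (2 ^ 2 * 3 ^ 2 * 7)"
    proof cases
      case 1
      have "\<not> (4::nat) dvd 6" by presburger
      then have "multiplicity p n < 3"
        using pp [of 2 2] \<open>n > 0\<close> 1 by (intro multiplicity_lessI) auto
      moreover have "multiplicity p (2 ^ 2 * 3 ^ 2 * 7) \<ge> 2"
        using 1 by (intro multiplicity_geI) auto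
      ultimately show ?thesis by linarith
    next
      case 2
      have "\<not> (18::nat) dvd 6" by auto
      then have "multiplicity p n < 3"
        using pp [of 3 2] \<open>n > 0\<close> 2 by (intro multiplicity_lessI) auto
      moreover have "multiplicity p (2 ^ 2 * 3 ^ 2 * 7) \<ge> 2"
        using 2 by (intro multiplicity_geI) auto
      ultimately show ?thesis by linarith
    next
      case 3
      have "\<not> (4::nat) dvd 6" by presburger
      then have "multiplicity p n < 1"
        using pp [of 5 0] \<open>n > 0\<close> 3 by (intro multiplicity_lessI) auto
      then show ?thesis by linarith
    next
      case 4
      have "\<not> (42::nat) dvd 6" by auto
      then have "multiplicity p n < 2"
        using pp [of 7 1] \<open>n > 0\<close> 4 p7 by (intro multiplicity_lessI) auto
      moreover have "multiplicity p (2 ^ 2 * 3 ^ 2 * 7) \<ge> 1"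
        using 4 by (intro multiplicity_geI) auto
      ultimately show ?thesis by linarith
    next
      case 5
      then have "\<not> p - 1 dvd 6" by (auto dest: dvd_imp_le)
      then have "multiplicity p n < 1"
        using pp [of p 0] \<open>n > 0\<close> p by (intro multiplicity_lessI) auto
      then show ?thesis by linarith
    qed
  qed (use \<open>n > 0\<close> in auto)
  then show ?thesis by simp
qed

lemma dvd_set_120: "n dvd (120::nat) \<Longrightarrow> n \<in> {1,2,3,4,5,6,8,10,12,15,20,24,30,40,60,120}"
proof -
  assume "n dvd 120"
  then obtain k where k: "120 = n * k" by blast
  \<comment> \<open>One of two complementary divisors is small, as 11 * 12 exceeds 120; this leaves
    few cases on either side.\<close>
  have "n \<le> 10 \<or> k \<le> 11"
  proof (rule ccontr)
    assume "\<not> (n \<le> 10 \<or> k \<le> 11)"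
    then have "11 * 12 \<le> n * k" by (intro mult_le_mono) auto
    with k show False by simp
  qed
  then have "n \<in> {..<11} \<or> k \<in> {..<12}" by auto
  then show ?thesis
    using k by (simp add: lessThan_nat_numeral lessThan_Suc) (elim disjE; clarsimp; presburger)
qed

lemma dvd_set_252:
  "n dvd (252::nat) \<Longrightarrow> n \<in> {1,2,3,4,6,7,9,12,14,18,21,28,36,42,63,84,126,252}"
proof -
  assume "n dvd 252"
  then obtain k where k: "252 = n * k" by blast
  have "n \<le> 14 \<or> k \<le> 16"
  proof (rule ccontr)
    assume "\<not> (n \<le> 14 \<or> k \<le> 16)"
    then have "15 * 17 \<le> n * k" by (intro mult_le_mono) auto
    with k show False by simp
  qed
  then have "n \<in> {..<15} \<or> k \<in> {..<17}" by auto
  then show ?thesis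
    using k by (simp add: lessThan_nat_numeral lessThan_Suc) (elim disjE; clarsimp; presburger)
qed

lemma totient_small_odd:
  "totient 3 = 2" "totient 5 = 4" "totient 7 = 6" "totient 9 = 6" "totient 15 = 8"
  "totient 21 = 12" "totient 63 = 36"
proof -
  show 3: "totient 3 = 2" and 5: "totient 5 = 4" and 7: "totient 7 = 6"
    by (simp_all add: totient_prime)
  show 9: "totient 9 = 6"
    using totient_power_Suc [of 3 1] 3 by simp
  have cop: "coprime (3::nat) 5" "coprime (3::nat) 7" "coprime (9::nat) 7"
    by (simp_all add: coprime_iff_gcd_eq_1 gcd_non_0_nat)
  show "totient 15 = 8" "totient 21 = 12" "totient 63 = 36"
    using totient_mult_coprime [of 3 5] totient_mult_coprime [of 3 7] totient_mult_coprime [of 9 7]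
      cop 3 5 7 9 by simp_all
qed

lemma totient_values:
  "totient 3 = 2" "totient 5 = 4" "totient 7 = 6" "totient 8 = 4" "totient 9 = 6" "totient 10 = 4"
  "totient 12 = 4" "totient 14 = 6" "totient 15 = 8" "totient 18 = 6" "totient 20 = 8"
  "totient 21 = 12" "totient 24 = 8" "totient 28 = 12" "totient 30 = 8" "totient 36 = 12"
  "totient 40 = 16" "totient 42 = 12" "totient 60 = 16" "totient 63 = 36" "totient 84 = 24"
  "totient 120 = 32" "totient 126 = 36" "totient 252 = 72"
  using totient_small_odd totient_double [of 4] totient_double [of 5] totient_double [of 6]
    totient_double [of 7] totient_double [of 9] totient_double [of 10] totient_double [of 12]
    totient_double [of 14] totient_double [of 15] totient_double [of 18] totient_double [of 20]
    totient_double [of 21] totient_double [of 30] totient_double [of 42] totient_double [of 60]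
    totient_double [of 63] totient_double [of 126]
  by simp_all

lemma totient_le_2:
  assumes "totient n \<le> 2" "n > 0"
  shows "n \<in> {1, 2, 3, 4, 6}"
proof -
  have "totient n \<in> {1, 2}" using assms totient_gt_0_iff [of n] by (simp del: totient_gt_0_iff) linarith
  then have "totient n dvd 4" by auto
  from dvd_set_120 [OF totient_dvd_4 [OF this]] show ?thesis
    using assms by (auto simp: totient_values)
qed

lemma totient_eq_1: "totient n = 1 \<longleftrightarrow> n = 1 \<or> n = 2"
proof
  assume *: "totient n = 1"
  then have "n > 0" by (cases "n = 0") auto
  with totient_le_2 [of n] * show "n = 1 \<or> n = 2" by (auto simp: totient_values)
qed auto

lemma totient_eq_4:
  assumes "totient n = 4"
  shows "n \<in> {5, 8, 10, 12}"
  using dvd_set_120 [OF totient_dvd_4, of n] assms by (auto simp: totient_values)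

lemma totient_eq_6:
  assumes "totient n = 6"
  shows "n \<in> {7, 9, 14, 18}"
  using dvd_set_252 [OF totient_dvd_6, of n] assms by (auto simp: totient_values)

text \<open>Residues prime to an even number are odd.\<close>

lemma totient_le_half:
  assumes "even n"
  shows "2 * totient n \<le> n"
proof -
  from assms obtain k where n: "n = 2 * k" by blast
  have "totatives n \<subseteq> {m \<in> {0<..n}. odd m}"
    using assms by (auto simp: totatives_def dest: coprime_common_divisor_nat)
  moreover have "{m \<in> {0<..n}. odd m} = (\<lambda>i. 2 * i + 1) ` {..<k}"
    by (auto simp: n image_iff elim!: oddE)
  ultimately have "totient n \<le> card ((\<lambda>i. 2 * i + 1) ` {..<k})"
    unfolding totient_def using card_mono by (metis finite_imageI finite_lessThan)
  also have "\<dots> \<le> k" using card_image_le [of "{..<k}"] by simp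
  finally show ?thesis by (simp add: n)
qed

section \<open>Counting cyclic subgroups\<close>

context group
begin

abbreviation cyc :: "'a \<Rightarrow> 'a set" where "cyc x \<equiv> generate G {x}"

lemma cyc_self: "x \<in> cyc x"
  by (simp add: generate.incl)

lemma cyc_subset: "x \<in> carrier G \<Longrightarrow> cyc x \<subseteq> carrier G"
  by (simp add: generate_incl)

lemma cyc_mem_iff: "x \<in> carrier G \<Longrightarrow> y \<in> cyc x \<longleftrightarrow> (\<exists>k::int. y = x [^] k)"
  by (auto simp: generate_pow)

lemma cyc_mono: "x \<in> carrier G \<Longrightarrow> y \<in> cyc x \<Longrightarrow> cyc y \<subseteq> cyc x"
  by (rule generate_subgroup_incl) (auto simp: generate_is_subgroup)

lemma ord_eq_if_cyc_eq:
  "x \<in> carrier G \<Longrightarrow> y \<in> carrier G \<Longrightarrow> cyc x = cyc y \<Longrightarrow> ord x = ord y"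
  by (simp add: generate_pow_card)

lemma cyc_eqI:
  assumes "finite (carrier G)" "x \<in> carrier G" "y \<in> cyc x" "ord y = ord x"
  shows "cyc y = cyc x"
proof (rule card_subset_eq)
  show "finite (cyc x)" using assms cyc_subset finite_subset by metis
  show "cyc y \<subseteq> cyc x" using assms cyc_mono by blast
  have "y \<in> carrier G" using assms cyc_subset by blast
  then show "card (cyc y) = card (cyc x)" using assms by (simp flip: generate_pow_card)
qed

text \<open>The generators are the powers with exponent prime to \<open>ord x\<close>.\<close>

lemma card_cyc_generators:
  assumes fin: "finite (carrier G)" and x: "x \<in> carrier G"
  shows "card {y \<in> carrier G. cyc y = cyc x} = totient (ord x)"
proof -
  have pos: "ord x > 0" using ord_ge_1 [OF fin x] by simp
  have "{y \<in> carrier G. cyc y = cyc x} = (\<lambda>k. x [^] k) ` totatives (ord x)"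
  proof (intro equalityI subsetI)
    fix y assume "y \<in> {y \<in> carrier G. cyc y = cyc x}"
    then have y: "y \<in> carrier G" "cyc y = cyc x" by auto
    then have "y \<in> cyc x" using cyc_self by blast
    then obtain k :: nat where "y = x [^] k"
      unfolding generate_pow_on_finite_carrier [OF fin x] by blast
    \<comment> \<open>Totatives range from 1 to the order, so exponent 0 is represented by
      \<open>ord x\<close>; this matters for the trivial subgroup.\<close>
    moreover define j where "j = (if k mod ord x = 0 then ord x else k mod ord x)"
    have "x [^] k = x [^] j"
    proof -
      have "x [^] (int k) = x [^] (int j)"
        unfolding int_pow_eq [OF x] j_def
        by (auto simp: mod_eq_0_iff_dvd zmod_int intro: dvd_diff simp flip: mod_eq_dvd_iff)
      then show ?thesis by (simp add: int_pow_int)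
    qed
    ultimately have yj: "y = x [^] j" by simp
    have "coprime j (ord x)"
      using pow_ord_eq_ord_iff [OF fin x, of j] ord_eq_if_cyc_eq [OF y(1) x y(2)] yj by simp
    moreover have "0 < j" "j \<le> ord x"
      using pos by (auto simp: j_def intro: less_imp_le)
    ultimately show "y \<in> (\<lambda>k. x [^] k) ` totatives (ord x)"
      using yj by (auto simp: totatives_def)
  next
    fix y assume "y \<in> (\<lambda>k. x [^] k) ` totatives (ord x)"
    then obtain k where k: "k \<in> totatives (ord x)" and y: "y = x [^] k" by blast
    have "ord y = ord x"
      using pow_ord_eq_ord_iff [OF fin x, of k] k y by (simp add: totatives_def)
    moreover have "y \<in> cyc x"
      unfolding generate_pow_on_finite_carrier [OF fin x] y by blast
    ultimately show "y \<in> {y \<in> carrier G. cyc y = cyc x}"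
      using cyc_eqI [OF fin x] y x by auto
  qed
  moreover have "inj_on (\<lambda>k. x [^] k) (totatives (ord x))"
    by (rule inj_on_subset [OF ord_inj' [OF x]]) (auto simp: totatives_def)
  ultimately show ?thesis by (simp add: card_image totient_def)
qed

lemma cyclic_subgroups_eq_image: "cyclic_subgroups G = cyc ` carrier G"
proof (intro equalityI subsetI)
  fix H assume "H \<in> cyclic_subgroups G"
  then have H: "subgroup H G" "cyclic_group (G\<lparr>carrier := H\<rparr>)"
    by (auto simp: cyclic_subgroups_def)
  interpret H: group "G\<lparr>carrier := H\<rparr>" using subgroup.subgroup_is_group [OF H(1) is_group] .
  obtain x where x: "x \<in> H" "H = range (\<lambda>n::int. x [^]\<^bsub>G\<lparr>carrier := H\<rparr>\<^esub> n)"
    using H(2) unfolding H.cyclic_group by auto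
  have xc: "x \<in> carrier G" using x(1) H(1) subgroup.mem_carrier by metis
  have "H = cyc x"
    using x(2) int_pow_consistent [OF H(1) x(1)] generate_pow [OF xc] by auto
  then show "H \<in> cyc ` carrier G" using xc by blast
next
  fix H assume "H \<in> cyc ` carrier G"
  then obtain x where x: "x \<in> carrier G" "H = cyc x" by blast
  have sub: "subgroup H G" using x by (simp add: generate_is_subgroup)
  interpret H: group "G\<lparr>carrier := H\<rparr>" using subgroup.subgroup_is_group [OF sub is_group] .
  have "x \<in> H" using x cyc_self by simp
  then have "cyclic_group (G\<lparr>carrier := H\<rparr>)"
    unfolding H.cyclic_group
  proof (intro bexI)
    show "carrier (G\<lparr>carrier := H\<rparr>) = range (\<lambda>n::int. x [^]\<^bsub>G\<lparr>carrier := H\<rparr>\<^esub> n)"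
      unfolding int_pow_consistent [OF sub \<open>x \<in> H\<close>, symmetric]
      using x(2) generate_pow [OF x(1)] by (simp add: full_SetCompr_eq)
  qed (use \<open>x \<in> H\<close> in simp)
  then show "H \<in> cyclic_subgroups G" using sub by (simp add: cyclic_subgroups_def)
qed

lemma sum_totient_cyclic_subgroups:
  assumes fin: "finite (carrier G)"
  shows "(\<Sum>C\<in>cyclic_subgroups G. totient (card C)) = order G"
proof -
  have "order G = (\<Sum>x\<in>carrier G. 1)" by (simp add: order_def)
  also have "\<dots> = (\<Sum>C\<in>cyc ` carrier G. \<Sum>x\<in>{x. x \<in> carrier G \<and> cyc x = C}. 1)"
    by (rule sum.image_gen [OF fin])
  also have "\<dots> = (\<Sum>C\<in>cyc ` carrier G. totient (card C))"
  proof (rule sum.cong [OF HOL.refl])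
    fix C assume "C \<in> cyc ` carrier G"
    then obtain x where "x \<in> carrier G" "C = cyc x" by blast
    then show "(\<Sum>x\<in>{x. x \<in> carrier G \<and> cyc x = C}. 1) = totient (card C)"
      using card_cyc_generators [OF fin, of x] by (simp add: generate_pow_card)
  qed
  finally show ?thesis by (simp add: cyclic_subgroups_eq_image)
qed

lemma finite_cyclic_subgroups: "finite (carrier G) \<Longrightarrow> finite (cyclic_subgroups G)"
  by (simp add: cyclic_subgroups_eq_image)

text \<open>Totient 1 means a unique generator, so \<open>cyc\<close> is injective on the elements
  of order at most 2; the summand 1 is the trivial subgroup.\<close>

lemma card_small_cyclic_subgroups:
  assumes fin: "finite (carrier G)"
  shows "card {C \<in> cyclic_subgroups G. totient (card C) = 1} = 1 + involution_count G"
proof -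
  have "{C \<in> cyclic_subgroups G. totient (card C) = 1} =
      cyc ` ({\<one>} \<union> {x \<in> carrier G. ord x = 2})"
  proof -
    have "{\<one>} \<union> {x \<in> carrier G. ord x = 2} = {x \<in> carrier G. totient (ord x) = 1}"
      by (auto simp: totient_eq_1 [unfolded One_nat_def] ord_eq_1 [unfolded One_nat_def])
    then show ?thesis
      unfolding cyclic_subgroups_eq_image using generate_pow_card by auto
  qed
  moreover have "inj_on cyc ({\<one>} \<union> {x \<in> carrier G. ord x = 2})"
  proof (rule inj_onI)
    fix x y
    assume "x \<in> {\<one>} \<union> {x \<in> carrier G. ord x = 2}" "y \<in> {\<one>} \<union> {x \<in> carrier G. ord x = 2}"
      and eq: "cyc x = cyc y"
    then have x: "x \<in> carrier G" "ord x = 1 \<or> ord x = 2" and y: "y \<in> carrier G"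
      by (auto simp: ord_eq_1)
    have "card {z \<in> carrier G. cyc z = cyc x} = 1"
      using card_cyc_generators [OF fin x(1)] x(2) by auto
    then obtain w where "{z \<in> carrier G. cyc z = cyc x} = {w}"
      by (auto simp: card_1_singleton_iff)
    then show "x = y" using x y eq by (metis (mono_tags, lifting) mem_Collect_eq singletonD)
  qed
  ultimately have "card {C \<in> cyclic_subgroups G. totient (card C) = 1} =
      card ({\<one>} \<union> {x \<in> carrier G. ord x = 2})"
    by (simp only: card_image)
  also have "\<dots> = 1 + card {x \<in> carrier G. ord x = 2}"
    using fin by (subst card_Un_disjoint) auto
  finally show ?thesis by (simp add: involution_count_def)
qed

definition big_cyclic :: "'a set set" where
  "big_cyclic = {C \<in> cyclic_subgroups G. totient (card C) > 2}"

lemma finite_big_cyclic: "finite (carrier G) \<Longrightarrow> finite big_cyclic"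
  by (simp add: big_cyclic_def finite_cyclic_subgroups)

lemma sum_cyclic_subgroups_split:
  fixes f :: "'a set \<Rightarrow> nat"
  assumes fin: "finite (carrier G)"
  shows "sum f (cyclic_subgroups G) = sum f {C \<in> cyclic_subgroups G. totient (card C) = 1}
    + sum f {C \<in> cyclic_subgroups G. totient (card C) = 2} + sum f big_cyclic"
proof -
  let ?S = "cyclic_subgroups G"
  have pos: "totient (card C) > 0" if "C \<in> ?S" for C
  proof -
    from that obtain x where "x \<in> carrier G" "C = cyc x" by (auto simp: cyclic_subgroups_eq_image)
    then show ?thesis using ord_ge_1 [OF fin, of x] by (simp flip: generate_pow_card)
  qed
  have S: "?S = {C \<in> ?S. totient (card C) = 1} \<union> {C \<in> ?S. totient (card C) = 2} \<union> big_cyclic"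
  proof -
    have "totient (card C) = 1 \<or> totient (card C) = 2 \<or> totient (card C) > 2" if "C \<in> ?S" for C
      using pos [OF that] by linarith
    then show ?thesis unfolding big_cyclic_def by blast
  qed
  have fS: "finite ?S" by (rule finite_cyclic_subgroups [OF fin])
  have "sum f ?S = sum f ({C \<in> ?S. totient (card C) = 1} \<union> {C \<in> ?S. totient (card C) = 2} \<union> big_cyclic)"
    by (rule arg_cong [OF S])
  also have "\<dots> = sum f ({C \<in> ?S. totient (card C) = 1} \<union> {C \<in> ?S. totient (card C) = 2}) + sum f big_cyclic"
  proof (rule sum.union_disjoint)
    show "({C \<in> ?S. totient (card C) = 1} \<union> {C \<in> ?S. totient (card C) = 2}) \<inter> big_cyclic = {}"
      unfolding big_cyclic_def by auto
  qed (use fS finite_big_cyclic [OF fin] in simp_all)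
  also have "sum f ({C \<in> ?S. totient (card C) = 1} \<union> {C \<in> ?S. totient (card C) = 2}) =
      sum f {C \<in> ?S. totient (card C) = 1} + sum f {C \<in> ?S. totient (card C) = 2}"
  proof (rule sum.union_disjoint)
    show "{C \<in> ?S. totient (card C) = 1} \<inter> {C \<in> ?S. totient (card C) = 2} = {}"
      by auto
  qed (use fS in simp_all)
  finally show ?thesis .
qed

text \<open>The numbers totient - 2 sum to zero over all cyclic subgroups: each subgroup of order 1
  or 2 contributes -1, those with totient 2 contribute nothing. The equation is arranged without
  subtraction on natural numbers.\<close>

lemma sum_big_cyclic:
  assumes fin: "finite (carrier G)" and half: "2 * card (cyclic_subgroups G) = order G"
  shows "(\<Sum>C\<in>big_cyclic. totient (card C)) = 1 + involution_count G + 2 * card big_cyclic"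
proof -
  let ?t = "\<lambda>C. totient (card C)"
  have "sum ?t (cyclic_subgroups G) = (\<Sum>C\<in>cyclic_subgroups G. 2)"
    using sum_totient_cyclic_subgroups [OF fin] half by simp
  then have "sum ?t big_cyclic =
      card {C \<in> cyclic_subgroups G. ?t C = 1} + 2 * card big_cyclic"
    unfolding sum_cyclic_subgroups_split [OF fin, of ?t]
      sum_cyclic_subgroups_split [OF fin, of "\<lambda>_. 2"] by simp
  then show ?thesis using card_small_cyclic_subgroups [OF fin] by simp
qed

lemma order_eq_small_plus_rest:
  assumes fin: "finite (carrier G)"
  shows "order G = 1 + involution_count G + 2 * card {C \<in> cyclic_subgroups G. totient (card C) = 2}
    + (\<Sum>C\<in>big_cyclic. totient (card C))"
  using sum_totient_cyclic_subgroups [OF fin] card_small_cyclic_subgroups [OF fin]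
  unfolding sum_cyclic_subgroups_split [OF fin, of "\<lambda>C. totient (card C)"] by simp

end

section \<open>Extensions of an abelian group by an element of square \<open>c\<close>\<close>

text \<open>\<open>(u, i)\<close> stands for u x^i, where conjugation by x is
  \<open>\<sigma>\<close> and x^2 = \<open>c\<close>. Moving x past v applies
  \<open>\<sigma>\<close>, and two factors x leave one \<open>c\<close> behind.\<close>

definition double_ext :: "('a, 'b) monoid_scheme \<Rightarrow> ('a \<Rightarrow> 'a) \<Rightarrow> 'a \<Rightarrow> ('a \<times> bool) monoid" where
  "double_ext A \<sigma> c =
     \<lparr>carrier = carrier A \<times> UNIV,
      monoid.mult = (\<lambda>(u, i) (v, j).
        (u \<otimes>\<^bsub>A\<^esub> (if i then \<sigma> v else v) \<otimes>\<^bsub>A\<^esub> (if i \<and> j then c else \<one>\<^bsub>A\<^esub>), i \<noteq> j)),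
      one = (\<one>\<^bsub>A\<^esub>, False)\<rparr>"

text \<open>The conditions are those that an extension forces: x^2 lies in the abelian group and
  acts trivially on it, so \<open>\<sigma>\<close> is its own inverse; and x commutes with its own
  square, so \<open>\<sigma>\<close> fixes \<open>c\<close>.\<close>

lemma group_double_ext:
  assumes "comm_group A" and hom: "\<sigma> \<in> hom A A"
    and inv: "\<And>u. u \<in> carrier A \<Longrightarrow> \<sigma> (\<sigma> u) = u"
    and c: "c \<in> carrier A" "\<sigma> c = c"
  shows "group (double_ext A \<sigma> c)"
proof -
  interpret A: comm_group A by fact
  have \<sigma>: "\<sigma> u \<in> carrier A" if "u \<in> carrier A" for u
    using hom that by (auto simp: hom_def)
  have mult: "\<sigma> (u \<otimes>\<^bsub>A\<^esub> v) = \<sigma> u \<otimes>\<^bsub>A\<^esub> \<sigma> v" if "u \<in> carrier A" "v \<in> carrier A" for u v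
    using hom that by (auto simp: hom_def)
  have one: "\<sigma> \<one>\<^bsub>A\<^esub> = \<one>\<^bsub>A\<^esub>"
    using hom_one [OF hom A.is_group A.is_group] .
  show ?thesis
  proof (rule groupI)
    fix e assume "e \<in> carrier (double_ext A \<sigma> c)"
    then obtain u i where e: "e = (u, i)" "u \<in> carrier A" by (auto simp: double_ext_def)
    let ?y = "(if i then inv\<^bsub>A\<^esub> (\<sigma> u \<otimes>\<^bsub>A\<^esub> c) else inv\<^bsub>A\<^esub> u, i)"
    have "?y \<otimes>\<^bsub>double_ext A \<sigma> c\<^esub> e = \<one>\<^bsub>double_ext A \<sigma> c\<^esub>"
      using e \<sigma> c by (auto simp: double_ext_def A.m_assoc)
    moreover have "?y \<in> carrier (double_ext A \<sigma> c)"
      using e \<sigma> c by (auto simp: double_ext_def)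
    ultimately show "\<exists>y\<in>carrier (double_ext A \<sigma> c).
        y \<otimes>\<^bsub>double_ext A \<sigma> c\<^esub> e = \<one>\<^bsub>double_ext A \<sigma> c\<^esub>" by blast
  qed (auto simp: double_ext_def \<sigma> c mult one inv A.m_ac)
qed

section \<open>The model groups\<close>

abbreviation (input) two_cyclic :: "nat \<Rightarrow> nat \<Rightarrow> (int \<times> int) monoid" where
  "two_cyclic m s \<equiv> integer_mod_group m \<times>\<times> integer_mod_group s"

text \<open>
  The group on \<open>a\<close>, \<open>t\<close>, \<open>x\<close> with \<open>a\<close> and \<open>t\<close> commuting of orders \<open>m\<close> and \<open>s\<close>, \<open>x a x\<^sup>-\<^sup>1 = a\<^sup>p t\<^sup>r\<close>,
  \<open>x t x\<^sup>-\<^sup>1 = a\<^sup>q t\<close> and \<open>x\<^sup>2 = a\<^sup>c t\<^sup>d\<close>; the Boolean is the exponent of \<open>x\<close>. Every nonabelian group of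
  the classification is of this form.
\<close>

definition dbl :: "nat \<Rightarrow> nat \<Rightarrow> int \<Rightarrow> int \<Rightarrow> int \<Rightarrow> int \<Rightarrow> int \<Rightarrow> ((int \<times> int) \<times> bool) monoid" where
  "dbl m s p q r c d = double_ext (two_cyclic m s)
     (\<lambda>(i, j). ((p * i + q * j) mod int m, (r * i + j) mod int s)) (c mod int m, d mod int s)"

text \<open>The divisibility says that multiplication by \<open>q\<close> is well defined from
  residues modulo \<open>s\<close> to residues modulo \<open>m\<close>.\<close>

lemma mod_coeff_mod:
  fixes m s q y z :: int
  assumes "m dvd q * s"
  shows "(z + q * (y mod s)) mod m = (z + q * y) mod m"
proof -
  have "z + q * y - (z + q * (y mod s)) = q * (y - y mod s)" by (simp add: algebra_simps)
  also have "\<dots> = q * s * (y div s)" by (simp add: minus_mod_eq_mult_div)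
  finally have "m dvd z + q * y - (z + q * (y mod s))" using assms by simp
  then show ?thesis by (metis mod_eq_dvd_iff)
qed

lemma mod_mult_mod_add:
  fixes m p x y :: int
  shows "(p * (x mod m) + y) mod m = (p * x + y) mod m"
  by (subst (1 2) add.commute) (rule mod_coeff_mod, rule dvd_triv_right)

text \<open>On exponents of (a, t), conjugation by x is the matrix with rows (p, q) and (r, 1).
  \<open>wd\<close> makes it well defined on residues, \<open>inv\<close> lists the entries of its
  square minus the identity, and \<open>fixed\<close> says that it fixes the vector (c, d). For
  concrete parameters all of this is decided by evaluation.\<close>

lemma group_dbl:
  fixes p q r c d :: int
  assumes pos: "m > 0" "s > 0"
    and wd: "int m dvd q * int s" "int s dvd r * int m"
    and inv: "int m dvd p * p + q * r - 1" "int m dvd p * q + q" "int s dvd r * p + r" "int s dvd r * q"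
    and fixed: "int m dvd p * c + q * d - c" "int s dvd r * c"
  shows "group (dbl m s p q r c d)"
  unfolding dbl_def
proof (rule group_double_ext)
  let ?\<sigma> = "\<lambda>(i, j). ((p * i + q * j) mod int m, (r * i + j) mod int s)"
  show "comm_group (two_cyclic m s)"
  proof (rule group.group_comm_groupI [OF DirProd_group])
    fix x y assume "x \<in> carrier (two_cyclic m s)" "y \<in> carrier (two_cyclic m s)"
    show "x \<otimes>\<^bsub>two_cyclic m s\<^esub> y = y \<otimes>\<^bsub>two_cyclic m s\<^esub> x"
      by (cases x; cases y) (simp add: add.commute)
  qed auto
  have carr: "(i, j) \<in> carrier (two_cyclic m s) \<longleftrightarrow> 0 \<le> i \<and> i < int m \<and> 0 \<le> j \<and> j < int s" for i j
    using pos by (auto simp: carrier_integer_mod_group)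
  note coeff = mod_coeff_mod [OF wd(1)] mod_coeff_mod [OF wd(2)]
  have coeff': "(r * (y mod int m) + z) mod int s = (r * y + z) mod int s" for y z
    using coeff(2) [of z y] by (simp add: add.commute)
  show "?\<sigma> \<in> hom (two_cyclic m s) (two_cyclic m s)"
  proof (rule homI)
    fix x assume "x \<in> carrier (two_cyclic m s)"
    then show "?\<sigma> x \<in> carrier (two_cyclic m s)"
      using pos by (auto simp: carrier_integer_mod_group)
  next
    fix x y assume "x \<in> carrier (two_cyclic m s)" "y \<in> carrier (two_cyclic m s)"
    obtain i j i' j' where xy: "x = (i, j)" "y = (i', j')" by (cases x, cases y) auto
    have "(p * ((i + i') mod int m) + q * ((j + j') mod int s)) mod int m =
        (p * ((i + i') mod int m) + q * (j + j')) mod int m"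
      by (rule coeff)
    also have "\<dots> = (p * (i + i') + q * (j + j')) mod int m"
      by (rule mod_mult_mod_add)
    also have "\<dots> = ((p * i + q * j) mod int m + (p * i' + q * j') mod int m) mod int m"
      by (simp only: mod_simps) (simp add: algebra_simps)
    moreover have "(r * ((i + i') mod int m) + (j + j') mod int s) mod int s =
        (r * (i + i') + (j + j') mod int s) mod int s"
      by (rule coeff')
    moreover have "\<dots> = ((r * i + j) mod int s + (r * i' + j') mod int s) mod int s"
      by (simp only: mod_simps) (simp add: algebra_simps)
    ultimately show "?\<sigma> (x \<otimes>\<^bsub>two_cyclic m s\<^esub> y) = ?\<sigma> x \<otimes>\<^bsub>two_cyclic m s\<^esub> ?\<sigma> y"
      by (simp add: xy)
  qed
  show "?\<sigma> (?\<sigma> u) = u" if "u \<in> carrier (two_cyclic m s)" for u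
  proof -
    obtain i j where u: "u = (i, j)" by (cases u)
    have ij: "i mod int m = i" "j mod int s = j"
      using that unfolding u carr by auto
    have "(p * ((p * i + q * j) mod int m) + q * ((r * i + j) mod int s)) mod int m =
        (p * ((p * i + q * j) mod int m) + q * (r * i + j)) mod int m"
      by (rule coeff)
    also have "\<dots> = (p * (p * i + q * j) + q * (r * i + j)) mod int m"
      by (rule mod_mult_mod_add)
    also have "\<dots> = i mod int m"
    proof -
      have "p * (p * i + q * j) + q * (r * i + j) - i =
          (p * p + q * r - 1) * i + (p * q + q) * j" by (simp add: algebra_simps)
      also have "int m dvd \<dots>" using inv by auto
      finally show ?thesis by (simp add: mod_eq_dvd_iff)
    qed
    moreover have "(r * ((p * i + q * j) mod int m) + (r * i + j) mod int s) mod int s =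
        (r * (p * i + q * j) + (r * i + j) mod int s) mod int s"
      by (rule coeff')
    moreover have "\<dots> = (r * (p * i + q * j) + (r * i + j)) mod int s"
      by (simp add: mod_simps)
    moreover have "\<dots> = j mod int s"
    proof -
      have "r * (p * i + q * j) + (r * i + j) - j = (r * p + r) * i + (r * q) * j"
        by (simp add: algebra_simps)
      also have "int s dvd \<dots>" using inv by auto
      finally show ?thesis by (simp add: mod_eq_dvd_iff)
    qed
    ultimately show ?thesis by (simp add: u ij)
  qed
  show "(c mod int m, d mod int s) \<in> carrier (two_cyclic m s)"
    using pos unfolding carr by auto
  have "(p * (c mod int m) + q * (d mod int s)) mod int m = (p * (c mod int m) + q * d) mod int m"
    by (rule coeff)
  also have "\<dots> = (p * c + q * d) mod int m"
    by (rule mod_mult_mod_add)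
  also have "\<dots> = c mod int m"
    using fixed by (simp add: mod_eq_dvd_iff)
  moreover have "(r * (c mod int m) + d mod int s) mod int s = (r * c + d mod int s) mod int s"
    by (rule coeff')
  moreover have "\<dots> = d mod int s"
    using fixed by (simp add: mod_simps mod_eq_dvd_iff)
  ultimately show "?\<sigma> (c mod int m, d mod int s) = (c mod int m, d mod int s)"
    by simp
qed

lemma carrier_dbl:
  "m > 0 \<Longrightarrow> s > 0 \<Longrightarrow> carrier (dbl m s p q r c d) = ({0..<int m} \<times> {0..<int s}) \<times> UNIV"
  by (simp add: dbl_def double_ext_def carrier_integer_mod_group)

lemma one_dbl: "\<one>\<^bsub>dbl m s p q r c d\<^esub> = ((0, 0), False)"
  by (simp add: dbl_def double_ext_def)

lemma mult_dbl:
  "((i, j), k) \<otimes>\<^bsub>dbl m s p q r c d\<^esub> ((i', j'), k') =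
    (((i + (if k then p * i' + q * j' else i') + (if k \<and> k' then c else 0)) mod int m,
      (j + (if k then r * i' + j' else j') + (if k \<and> k' then d else 0)) mod int s), k \<noteq> k')"
  by (auto simp: dbl_def double_ext_def mod_simps)

lemma order_dbl: "m > 0 \<Longrightarrow> s > 0 \<Longrightarrow> order (dbl m s p q r c d) = 2 * m * s"
  by (simp add: order_def carrier_dbl card_cartesian_product UNIV_bool)

section \<open>Recognising the model groups\<close>

context group
begin

lemma inv_mult_cancel [simp]:
  "x \<in> carrier G \<Longrightarrow> y \<in> carrier G \<Longrightarrow> inv x \<otimes> (x \<otimes> y) = y"
  "x \<in> carrier G \<Longrightarrow> y \<in> carrier G \<Longrightarrow> x \<otimes> (inv x \<otimes> y) = y"
  by (simp_all flip: m_assoc)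

lemma int_pow_mod:
  assumes "x \<in> carrier G" "x [^] m = \<one>"
  shows "x [^] (k mod int m) = x [^] k"
proof -
  have "int (ord x) dvd int m" using assms by (simp add: pow_eq_id)
  then have "int (ord x) dvd k - k mod int m" by (rule dvd_trans) (rule dvd_minus_mod)
  then show ?thesis
    using assms(1) by (simp add: int_pow_eq)
qed

text \<open>Conjugation by \<open>x\<close> is an endomorphism. The relation is stated without
  inverses because later computations push \<open>x\<close> to the right of a word.\<close>

lemma conj_int_pow:
  assumes c: "x \<in> carrier G" "a \<in> carrier G" "b \<in> carrier G" and eq: "x \<otimes> a = b \<otimes> x"
  shows "x \<otimes> a [^] (k::int) = b [^] k \<otimes> x"
proof -
  have hom: "(\<lambda>u. x \<otimes> u \<otimes> inv x) \<in> hom G G"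
    using c by (intro homI) (simp_all add: m_assoc)
  have "x \<otimes> a \<otimes> inv x = b"
    using c eq by (simp add: m_assoc)
  then have "x \<otimes> a [^] k \<otimes> inv x = b [^] k"
    using hom_int_pow [OF hom c(2) is_group is_group, of k] by simp
  then show ?thesis
    using c by (metis inv_solve_right int_pow_closed m_closed)
qed

lemmas int_pow_commute = conj_int_pow [where a = a and b = a for a]

lemma int_pow_commute2:
  assumes "x \<in> carrier G" "y \<in> carrier G" "x \<otimes> y = y \<otimes> x"
  shows "x [^] (k::int) \<otimes> y [^] (l::int) = y [^] l \<otimes> x [^] k"
proof (rule conj_int_pow)
  show "x [^] k \<otimes> y = y \<otimes> x [^] k"
    using conj_int_pow [of y x x k] assms by simp
qed (use assms in simp_all)

end

text \<open>Only the relations are required, not independence of the generators. Thus a presented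
  group qualifies before anything is known about its size; the relations alone give a homomorphism
  from the model, and injectivity is a separate matter.\<close>

locale dbl_gens = group G for G (structure) +
  fixes a t x and m s :: nat and p q r c d :: int
  assumes closed [simp]: "a \<in> carrier G" "t \<in> carrier G" "x \<in> carrier G"
    and pos: "m > 0" "s > 0"
    and pow_m: "a [^] m = \<one>" and pow_s: "t [^] s = \<one>" and comm: "a \<otimes> t = t \<otimes> a"
    and x_a: "x \<otimes> a = a [^] p \<otimes> t [^] r \<otimes> x"
    and x_t: "x \<otimes> t = a [^] q \<otimes> t \<otimes> x"
    and x_x: "x \<otimes> x = a [^] c \<otimes> t [^] d"
begin

definition E :: "int \<Rightarrow> int \<Rightarrow> 'a" where "E i j = a [^] i \<otimes> t [^] j"

lemma E_closed [simp]: "E i j \<in> carrier G"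
  by (simp add: E_def)

lemma E_mult: "E i j \<otimes> E i' j' = E (i + i') (j + j')"
proof -
  have "a [^] i \<otimes> t [^] j \<otimes> (a [^] i' \<otimes> t [^] j') = a [^] i \<otimes> (a [^] i' \<otimes> t [^] j) \<otimes> t [^] j'"
    using int_pow_commute2 [OF closed(1,2) comm, of i' j] by (simp add: m_assoc flip: m_assoc)
  then show ?thesis by (simp add: E_def m_assoc int_pow_mult)
qed

lemma E_mod: "E (i mod int m) (j mod int s) = E i j"
  by (simp add: E_def int_pow_mod pow_m pow_s)

lemma E_0: "E 0 0 = \<one>"
  by (simp add: E_def)

lemma x_E: "x \<otimes> E i j = E (p * i + q * j) (r * i + j) \<otimes> x"
proof -
  have at: "a [^] k \<otimes> t [^] l = t [^] l \<otimes> a [^] k" for k l :: int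
    by (rule int_pow_commute2) (simp_all add: comm)
  have aq: "a [^] q \<otimes> t = t \<otimes> a [^] q" using at [of q 1] by simp
  have "x \<otimes> a [^] i = (a [^] p \<otimes> t [^] r) [^] i \<otimes> x"
    by (rule conj_int_pow) (simp_all add: x_a)
  also have "(a [^] p \<otimes> t [^] r) [^] i = E (p * i) (r * i)"
    by (simp add: int_pow_mult_distrib [OF at] int_pow_pow E_def)
  finally have 1: "x \<otimes> a [^] i = E (p * i) (r * i) \<otimes> x" .
  have "x \<otimes> t [^] j = (a [^] q \<otimes> t) [^] j \<otimes> x"
    by (rule conj_int_pow) (simp_all add: x_t)
  also have "(a [^] q \<otimes> t) [^] j = E (q * j) j"
    by (simp add: int_pow_mult_distrib [OF aq] int_pow_pow E_def)
  finally have 2: "x \<otimes> t [^] j = E (q * j) j \<otimes> x" .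
  have "x \<otimes> E i j = x \<otimes> a [^] i \<otimes> t [^] j" by (simp add: E_def m_assoc)
  also have "\<dots> = E (p * i) (r * i) \<otimes> (x \<otimes> t [^] j)" by (simp add: 1 m_assoc)
  also have "\<dots> = E (p * i) (r * i) \<otimes> E (q * j) j \<otimes> x" by (simp add: 2 m_assoc)
  finally show ?thesis by (simp add: E_mult)
qed

definition emb :: "(int \<times> int) \<times> bool \<Rightarrow> 'a" where
  "emb = (\<lambda>((i, j), k). E i j \<otimes> (if k then x else \<one>))"

lemma emb_closed [simp]: "emb e \<in> carrier G"
  by (auto simp: emb_def split: prod.split)

lemma emb_hom: "emb \<in> hom (dbl m s p q r c d) G"
proof (rule homI)
  fix e f :: "(int \<times> int) \<times> bool"
  obtain i j k i' j' k' where ef: "e = ((i, j), k)" "f = ((i', j'), k')"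
    by (metis surj_pair)
  have xx: "x \<otimes> x = E c d" by (simp add: x_x E_def)
  have xE: "x \<otimes> (E i j \<otimes> w) = E (p * i + q * j) (r * i + j) \<otimes> (x \<otimes> w)"
    if "w \<in> carrier G" for i j w
    using that x_E [of i j] by (simp flip: m_assoc)
  have EE: "E i j \<otimes> (E i' j' \<otimes> w) = E (i + i') (j + j') \<otimes> w"
    if "w \<in> carrier G" for i j i' j' w
    using that by (simp add: E_mult flip: m_assoc)
  show "emb (e \<otimes>\<^bsub>dbl m s p q r c d\<^esub> f) = emb e \<otimes> emb f"
    by (cases k; cases k')
      (simp_all add: ef mult_dbl emb_def E_mod E_mult EE x_E xE xx m_assoc add.assoc)
qed simp

lemma emb_inj:
  assumes indep: "\<And>i j. E i j = \<one> \<Longrightarrow> int m dvd i \<and> int s dvd j"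
    and x: "\<And>i j. x \<noteq> E i j"
    and grp: "group (dbl m s p q r c d)"
  shows "inj_on emb (carrier (dbl m s p q r c d))"
proof -
  interpret D: group_hom "dbl m s p q r c d" G emb
    by (rule group_hom.intro [OF grp is_group group_hom_axioms.intro [OF emb_hom]])
  show ?thesis
    unfolding D.inj_on_one_iff
  proof (intro allI impI)
    fix e assume e: "e \<in> carrier (dbl m s p q r c d)" "emb e = \<one>"
    obtain i j k where ijk: "e = ((i, j), k)" by (metis surj_pair)
    have "\<not> k"
    proof
      assume k
      then have "E i j \<otimes> x = \<one>" using e by (simp add: ijk emb_def)
      then have "E (- i) (- j) \<otimes> (E i j \<otimes> x) = E (- i) (- j)" by simp
      then have "x = E (- i) (- j)" by (simp add: E_mult E_0 flip: m_assoc)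
      then show False using x by blast
    qed
    moreover from this have "int m dvd i" "int s dvd j"
      using indep e by (auto simp: ijk emb_def)
    moreover have "0 \<le> i" "i < int m" "0 \<le> j" "j < int s"
      using e(1) pos by (auto simp: ijk carrier_dbl)
    ultimately show "e = \<one>\<^bsub>dbl m s p q r c d\<^esub>"
      by (auto simp: ijk one_dbl dest: zdvd_imp_le)
  qed
qed

lemma emb_image_E: "E i j \<in> emb ` carrier (dbl m s p q r c d)"
proof
  show "E i j = emb ((i mod int m, j mod int s), False)"
    by (simp add: emb_def E_mod)
qed (use pos in \<open>auto simp: carrier_dbl\<close>)

lemma emb_image_Ex: "E i j \<otimes> x \<in> emb ` carrier (dbl m s p q r c d)"
proof
  show "E i j \<otimes> x = emb ((i mod int m, j mod int s), True)"
    by (simp add: emb_def E_mod)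
qed (use pos in \<open>auto simp: carrier_dbl\<close>)

lemma iso_dbl:
  assumes indep: "\<And>i j. E i j = \<one> \<Longrightarrow> int m dvd i \<and> int s dvd j"
    and x: "\<And>i j. x \<noteq> E i j"
    and grp: "group (dbl m s p q r c d)"
    and surj: "carrier G \<subseteq> range (\<lambda>(i, j). E i j) \<union> range (\<lambda>(i, j). E i j \<otimes> x)"
  shows "G \<cong> dbl m s p q r c d"
proof -
  have "emb \<in> iso (dbl m s p q r c d) G"
  proof (rule isoI [OF emb_hom])
    have "emb ` carrier (dbl m s p q r c d) = carrier G"
      using surj emb_image_E emb_image_Ex by auto
    then show "bij_betw emb (carrier (dbl m s p q r c d)) (carrier G)"
      using emb_inj [OF indep x grp] by (simp add: bij_betw_def)
  qed
  then have "dbl m s p q r c d \<cong> G" by (rule is_isoI)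
  then show ?thesis by (rule group.iso_sym [OF grp])
qed

lemma iso_dbl_order:
  assumes indep: "\<And>i j. E i j = \<one> \<Longrightarrow> int m dvd i \<and> int s dvd j"
    and x: "\<And>i j. x \<noteq> E i j"
    and grp: "group (dbl m s p q r c d)"
    and ord: "finite (carrier G)" "order G = 2 * m * s"
  shows "G \<cong> dbl m s p q r c d"
proof -
  have inj: "inj_on emb (carrier (dbl m s p q r c d))" by (rule emb_inj [OF indep x grp])
  have "card (emb ` carrier (dbl m s p q r c d)) = card (carrier G)"
    using card_image [OF inj] order_dbl [OF pos, of p q r c d] ord by (simp add: order_def)
  then have "emb ` carrier (dbl m s p q r c d) = carrier G"
    by (intro card_subset_eq ord) auto
  then have "emb \<in> iso (dbl m s p q r c d) G"
    using inj by (intro isoI emb_hom) (simp add: bij_betw_def)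
  then have "dbl m s p q r c d \<cong> G" by (rule is_isoI)
  then show ?thesis by (rule group.iso_sym [OF grp])
qed

end

section \<open>Involutions of the model groups\<close>

lemma (in group) ord_eq_2_iff:
  assumes "x \<in> carrier G"
  shows "ord x = 2 \<longleftrightarrow> x \<noteq> \<one> \<and> x \<otimes> x = \<one>"
proof -
  have 2: "x [^] (2::nat) = x \<otimes> x" using assms by (simp add: numeral_2_eq_2)
  show ?thesis
  proof
    assume "ord x = 2"
    then show "x \<noteq> \<one> \<and> x \<otimes> x = \<one>"
      using assms pow_eq_id [OF assms, of 2] 2 by auto
  next
    assume *: "x \<noteq> \<one> \<and> x \<otimes> x = \<one>"
    then have "ord x dvd 2" using pow_eq_id [OF assms, of 2] 2 by simp
    then have "ord x \<le> 2" "ord x \<noteq> 0" by (auto dest: dvd_imp_le intro: Nat.gr0I)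
    moreover have "ord x \<noteq> 1" using ord_eq_1 [OF assms] * by blast
    ultimately show "ord x = 2" by linarith
  qed
qed

lemma (in group) involution_count_eq:
  "involution_count G = card {x \<in> carrier G. x \<noteq> \<one> \<and> x \<otimes> x = \<one>}"
proof -
  have "{x \<in> carrier G. ord x = 2} = {x \<in> carrier G. x \<noteq> \<one> \<and> x \<otimes> x = \<one>}"
    using ord_eq_2_iff by blast
  then show ?thesis by (simp add: involution_count_def)
qed

lemma involution_count_iso:
  assumes "G \<cong> H" "group G" "group H"
  shows "involution_count G = involution_count H"
proof -
  interpret G: group G by fact
  interpret H: group H by fact
  obtain h where h: "h \<in> iso G H" using assms(1) by (auto simp: is_iso_def)
  then have hom: "h \<in> hom G H" and bij: "bij_betw h (carrier G) (carrier H)"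
    by (auto simp: iso_def)
  interpret h: group_hom G H h
    by (rule group_hom.intro [OF G.is_group H.is_group group_hom_axioms.intro [OF hom]])
  have one: "h x = \<one>\<^bsub>H\<^esub> \<longleftrightarrow> x = \<one>\<^bsub>G\<^esub>" if "x \<in> carrier G" for x
    using bij that h.hom_one by (metis G.one_closed bij_betw_imp_inj_on inj_onD)
  have "h ` {x \<in> carrier G. x \<noteq> \<one>\<^bsub>G\<^esub> \<and> x \<otimes>\<^bsub>G\<^esub> x = \<one>\<^bsub>G\<^esub>} =
      {x \<in> carrier H. x \<noteq> \<one>\<^bsub>H\<^esub> \<and> x \<otimes>\<^bsub>H\<^esub> x = \<one>\<^bsub>H\<^esub>}" (is "h ` ?X = ?Y")
  proof
    show "h ` ?X \<subseteq> ?Y" using one by (auto simp flip: h.hom_mult)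
    show "?Y \<subseteq> h ` ?X"
    proof
      fix y assume y: "y \<in> ?Y"
      then obtain x where x: "x \<in> carrier G" "y = h x"
        using bij by (auto simp: bij_betw_def)
      then have "x \<in> ?X" using y one by (auto simp flip: h.hom_mult)
      then show "y \<in> h ` ?X" using x by blast
    qed
  qed
  moreover have "inj_on h ?X"
    using bij by (auto simp: bij_betw_def intro: inj_on_subset)
  ultimately show ?thesis
    unfolding G.involution_count_eq H.involution_count_eq using card_image [of h ?X] by simp
qed

lemma card_pairs_minus_zero:
  assumes "s = 1 \<or> s = (2::nat)" "k > 0"
  shows "card (({0, int k} \<times> {0..<int s} - {(0, 0)}) \<times> {b}) = 2 * s - 1"
proof -
  have "card ({0, int k} \<times> {0..<int s} - {(0, 0)}) = card ({0, int k} \<times> {0..<int s}) - card {(0::int, 0::int)}"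
    using assms by (intro card_Diff_subset) auto
  then show ?thesis using assms by (simp add: card_cartesian_product)
qed

text \<open>\<open>no\<close> states that no a^i t^j x squares to one, so all involutions lie in the
  abelian part. There the exponent of a is 0 or \<open>k\<close> and that of t is arbitrary, which
  leaves 2 s elements including the identity.\<close>

lemma involution_count_dbl:
  fixes p q r c d :: int
  assumes D: "group (dbl (2 * k) s p q r c d)" and k: "k > 0" and s: "s = 1 \<or> s = 2"
    and no: "\<And>i j. (i + (p * i + q * j) + c) mod (2 * int k) = 0 \<Longrightarrow>
      (j + (r * i + j) + d) mod int s = 0 \<Longrightarrow> False"
  shows "involution_count (dbl (2 * k) s p q r c d) = 2 * s - 1"
proof -
  interpret D: group "dbl (2 * k) s p q r c d" by fact
  have pos: "2 * k > 0" "s > 0" using k s by auto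
  have half: "(i + i) mod (2 * int k) = 0 \<longleftrightarrow> i = 0 \<or> i = int k" if "0 \<le> i" "i < 2 * int k" for i
  proof (cases "i < int k")
    case True
    then have "(i + i) mod (2 * int k) = i + i" using that by (intro mod_pos_pos_trivial) auto
    then show ?thesis using True k by auto
  next
    case False
    have "(i + i) mod (2 * int k) = (i + i - 2 * int k) mod (2 * int k)" by simp
    also have "\<dots> = i + i - 2 * int k" using that False by (intro mod_pos_pos_trivial) auto
    finally show ?thesis using False k by auto
  qed
  have "{e \<in> carrier (dbl (2 * k) s p q r c d). e \<noteq> \<one>\<^bsub>dbl (2 * k) s p q r c d\<^esub> \<and>
        e \<otimes>\<^bsub>dbl (2 * k) s p q r c d\<^esub> e = \<one>\<^bsub>dbl (2 * k) s p q r c d\<^esub>} =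
      ({0, int k} \<times> {0..<int s} - {(0, 0)}) \<times> {False}" (is "?L = ?R")
  proof (intro equalityI subsetI)
    fix e assume e: "e \<in> ?L"
    obtain i j b where ijb: "e = ((i, j), b)" by (metis surj_pair)
    show "e \<in> ?R"
    proof (cases b)
      case True
      then have "(i + (p * i + q * j) + c) mod (2 * int k) = 0" "(j + (r * i + j) + d) mod int s = 0"
        using e by (simp_all add: ijb mult_dbl one_dbl)
      then have False by (rule no)
      then show ?thesis ..
    next
      case False
      then show ?thesis
        using e half [of i] by (auto simp: ijb mult_dbl one_dbl carrier_dbl [OF pos])
    qed
  next
    fix e assume e: "e \<in> ?R"
    obtain i j b where ijb: "e = ((i, j), b)" by (metis surj_pair)
    have ij: "\<not> b" "i = 0 \<or> i = int k" "0 \<le> j" "j < int s" "(i, j) \<noteq> (0, 0)"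
      using e by (auto simp: ijb)
    have "(j + j) mod int s = 0" using s by (elim disjE) (simp_all flip: mult_2)
    then show "e \<in> ?L"
      using ij k by (auto simp: ijb mult_dbl one_dbl carrier_dbl [OF pos])
  qed
  then show ?thesis
    unfolding D.involution_count_eq using card_pairs_minus_zero [OF s k] by simp
qed

section \<open>Presented groups as model groups\<close>

lemma pres_class_one: "pres_class R 1 = \<one>\<^bsub>presented_group R\<^esub>"
  by (simp add: presented_group_def)

lemma pres_class_closed [simp]: "pres_class R w \<in> carrier (presented_group R)"
  by (simp add: presented_group_def)

lemma pres_class_mult:
  "pres_class R (v * w) = pres_class R v \<otimes>\<^bsub>presented_group R\<^esub> pres_class R w"
  by (simp add: mult_pres_class)

lemma pres_class_inverse:
  "pres_class R (inverse w) = inv\<^bsub>presented_group R\<^esub> pres_class R w"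
proof -
  interpret P: group "presented_group R" by (rule group_presented_group)
  have "pres_class R (inverse w) \<otimes>\<^bsub>presented_group R\<^esub> pres_class R w = \<one>\<^bsub>presented_group R\<^esub>"
    unfolding mult_pres_class pres_class_one [symmetric] pres_class_eq_iff by (rule pres_eq.l_inv)
  then show ?thesis by (metis P.inv_equality pres_class_closed)
qed

lemma pres_class_power:
  "pres_class R (w ^ n) = pres_class R w [^]\<^bsub>presented_group R\<^esub> n"
proof (induction n)
  interpret P: group "presented_group R" by (rule group_presented_group)
  case 0
  show ?case by (simp add: power_0 pres_class_one)
next
  interpret P: group "presented_group R" by (rule group_presented_group)
  case (Suc n)
  then show ?case
    by (simp only: power_Suc pres_class_mult P.nat_pow_Suc2 pres_class_closed)
qed

lemma pres_class_rel: "(v, w) \<in> R \<Longrightarrow> pres_class R v = pres_class R w"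
  by (simp add: pres_class_eq_iff pres_eq.rel)

lemmas pres_simps = pres_class_one pres_class_mult pres_class_inverse pres_class_power

lemma term_val_simps:
  "term_val H f 1 = \<one>\<^bsub>H\<^esub>"
  "term_val H f (v * w) = term_val H f v \<otimes>\<^bsub>H\<^esub> term_val H f w"
  "term_val H f (inverse w) = inv\<^bsub>H\<^esub> term_val H f w"
  by (simp_all add: one_grp_term_def times_grp_term_def inverse_grp_term_def)

lemma pow_dbl:
  "((i, j), False) [^]\<^bsub>dbl m s p q r c d\<^esub> (n::nat) = ((int n * i mod int m, int n * j mod int s), False)"
  by (induction n) (simp_all add: one_dbl mult_dbl mod_simps distrib_right add.commute)

lemma neg_mod_add:
  fixes u v c m :: int
  shows "((- u - v - c) mod m + (u + v) + c) mod m = 0"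
proof -
  have "((- u - v - c) mod m + (u + v + c)) mod m = 0" by (simp only: mod_add_left_eq) simp
  then show ?thesis by (simp only: add.assoc)
qed

lemma inv_dbl:
  assumes "group (dbl m s p q r c d)" "((i, j), k) \<in> carrier (dbl m s p q r c d)" "m > 0" "s > 0"
  shows "inv\<^bsub>dbl m s p q r c d\<^esub> ((i, j), k) =
    (if k then ((- (p * i + q * j) - c) mod int m, (- (r * i + j) - d) mod int s)
     else ((- i) mod int m, (- j) mod int s), k)"
proof -
  interpret D: group "dbl m s p q r c d" by fact
  show ?thesis
    by (rule D.inv_equality)
      (use assms in \<open>auto simp: mult_dbl one_dbl carrier_dbl mod_simps neg_mod_add\<close>)
qed

text \<open>The assignment \<open>f\<close> extends to a homomorphism \<open>h\<close> into the
  model, and \<open>h\<close> undoes \<open>emb\<close> on normal forms, so \<open>emb\<close> is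
  injective; its image is a subgroup containing the generators, so \<open>emb\<close> is onto. The
  words \<open>wa\<close>, \<open>wt\<close>, \<open>wx\<close> express the model generators in the
  presentation. Reducing 1 modulo \<open>s\<close> covers s = 1, where the generator t is
  trivial.\<close>

lemma presented_iso_dbl:
  fixes R :: "('g grp_term \<times> 'g grp_term) set" and p q r c d :: int
  assumes gens: "dbl_gens (presented_group R) (pres_class R wa) (pres_class R wt) (pres_class R wx)
      m s p q r c d"
    and D: "group (dbl m s p q r c d)"
    and f: "\<And>g. f g \<in> carrier (dbl m s p q r c d)"
    and rels: "\<And>v w. (v, w) \<in> R \<Longrightarrow> term_val (dbl m s p q r c d) f v = term_val (dbl m s p q r c d) f w"
    and words: "term_val (dbl m s p q r c d) f wa = ((1 mod int m, 0), False)"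
      "term_val (dbl m s p q r c d) f wt = ((0, 1 mod int s), False)"
      "term_val (dbl m s p q r c d) f wx = ((0, 0), True)"
    and img: "\<And>g. pres_class R (Gen g) \<in>
      dbl_gens.emb (presented_group R) (pres_class R wa) (pres_class R wt) (pres_class R wx) `
        carrier (dbl m s p q r c d)"
  shows "presented_group R \<cong> dbl m s p q r c d"
proof -
  let ?P = "presented_group R" and ?D = "dbl m s p q r c d"
  interpret dbl_gens ?P "pres_class R wa" "pres_class R wt" "pres_class R wx" m s p q r c d by fact
  interpret D: group ?D by fact
  obtain h where h: "h \<in> hom ?P ?D" and hg: "\<And>g. h (pres_class R (Gen g)) = f g"
    using presented_group_universal [OF D f rels] by blast
  interpret h: group_hom ?P ?D h
    by (rule group_hom.intro [OF is_group D group_hom_axioms.intro [OF h]])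
  interpret F: group_hom ?D ?P emb
    by (rule group_hom.intro [OF D is_group group_hom_axioms.intro [OF emb_hom]])
  have h_class: "h (pres_class R w) = term_val ?D f w" for w
  proof (induction w)
    case (Gen g)
    show ?case by (simp add: hg)
  next
    case One
    show ?case using pres_class_one [of R] by (simp add: one_grp_term_def)
  next
    case (Mul v w)
    then show ?case using pres_class_mult [of R v w] by (simp add: times_grp_term_def)
  next
    case (Inv w)
    then show ?case using pres_class_inverse [of R w] by (simp add: inverse_grp_term_def)
  qed
  have left: "h (emb e) = e" if "e \<in> carrier ?D" for e
  proof -
    obtain i j k where e: "e = ((i, j), k)" by (metis surj_pair)
    with that have ij: "0 \<le> i" "i < int m" "0 \<le> j" "j < int s" using pos by (auto simp: carrier_dbl)
    define i' j' where "i' = nat i" and "j' = nat j"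
    have i': "i = int i'" "j = int j'" using ij by (auto simp: i'_def j'_def)
    have "h (emb e) = (((1 mod int m, 0), False) [^]\<^bsub>?D\<^esub> i' \<otimes>\<^bsub>?D\<^esub> ((0, 1 mod int s), False) [^]\<^bsub>?D\<^esub> j')
        \<otimes>\<^bsub>?D\<^esub> (if k then ((0, 0), True) else \<one>\<^bsub>?D\<^esub>)"
      by (simp add: e emb_def E_def i' int_pow_int h_class words h.hom_nat_pow)
    also have "\<dots> = e"
      using ij by (auto simp: pow_dbl mult_dbl one_dbl e i' mod_simps)
    finally show ?thesis .
  qed
  have inj: "inj_on emb (carrier ?D)"
    by (rule inj_on_inverseI [of _ h]) (rule left)
  have "generate ?P (range (\<lambda>g. pres_class R (Gen g))) \<subseteq> emb ` carrier ?D"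
    using img by (intro generate_subgroup_incl) (auto intro: F.img_is_subgroup)
  then have "emb ` carrier ?D = carrier ?P"
    unfolding presented_group_generated by auto
  then have "emb \<in> iso ?D ?P"
    using inj by (intro isoI emb_hom) (simp add: bij_betw_def)
  then have "?D \<cong> ?P" by (rule is_isoI)
  then show ?thesis by (rule group.iso_sym [OF D])
qed

section \<open>Model generators inside the presented groups\<close>

context group
begin

lemma int_pow_numeral: "x [^] (numeral k :: int) = x [^] (numeral k :: nat)"
  using int_pow_int [of G x "numeral k"] by simp

lemma conj_eq_imp:
  "x \<in> carrier G \<Longrightarrow> a \<in> carrier G \<Longrightarrow> b \<in> carrier G \<Longrightarrow> x \<otimes> a \<otimes> inv x = b \<Longrightarrow> x \<otimes> a = b \<otimes> x"
  by (auto simp: m_assoc)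

text \<open>Words are kept associated to the right, so a relation between two letters also has to be
  available in front of an arbitrary tail \<open>z\<close>.\<close>

lemma mult_tail:
  "x \<otimes> y = w \<Longrightarrow> x \<in> carrier G \<Longrightarrow> y \<in> carrier G \<Longrightarrow> z \<in> carrier G \<Longrightarrow> x \<otimes> (y \<otimes> z) = w \<otimes> z"
  by (simp flip: m_assoc)

lemma inv_eq_pow:
  assumes "x \<in> carrier G" "x [^] Suc n = \<one>"
  shows "inv x = x [^] n"
  by (rule inv_equality) (use assms in simp_all)

text \<open>The model generators are a, b^2 and x = b. Since b acts by the exponent \<open>k\<close>
  with k^2 = 1 modulo \<open>n\<close>, the square of b commutes with a.\<close>

lemma dbl_gens_metacyclic:
  assumes [simp]: "a \<in> carrier G" "b \<in> carrier G"
    and n: "n > 0" and a: "a [^] n = \<one>" and b: "b [^] (4::nat) = \<one>"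
    and ba: "b \<otimes> a = a [^] k \<otimes> b" and k: "int n dvd k * k - 1"
  shows "dbl_gens G a (b \<otimes> b) b n 2 k 0 0 0 1"
proof (intro dbl_gens.intro dbl_gens_axioms.intro)
  have "b \<otimes> (b \<otimes> a) = b \<otimes> a [^] k \<otimes> b" by (simp add: ba m_assoc)
  also have "b \<otimes> a [^] k = (a [^] k) [^] k \<otimes> b"
    by (rule conj_int_pow) (simp_all add: ba)
  also have "(a [^] k) [^] k = a [^] (k * k)" by (simp add: int_pow_pow)
  also have "\<dots> = a [^] (1::int)"
  proof -
    have "int (ord a) dvd int n" using a by (simp add: pow_eq_id)
    then have "int (ord a) dvd 1 - k * k" using k by (metis dvd_diff_commute dvd_trans)
    then show ?thesis by (subst int_pow_eq) simp_all
  qed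
  finally show "a \<otimes> (b \<otimes> b) = b \<otimes> b \<otimes> a" by (simp add: m_assoc)
  show "(b \<otimes> b) [^] (2::nat) = \<one>"
    using b by (simp add: eval_nat_numeral m_assoc)
qed (use n a ba in \<open>simp_all add: m_assoc is_group\<close>)

lemma dbl_gens_quaternion:
  assumes [simp]: "a \<in> carrier G" "b \<in> carrier G" and k: "k > 0"
    and a: "a [^] (2 * k) = \<one>" and b: "b [^] (2::nat) = a [^] k" and ba: "b \<otimes> a \<otimes> inv b = inv a"
  shows "dbl_gens G a \<one> b (2 * k) 1 (2 * int k - 1) 0 0 (int k) 0"
proof (intro dbl_gens.intro dbl_gens_axioms.intro is_group)
  have "a [^] (2 * int k) = \<one>"
    using a int_pow_int [of G a "2 * k"] by simp
  then have "inv a = a [^] (2 * int k - 1)"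
    by (simp add: int_pow_diff)
  then show "b \<otimes> a = a [^] (2 * int k - 1) \<otimes> \<one> [^] (0::int) \<otimes> b"
    using conj_eq_imp [OF _ _ _ ba] by simp
  show "b \<otimes> b = a [^] int k \<otimes> \<one> [^] (0::int)"
    using b by (simp add: int_pow_int numeral_2_eq_2)
qed (use k a in simp_all)

text \<open>\<open>a\<close> and \<open>b\<close> do not commute, but a^2 and \<open>b\<close> do,
  since 5 * 2 = 2 modulo 8. So a^2 and \<open>b\<close> span the abelian part and \<open>a\<close>
  is the extending element, with a b = a^4 b a.\<close>

lemma dbl_gens_modular:
  assumes [simp]: "a \<in> carrier G" "b \<in> carrier G"
    and a: "a [^] (8::nat) = \<one>" and b: "b [^] (2::nat) = \<one>" and ba: "b \<otimes> a \<otimes> inv b = a [^] (5::nat)"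
  shows "dbl_gens G (a \<otimes> a) b a 4 2 1 2 0 1 0"
proof (intro dbl_gens.intro dbl_gens_axioms.intro is_group)
  have 1: "b \<otimes> a = a \<otimes> (a \<otimes> (a \<otimes> (a \<otimes> (a \<otimes> b))))"
    using conj_eq_imp [OF _ _ _ ba] by (simp add: eval_nat_numeral m_assoc)
  have 2: "b \<otimes> (a \<otimes> w) = a \<otimes> (a \<otimes> (a \<otimes> (a \<otimes> (a \<otimes> (b \<otimes> w)))))" if "w \<in> carrier G" for w
    using mult_tail [OF 1, of w] that by (simp add: m_assoc)
  have 3: "a \<otimes> (a \<otimes> (a \<otimes> (a \<otimes> (a \<otimes> (a \<otimes> (a \<otimes> a)))))) = \<one>"
    using a by (simp add: eval_nat_numeral m_assoc)
  have 4: "a \<otimes> (a \<otimes> (a \<otimes> (a \<otimes> (a \<otimes> (a \<otimes> (a \<otimes> (a \<otimes> w))))))) = w" if "w \<in> carrier G" for w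
    using arg_cong [OF 3, of "\<lambda>u. u \<otimes> w"] that by (simp add: m_assoc)
  show "a \<otimes> a \<otimes> b = b \<otimes> (a \<otimes> a)"
    by (simp add: m_assoc 1 2 4)
  show "(a \<otimes> a) [^] (4::nat) = \<one>" using 3 by (simp add: eval_nat_numeral m_assoc)
  show "a \<otimes> b = (a \<otimes> a) [^] (2::int) \<otimes> b \<otimes> a"
    by (simp add: int_pow_numeral eval_nat_numeral m_assoc 1 4)
qed (use b in \<open>simp_all add: m_assoc\<close>)

text \<open>The element b c has order 8 in the model, and a^2 c^2 is an involution commuting with
  it. From (b c)^2 = a^3 c^2 one recovers \<open>a\<close>, and then \<open>c\<close>.\<close>

lemma dbl_gens_32_10:
  assumes [simp]: "a \<in> carrier G" "b \<in> carrier G" "c \<in> carrier G"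
    and a: "a [^] (4::nat) = \<one>" and c: "c [^] (4::nat) = \<one>" and bb: "b [^] (2::nat) = a [^] (2::nat)"
    and ba: "b \<otimes> a \<otimes> inv b = inv a" and ca: "c \<otimes> a \<otimes> inv c = inv a"
    and cb: "c \<otimes> b \<otimes> inv c = inv a \<otimes> b"
  shows "dbl_gens G (b \<otimes> c) (a \<otimes> a \<otimes> c \<otimes> c) b 8 2 7 0 1 4 0"
    and "a = (b \<otimes> c) [^] (2::int) \<otimes> (a \<otimes> a \<otimes> c \<otimes> c)"
    and "c = (b \<otimes> c) [^] (3::int) \<otimes> (a \<otimes> a \<otimes> c \<otimes> c) \<otimes> b"
proof -
  have i: "inv a = a \<otimes> (a \<otimes> a)"
    using inv_eq_pow [of a 3] a by (simp add: eval_nat_numeral m_assoc)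
  have ba1: "b \<otimes> a = a \<otimes> (a \<otimes> (a \<otimes> b))"
    using conj_eq_imp [OF _ _ _ ba] i by (simp add: m_assoc)
  have ba2: "b \<otimes> (a \<otimes> w) = a \<otimes> (a \<otimes> (a \<otimes> (b \<otimes> w)))" if "w \<in> carrier G" for w
    using mult_tail [OF ba1, of w] that by (simp add: m_assoc)
  have ca1: "c \<otimes> a = a \<otimes> (a \<otimes> (a \<otimes> c))"
    using conj_eq_imp [OF _ _ _ ca] i by (simp add: m_assoc)
  have ca2: "c \<otimes> (a \<otimes> w) = a \<otimes> (a \<otimes> (a \<otimes> (c \<otimes> w)))" if "w \<in> carrier G" for w
    using mult_tail [OF ca1, of w] that by (simp add: m_assoc)
  have cb1: "c \<otimes> b = a \<otimes> (a \<otimes> (a \<otimes> (b \<otimes> c)))"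
    using conj_eq_imp [OF _ _ _ cb] i by (simp add: m_assoc)
  have cb2: "c \<otimes> (b \<otimes> w) = a \<otimes> (a \<otimes> (a \<otimes> (b \<otimes> (c \<otimes> w))))" if "w \<in> carrier G" for w
    using mult_tail [OF cb1, of w] that by (simp add: m_assoc)
  have bb1: "b \<otimes> b = a \<otimes> a"
    using bb by (simp add: eval_nat_numeral)
  have bb2: "b \<otimes> (b \<otimes> w) = a \<otimes> (a \<otimes> w)" if "w \<in> carrier G" for w
    using mult_tail [OF bb1, of w] that by (simp add: m_assoc)
  have aa1: "a \<otimes> (a \<otimes> (a \<otimes> a)) = \<one>"
    using a by (simp add: eval_nat_numeral m_assoc)
  have aa2: "a \<otimes> (a \<otimes> (a \<otimes> (a \<otimes> w))) = w" if "w \<in> carrier G" for w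
    using arg_cong [OF aa1, of "\<lambda>u. u \<otimes> w"] that by (simp add: m_assoc)
  have cc1: "c \<otimes> (c \<otimes> (c \<otimes> c)) = \<one>"
    using c by (simp add: eval_nat_numeral m_assoc)
  have cc2: "c \<otimes> (c \<otimes> (c \<otimes> (c \<otimes> w))) = w" if "w \<in> carrier G" for w
    using arg_cong [OF cc1, of "\<lambda>u. u \<otimes> w"] that by (simp add: m_assoc)
  \<comment> \<open>The relations are oriented towards the normal form a^i b^j c^k, each with and
    without a tail; rewriting then decides all required equations.\<close>
  note rules = m_assoc ba1 ba2 ca1 ca2 cb1 cb2 bb1 bb2 aa1 aa2 cc1 cc2
  show "dbl_gens G (b \<otimes> c) (a \<otimes> a \<otimes> c \<otimes> c) b 8 2 7 0 1 4 0"
    by (intro dbl_gens.intro dbl_gens_axioms.intro is_group)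
      (simp_all add: int_pow_numeral eval_nat_numeral rules)
  show "a = (b \<otimes> c) [^] (2::int) \<otimes> (a \<otimes> a \<otimes> c \<otimes> c)"
    "c = (b \<otimes> c) [^] (3::int) \<otimes> (a \<otimes> a \<otimes> c \<otimes> c) \<otimes> b"
    by (simp_all add: int_pow_numeral eval_nat_numeral rules)
qed

text \<open>a^2 has order dividing 3, \<open>c\<close> order dividing 4, and they commute, so a^2 c
  takes the place of the generator of order 12. Its ninth power is \<open>c\<close>, and its square
  times a^3 c^2 is \<open>a\<close>.\<close>

lemma dbl_gens_48_12:
  assumes [simp]: "a \<in> carrier G" "b \<in> carrier G" "c \<in> carrier G"
    and a: "a [^] (6::nat) = \<one>" and c: "c [^] (4::nat) = \<one>" and bb: "b [^] (2::nat) = a [^] (3::nat)"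
    and ba: "b \<otimes> a \<otimes> inv b = inv a" and ac: "a \<otimes> c = c \<otimes> a"
    and cb: "c \<otimes> b \<otimes> inv c = a [^] (3::nat) \<otimes> b"
  shows "dbl_gens G (a \<otimes> a \<otimes> c) (a \<otimes> a \<otimes> a \<otimes> c \<otimes> c) b 12 2 11 0 1 6 1"
    and "a = (a \<otimes> a \<otimes> c) [^] (2::int) \<otimes> (a \<otimes> a \<otimes> a \<otimes> c \<otimes> c)"
    and "c = (a \<otimes> a \<otimes> c) [^] (9::int)"
proof -
  have i: "inv a = a \<otimes> (a \<otimes> (a \<otimes> (a \<otimes> a)))"
    using inv_eq_pow [of a 5] a by (simp add: eval_nat_numeral m_assoc)
  have ba1: "b \<otimes> a = a \<otimes> (a \<otimes> (a \<otimes> (a \<otimes> (a \<otimes> b))))"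
    using conj_eq_imp [OF _ _ _ ba] i by (simp add: m_assoc)
  have ba2: "b \<otimes> (a \<otimes> w) = a \<otimes> (a \<otimes> (a \<otimes> (a \<otimes> (a \<otimes> (b \<otimes> w)))))" if "w \<in> carrier G" for w
    using mult_tail [OF ba1, of w] that by (simp add: m_assoc)
  have ca1: "c \<otimes> a = a \<otimes> c" using ac by simp
  have ca2: "c \<otimes> (a \<otimes> w) = a \<otimes> (c \<otimes> w)" if "w \<in> carrier G" for w
    using mult_tail [OF ca1, of w] that by (simp add: m_assoc)
  have cb1: "c \<otimes> b = a \<otimes> (a \<otimes> (a \<otimes> (b \<otimes> c)))"
    using conj_eq_imp [OF _ _ _ cb] by (simp add: m_assoc eval_nat_numeral)
  have cb2: "c \<otimes> (b \<otimes> w) = a \<otimes> (a \<otimes> (a \<otimes> (b \<otimes> (c \<otimes> w))))" if "w \<in> carrier G" for w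
    using mult_tail [OF cb1, of w] that by (simp add: m_assoc)
  have bb1: "b \<otimes> b = a \<otimes> (a \<otimes> a)"
    using bb by (simp add: eval_nat_numeral m_assoc)
  have bb2: "b \<otimes> (b \<otimes> w) = a \<otimes> (a \<otimes> (a \<otimes> w))" if "w \<in> carrier G" for w
    using mult_tail [OF bb1, of w] that by (simp add: m_assoc)
  have aa1: "a \<otimes> (a \<otimes> (a \<otimes> (a \<otimes> (a \<otimes> a)))) = \<one>"
    using a by (simp add: eval_nat_numeral m_assoc)
  have aa2: "a \<otimes> (a \<otimes> (a \<otimes> (a \<otimes> (a \<otimes> (a \<otimes> w))))) = w" if "w \<in> carrier G" for w
    using arg_cong [OF aa1, of "\<lambda>u. u \<otimes> w"] that by (simp add: m_assoc)
  have cc1: "c \<otimes> (c \<otimes> (c \<otimes> c)) = \<one>"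
    using c by (simp add: eval_nat_numeral m_assoc)
  have cc2: "c \<otimes> (c \<otimes> (c \<otimes> (c \<otimes> w))) = w" if "w \<in> carrier G" for w
    using arg_cong [OF cc1, of "\<lambda>u. u \<otimes> w"] that by (simp add: m_assoc)
  note rules = m_assoc ba1 ba2 ca1 ca2 cb1 cb2 bb1 bb2 aa1 aa2 cc1 cc2
  show "dbl_gens G (a \<otimes> a \<otimes> c) (a \<otimes> a \<otimes> a \<otimes> c \<otimes> c) b 12 2 11 0 1 6 1"
    by (intro dbl_gens.intro dbl_gens_axioms.intro is_group)
      (simp_all add: int_pow_numeral eval_nat_numeral rules)
  show "a = (a \<otimes> a \<otimes> c) [^] (2::int) \<otimes> (a \<otimes> a \<otimes> a \<otimes> c \<otimes> c)"
    "c = (a \<otimes> a \<otimes> c) [^] (9::int)"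
    by (simp_all add: int_pow_numeral eval_nat_numeral rules)
qed

end

section \<open>The presented groups as models\<close>

text \<open>In this order the models are Q_8, Q_16 and Z_3 by Q_8; M_16; Q_16 x Z_2 and the groups
  [32,14], [32,13], [32,10]; Z_2 x (Z_3 by Q_8), [48,13], Z_4 x (Z_3 by Z_4) and [48,12], where "by"
  denotes the nontrivial semidirect product.\<close>

lemma group_models:
  "group (dbl 4 1 3 0 0 2 0)" "group (dbl 8 1 7 0 0 4 0)" "group (dbl 12 1 11 0 0 6 0)"
  "group (dbl 4 2 1 2 0 1 0)"
  "group (dbl 8 2 7 0 0 4 0)" "group (dbl 8 2 7 0 0 0 1)" "group (dbl 8 2 3 0 0 0 1)"
  "group (dbl 8 2 7 0 1 4 0)"
  "group (dbl 12 2 11 0 0 6 0)" "group (dbl 12 2 11 0 0 0 1)" "group (dbl 12 2 5 0 0 0 1)"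
  "group (dbl 12 2 11 0 1 6 1)"
  by (rule group_dbl; simp)+

lemma term_val_power_numeral:
  "term_val H f (w ^ numeral k) = term_val H f w \<otimes>\<^bsub>H\<^esub> term_val H f (w ^ pred_numeral k)"
  by (simp add: numeral_eq_Suc term_val_simps)

lemmas dbl_eval = term_val_simps term_val_power_numeral mult_dbl one_dbl inv_dbl carrier_dbl
  group_models group_models [unfolded One_nat_def]

lemma gen_quaternion_3: "gen_quaternion 3 \<cong> dbl 4 1 3 0 0 2 0"
proof -
  \<comment> \<open>The exponent stays unevaluated as 2 * 2 to match
    \<open>dbl_gens_quaternion\<close> with k = 2.\<close>
  define R where "R = (let a = Gen A2; b = Gen B2 in
    {a ^ (2 * 2) \<doteq> 1, b\<^sup>2 \<doteq> a ^ 2, b * a * inverse b \<doteq> inverse a})"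
  let ?P = "presented_group R"
  let ?A = "pres_class R (Gen A2)" and ?B = "pres_class R (Gen B2)"
  interpret P: group ?P by (rule group_presented_group)
  have rels: "?A [^]\<^bsub>?P\<^esub> (2 * 2 :: nat) = \<one>\<^bsub>?P\<^esub>"
    "?B [^]\<^bsub>?P\<^esub> (2::nat) = ?A [^]\<^bsub>?P\<^esub> (2::nat)"
    "?B \<otimes>\<^bsub>?P\<^esub> ?A \<otimes>\<^bsub>?P\<^esub> inv\<^bsub>?P\<^esub> ?B = inv\<^bsub>?P\<^esub> ?A"
    unfolding pres_simps [symmetric] by (rule pres_class_rel, simp add: R_def Let_def)+
  have gens: "dbl_gens ?P (pres_class R (Gen A2)) (pres_class R (1)) (pres_class R (Gen B2))
    4 1 3 0 0 2 0"
    using P.dbl_gens_quaternion [OF _ _ _ rels] by (simp add: pres_simps)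
  interpret dbl_gens ?P "pres_class R (Gen A2)" "pres_class R (1)" "pres_class R (Gen B2)"
    4 1 3 0 0 2 0
    by (rule gens)
  have "?P \<cong> dbl 4 1 3 0 0 2 0"
  proof (rule presented_iso_dbl [where f = "case_gen2 (((1, 0), False)) (((0, 0), True))"])
    show "(case g of A2 \<Rightarrow> ((1, 0), False) | B2 \<Rightarrow> ((0, 0), True)) \<in> carrier (dbl 4 1 3 0 0 2 0)" for g
      by (cases g) (simp_all add: carrier_dbl)
    show "pres_class R (Gen g) \<in> emb ` carrier (dbl 4 1 3 0 0 2 0)" for g
      using emb_image_E [of 1 0, unfolded E_def] emb_image_Ex [of 0 0, unfolded E_def]
      by (cases g) (simp_all add: pres_simps)
  qed (use gens in \<open>auto simp: R_def Let_def dbl_eval\<close>)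
  then show ?thesis by (simp add: gen_quaternion_def R_def Let_def)
qed

lemma gen_quaternion_4: "gen_quaternion 4 \<cong> dbl 8 1 7 0 0 4 0"
proof -
  define R where "R = (let a = Gen A2; b = Gen B2 in
    {a ^ (2 * 4) \<doteq> 1, b\<^sup>2 \<doteq> a ^ 4, b * a * inverse b \<doteq> inverse a})"
  let ?P = "presented_group R"
  let ?A = "pres_class R (Gen A2)" and ?B = "pres_class R (Gen B2)"
  interpret P: group ?P by (rule group_presented_group)
  have rels: "?A [^]\<^bsub>?P\<^esub> (2 * 4 :: nat) = \<one>\<^bsub>?P\<^esub>"
    "?B [^]\<^bsub>?P\<^esub> (2::nat) = ?A [^]\<^bsub>?P\<^esub> (4::nat)"
    "?B \<otimes>\<^bsub>?P\<^esub> ?A \<otimes>\<^bsub>?P\<^esub> inv\<^bsub>?P\<^esub> ?B = inv\<^bsub>?P\<^esub> ?A"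
    unfolding pres_simps [symmetric] by (rule pres_class_rel, simp add: R_def Let_def)+
  have gens: "dbl_gens ?P (pres_class R (Gen A2)) (pres_class R (1)) (pres_class R (Gen B2))
    8 1 7 0 0 4 0"
    using P.dbl_gens_quaternion [OF _ _ _ rels] by (simp add: pres_simps)
  interpret dbl_gens ?P "pres_class R (Gen A2)" "pres_class R (1)" "pres_class R (Gen B2)"
    8 1 7 0 0 4 0
    by (rule gens)
  have "?P \<cong> dbl 8 1 7 0 0 4 0"
  proof (rule presented_iso_dbl [where f = "case_gen2 (((1, 0), False)) (((0, 0), True))"])
    show "(case g of A2 \<Rightarrow> ((1, 0), False) | B2 \<Rightarrow> ((0, 0), True)) \<in> carrier (dbl 8 1 7 0 0 4 0)" for g
      by (cases g) (simp_all add: carrier_dbl)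
    show "pres_class R (Gen g) \<in> emb ` carrier (dbl 8 1 7 0 0 4 0)" for g
      using emb_image_E [of 1 0, unfolded E_def] emb_image_Ex [of 0 0, unfolded E_def]
      by (cases g) (simp_all add: pres_simps)
  qed (use gens in \<open>auto simp: R_def Let_def dbl_eval\<close>)
  then show ?thesis by (simp add: gen_quaternion_def R_def Let_def)
qed

lemma modular_max_cyclic_4: "modular_max_cyclic 4 \<cong> dbl 4 2 1 2 0 1 0"
proof -
  define R where "R = (let a = Gen A2; b = Gen B2 in
    {a ^ 8 \<doteq> 1, b\<^sup>2 \<doteq> 1, b * a * inverse b \<doteq> a ^ 5})"
  let ?P = "presented_group R"
  let ?A = "pres_class R (Gen A2)" and ?B = "pres_class R (Gen B2)"
  interpret P: group ?P by (rule group_presented_group)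
  have rels: "?A [^]\<^bsub>?P\<^esub> (8::nat) = \<one>\<^bsub>?P\<^esub>"
    "?B [^]\<^bsub>?P\<^esub> (2::nat) = \<one>\<^bsub>?P\<^esub>"
    "?B \<otimes>\<^bsub>?P\<^esub> ?A \<otimes>\<^bsub>?P\<^esub> inv\<^bsub>?P\<^esub> ?B = ?A [^]\<^bsub>?P\<^esub> (5::nat)"
    unfolding pres_simps [symmetric] by (rule pres_class_rel, simp add: R_def Let_def)+
  have gens: "dbl_gens ?P (pres_class R (Gen A2 * Gen A2)) (pres_class R (Gen B2)) (pres_class R (Gen A2))
    4 2 1 2 0 1 0"
    using P.dbl_gens_modular [OF _ _ rels] by (simp add: pres_simps)
  interpret dbl_gens ?P "pres_class R (Gen A2 * Gen A2)" "pres_class R (Gen B2)" "pres_class R (Gen A2)"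
    4 2 1 2 0 1 0
    by (rule gens)
  have "?P \<cong> dbl 4 2 1 2 0 1 0"
  \<comment> \<open>The generator a of M_16 is the extending element of the model, hence the value
    \<open>True\<close>; b is the involution t.\<close>
  proof (rule presented_iso_dbl [where f = "case_gen2 (((0, 0), True)) (((0, 1), False))"])
    show "(case g of A2 \<Rightarrow> ((0, 0), True) | B2 \<Rightarrow> ((0, 1), False)) \<in> carrier (dbl 4 2 1 2 0 1 0)" for g
      by (cases g) (simp_all add: carrier_dbl)
    show "pres_class R (Gen g) \<in> emb ` carrier (dbl 4 2 1 2 0 1 0)" for g
      using emb_image_E [of 0 1, unfolded E_def] emb_image_Ex [of 0 0, unfolded E_def]
      by (cases g) (simp_all add: pres_simps)
  qed (use gens in \<open>auto simp: R_def Let_def dbl_eval\<close>)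
  then show ?thesis by (simp add: modular_max_cyclic_def R_def Let_def)
qed

lemma SmallGroup_32_13: "SmallGroup_32_13 \<cong> dbl 8 2 3 0 0 0 1"
proof -
  define R where "R = (let a = Gen A2; b = Gen B2 in
    {a ^ 8 \<doteq> 1, b ^ 4 \<doteq> 1, b * a * inverse b \<doteq> a ^ 3})"
  let ?P = "presented_group R"
  let ?A = "pres_class R (Gen A2)" and ?B = "pres_class R (Gen B2)"
  interpret P: group ?P by (rule group_presented_group)
  have rels: "?A [^]\<^bsub>?P\<^esub> (8::nat) = \<one>\<^bsub>?P\<^esub>"
    "?B [^]\<^bsub>?P\<^esub> (4::nat) = \<one>\<^bsub>?P\<^esub>"
    "?B \<otimes>\<^bsub>?P\<^esub> ?A \<otimes>\<^bsub>?P\<^esub> inv\<^bsub>?P\<^esub> ?B = ?A [^]\<^bsub>?P\<^esub> (3::nat)"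
    unfolding pres_simps [symmetric] by (rule pres_class_rel, simp add: R_def Let_def)+
  have gens: "dbl_gens ?P (pres_class R (Gen A2)) (pres_class R (Gen B2 * Gen B2)) (pres_class R (Gen B2))
    8 2 3 0 0 0 1"
    using P.dbl_gens_metacyclic [of ?A ?B 8 3] rels(1,2) P.conj_eq_imp [OF _ _ _ rels(3)]
      P.int_pow_numeral [of ?A]
    by (simp add: pres_simps)
  interpret dbl_gens ?P "pres_class R (Gen A2)" "pres_class R (Gen B2 * Gen B2)" "pres_class R (Gen B2)"
    8 2 3 0 0 0 1
    by (rule gens)
  have "?P \<cong> dbl 8 2 3 0 0 0 1"
  proof (rule presented_iso_dbl [where f = "case_gen2 (((1, 0), False)) (((0, 0), True))"])
    show "(case g of A2 \<Rightarrow> ((1, 0), False) | B2 \<Rightarrow> ((0, 0), True)) \<in> carrier (dbl 8 2 3 0 0 0 1)" for g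
      by (cases g) (simp_all add: carrier_dbl)
    show "pres_class R (Gen g) \<in> emb ` carrier (dbl 8 2 3 0 0 0 1)" for g
      using emb_image_E [of 1 0, unfolded E_def] emb_image_Ex [of 0 0, unfolded E_def]
      by (cases g) (simp_all add: pres_simps)
  qed (use gens in \<open>auto simp: R_def Let_def dbl_eval\<close>)
  then show ?thesis by (simp add: SmallGroup_32_13_def R_def Let_def)
qed

lemma SmallGroup_32_14: "SmallGroup_32_14 \<cong> dbl 8 2 7 0 0 0 1"
proof -
  define R where "R = (let a = Gen A2; b = Gen B2 in
    {a ^ 8 \<doteq> 1, b ^ 4 \<doteq> 1, b * a * inverse b \<doteq> inverse a})"
  let ?P = "presented_group R"
  let ?A = "pres_class R (Gen A2)" and ?B = "pres_class R (Gen B2)"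
  interpret P: group ?P by (rule group_presented_group)
  have rels: "?A [^]\<^bsub>?P\<^esub> (8::nat) = \<one>\<^bsub>?P\<^esub>"
    "?B [^]\<^bsub>?P\<^esub> (4::nat) = \<one>\<^bsub>?P\<^esub>"
    "?B \<otimes>\<^bsub>?P\<^esub> ?A \<otimes>\<^bsub>?P\<^esub> inv\<^bsub>?P\<^esub> ?B = inv\<^bsub>?P\<^esub> ?A"
    unfolding pres_simps [symmetric] by (rule pres_class_rel, simp add: R_def Let_def)+
  have gens: "dbl_gens ?P (pres_class R (Gen A2)) (pres_class R (Gen B2 * Gen B2)) (pres_class R (Gen B2))
    8 2 7 0 0 0 1"
    using P.dbl_gens_metacyclic [of ?A ?B 8 7] rels(1,2) P.conj_eq_imp [OF _ _ _ rels(3)]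
      P.inv_eq_pow [of ?A 7] P.int_pow_numeral [of ?A]
    by (simp add: pres_simps)
  interpret dbl_gens ?P "pres_class R (Gen A2)" "pres_class R (Gen B2 * Gen B2)" "pres_class R (Gen B2)"
    8 2 7 0 0 0 1
    by (rule gens)
  have "?P \<cong> dbl 8 2 7 0 0 0 1"
  proof (rule presented_iso_dbl [where f = "case_gen2 (((1, 0), False)) (((0, 0), True))"])
    show "(case g of A2 \<Rightarrow> ((1, 0), False) | B2 \<Rightarrow> ((0, 0), True)) \<in> carrier (dbl 8 2 7 0 0 0 1)" for g
      by (cases g) (simp_all add: carrier_dbl)
    show "pres_class R (Gen g) \<in> emb ` carrier (dbl 8 2 7 0 0 0 1)" for g
      using emb_image_E [of 1 0, unfolded E_def] emb_image_Ex [of 0 0, unfolded E_def]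
      by (cases g) (simp_all add: pres_simps)
  qed (use gens in \<open>auto simp: R_def Let_def dbl_eval\<close>)
  then show ?thesis by (simp add: SmallGroup_32_14_def R_def Let_def)
qed

lemma SmallGroup_48_13: "SmallGroup_48_13 \<cong> dbl 12 2 11 0 0 0 1"
proof -
  define R where "R = (let a = Gen A2; b = Gen B2 in
    {a ^ 12 \<doteq> 1, b ^ 4 \<doteq> 1, b * a * inverse b \<doteq> inverse a})"
  let ?P = "presented_group R"
  let ?A = "pres_class R (Gen A2)" and ?B = "pres_class R (Gen B2)"
  interpret P: group ?P by (rule group_presented_group)
  have rels: "?A [^]\<^bsub>?P\<^esub> (12::nat) = \<one>\<^bsub>?P\<^esub>"
    "?B [^]\<^bsub>?P\<^esub> (4::nat) = \<one>\<^bsub>?P\<^esub>"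
    "?B \<otimes>\<^bsub>?P\<^esub> ?A \<otimes>\<^bsub>?P\<^esub> inv\<^bsub>?P\<^esub> ?B = inv\<^bsub>?P\<^esub> ?A"
    unfolding pres_simps [symmetric] by (rule pres_class_rel, simp add: R_def Let_def)+
  have gens: "dbl_gens ?P (pres_class R (Gen A2)) (pres_class R (Gen B2 * Gen B2)) (pres_class R (Gen B2))
    12 2 11 0 0 0 1"
    using P.dbl_gens_metacyclic [of ?A ?B 12 11] rels(1,2) P.conj_eq_imp [OF _ _ _ rels(3)]
      P.inv_eq_pow [of ?A 11] P.int_pow_numeral [of ?A]
    by (simp add: pres_simps)
  interpret dbl_gens ?P "pres_class R (Gen A2)" "pres_class R (Gen B2 * Gen B2)" "pres_class R (Gen B2)"
    12 2 11 0 0 0 1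
    by (rule gens)
  have "?P \<cong> dbl 12 2 11 0 0 0 1"
  proof (rule presented_iso_dbl [where f = "case_gen2 (((1, 0), False)) (((0, 0), True))"])
    show "(case g of A2 \<Rightarrow> ((1, 0), False) | B2 \<Rightarrow> ((0, 0), True)) \<in> carrier (dbl 12 2 11 0 0 0 1)" for g
      by (cases g) (simp_all add: carrier_dbl)
    show "pres_class R (Gen g) \<in> emb ` carrier (dbl 12 2 11 0 0 0 1)" for g
      using emb_image_E [of 1 0, unfolded E_def] emb_image_Ex [of 0 0, unfolded E_def]
      by (cases g) (simp_all add: pres_simps)
  qed (use gens in \<open>auto simp: R_def Let_def dbl_eval\<close>)
  then show ?thesis by (simp add: SmallGroup_48_13_def R_def Let_def)
qed

lemma SmallGroup_32_10: "SmallGroup_32_10 \<cong> dbl 8 2 7 0 1 4 0"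
proof -
  define R where "R = (let a = Gen A3; b = Gen B3; c = Gen C3 in
    {a ^ 4 \<doteq> 1, c ^ 4 \<doteq> 1, b\<^sup>2 \<doteq> a\<^sup>2, b * a * inverse b \<doteq> inverse a,
      c * a * inverse c \<doteq> inverse a, c * b * inverse c \<doteq> inverse a * b})"
  let ?P = "presented_group R"
  let ?A = "pres_class R (Gen A3)" and ?B = "pres_class R (Gen B3)" and ?C = "pres_class R (Gen C3)"
  interpret P: group ?P by (rule group_presented_group)
  have rels: "?A [^]\<^bsub>?P\<^esub> (4::nat) = \<one>\<^bsub>?P\<^esub>"
    "?C [^]\<^bsub>?P\<^esub> (4::nat) = \<one>\<^bsub>?P\<^esub>"
    "?B [^]\<^bsub>?P\<^esub> (2::nat) = ?A [^]\<^bsub>?P\<^esub> (2::nat)"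
    "?B \<otimes>\<^bsub>?P\<^esub> ?A \<otimes>\<^bsub>?P\<^esub> inv\<^bsub>?P\<^esub> ?B = inv\<^bsub>?P\<^esub> ?A"
    "?C \<otimes>\<^bsub>?P\<^esub> ?A \<otimes>\<^bsub>?P\<^esub> inv\<^bsub>?P\<^esub> ?C = inv\<^bsub>?P\<^esub> ?A"
    "?C \<otimes>\<^bsub>?P\<^esub> ?B \<otimes>\<^bsub>?P\<^esub> inv\<^bsub>?P\<^esub> ?C = inv\<^bsub>?P\<^esub> ?A \<otimes>\<^bsub>?P\<^esub> ?B"
    unfolding pres_simps [symmetric] by (rule pres_class_rel, simp add: R_def Let_def)+
  have gens: "dbl_gens ?P (pres_class R (Gen B3 * Gen C3)) (pres_class R (Gen A3 * Gen A3 * Gen C3 * Gen C3)) (pres_class R (Gen B3))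
    8 2 7 0 1 4 0"
    using P.dbl_gens_32_10(1) [OF _ _ _ rels] by (simp add: pres_simps)
  interpret dbl_gens ?P "pres_class R (Gen B3 * Gen C3)" "pres_class R (Gen A3 * Gen A3 * Gen C3 * Gen C3)" "pres_class R (Gen B3)"
    8 2 7 0 1 4 0
    by (rule gens)
  note words = P.dbl_gens_32_10(2,3) [OF _ _ _ rels, simplified, symmetric]
  have "?P \<cong> dbl 8 2 7 0 1 4 0"
  \<comment> \<open>The images are read off from \<open>words\<close>: a = (b c)^2 t and c = (b c)^3
    t b with t = a^2 c^2.\<close>
  proof (rule presented_iso_dbl [where f = "case_gen3 (((2, 1), False)) (((0, 0), True)) (((3, 1), True))"])
    show "(case g of A3 \<Rightarrow> ((2, 1), False) | B3 \<Rightarrow> ((0, 0), True) | C3 \<Rightarrow> ((3, 1), True)) \<in> carrier (dbl 8 2 7 0 1 4 0)" for g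
      by (cases g) (simp_all add: carrier_dbl)
    show "pres_class R (Gen g) \<in> emb ` carrier (dbl 8 2 7 0 1 4 0)" for g
      using emb_image_E [of 2 1, unfolded E_def] emb_image_Ex [of 0 0, unfolded E_def]
        emb_image_Ex [of 3 1, unfolded E_def] words
      by (cases g) (simp_all add: pres_simps)
  qed (use gens in \<open>auto simp: R_def Let_def dbl_eval\<close>)
  then show ?thesis by (simp add: SmallGroup_32_10_def R_def Let_def)
qed

lemma SmallGroup_48_12: "SmallGroup_48_12 \<cong> dbl 12 2 11 0 1 6 1"
proof -
  define R where "R = (let a = Gen A3; b = Gen B3; c = Gen C3 in
    {a ^ 6 \<doteq> 1, c ^ 4 \<doteq> 1, b\<^sup>2 \<doteq> a ^ 3, b * a * inverse b \<doteq> inverse a,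
      a * c \<doteq> c * a, c * b * inverse c \<doteq> a ^ 3 * b})"
  let ?P = "presented_group R"
  let ?A = "pres_class R (Gen A3)" and ?B = "pres_class R (Gen B3)" and ?C = "pres_class R (Gen C3)"
  interpret P: group ?P by (rule group_presented_group)
  have rels: "?A [^]\<^bsub>?P\<^esub> (6::nat) = \<one>\<^bsub>?P\<^esub>"
    "?C [^]\<^bsub>?P\<^esub> (4::nat) = \<one>\<^bsub>?P\<^esub>"
    "?B [^]\<^bsub>?P\<^esub> (2::nat) = ?A [^]\<^bsub>?P\<^esub> (3::nat)"
    "?B \<otimes>\<^bsub>?P\<^esub> ?A \<otimes>\<^bsub>?P\<^esub> inv\<^bsub>?P\<^esub> ?B = inv\<^bsub>?P\<^esub> ?A"
    "?A \<otimes>\<^bsub>?P\<^esub> ?C = ?C \<otimes>\<^bsub>?P\<^esub> ?A"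
    "?C \<otimes>\<^bsub>?P\<^esub> ?B \<otimes>\<^bsub>?P\<^esub> inv\<^bsub>?P\<^esub> ?C = ?A [^]\<^bsub>?P\<^esub> (3::nat) \<otimes>\<^bsub>?P\<^esub> ?B"
    unfolding pres_simps [symmetric] by (rule pres_class_rel, simp add: R_def Let_def)+
  have gens: "dbl_gens ?P (pres_class R (Gen A3 * Gen A3 * Gen C3)) (pres_class R (Gen A3 * Gen A3 * Gen A3 * Gen C3 * Gen C3)) (pres_class R (Gen B3))
    12 2 11 0 1 6 1"
    using P.dbl_gens_48_12(1) [OF _ _ _ rels] by (simp add: pres_simps)
  interpret dbl_gens ?P "pres_class R (Gen A3 * Gen A3 * Gen C3)" "pres_class R (Gen A3 * Gen A3 * Gen A3 * Gen C3 * Gen C3)" "pres_class R (Gen B3)"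
    12 2 11 0 1 6 1
    by (rule gens)
  note words = P.dbl_gens_48_12(2,3) [OF _ _ _ rels, simplified, symmetric]
  have "?P \<cong> dbl 12 2 11 0 1 6 1"
  \<comment> \<open>Again read off from \<open>words\<close>: a is the square of a^2 c times t, and
    c is the ninth power of a^2 c.\<close>
  proof (rule presented_iso_dbl [where f = "case_gen3 (((2, 1), False)) (((0, 0), True)) (((9, 0), False))"])
    show "(case g of A3 \<Rightarrow> ((2, 1), False) | B3 \<Rightarrow> ((0, 0), True) | C3 \<Rightarrow> ((9, 0), False)) \<in> carrier (dbl 12 2 11 0 1 6 1)" for g
      by (cases g) (simp_all add: carrier_dbl)
    show "pres_class R (Gen g) \<in> emb ` carrier (dbl 12 2 11 0 1 6 1)" for g
      using emb_image_E [of 2 1, unfolded E_def] emb_image_Ex [of 0 0, unfolded E_def]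
        emb_image_E [of 9 0, unfolded E_def] words
      by (cases g) (simp_all add: pres_simps)
  qed (use gens in \<open>auto simp: R_def Let_def dbl_eval\<close>)
  then show ?thesis by (simp add: SmallGroup_48_12_def R_def Let_def)
qed

lemma dvd_less_double_iff:
  assumes "0 \<le> i" "i < 2 * int k"
  shows "int k dvd i \<longleftrightarrow> i = 0 \<or> i = int k"
proof
  assume "int k dvd i"
  then obtain l where l: "i = int k * l" by (elim dvdE)
  have "k > 0" using assms by (cases "k = 0") auto
  have "0 \<le> l" "l < 2" using assms \<open>k > 0\<close> by (simp_all add: l zero_le_mult_iff mult.commute [of 2])
  then have "l = 0 \<or> l = 1" by auto
  then show "i = 0 \<or> i = int k" by (auto simp: l)
qed auto

section \<open>Semidirect products with \<open>\<int>\<^sub>3\<close>\<close>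

lemma mod_3_cases: "(i::int) mod 3 \<in> {0, 1, 2}"
proof -
  have "0 \<le> i mod 3" "i mod 3 < 3" by simp_all
  then show ?thesis by force
qed

lemma mod_4_cases: "(i::int) mod 4 \<in> {0, 1, 2, 3}"
proof -
  have "0 \<le> i mod 4" "i mod 4 < 4" by simp_all
  then show ?thesis by force
qed

lemma carrier_mod_3: "carrier (integer_mod_group 3) = {0, 1, 2}"
  by (auto simp: carrier_integer_mod_group)

lemma auto_mod_3:
  assumes "f \<in> auto (integer_mod_group 3)"
  shows "(f 1 = 1 \<or> f 1 = 2) \<and> (\<forall>n \<in> {0, 1, 2}. f n = (f 1 * n) mod 3)"
proof -
  have f: "f \<in> hom (integer_mod_group 3) (integer_mod_group 3)" "bij_betw f {0, 1, 2} {0, 1, 2}"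
    using assms by (auto simp: auto_def Bij_def carrier_mod_3)
  have add: "f ((m + n) mod 3) = (f m + f n) mod 3" if "m \<in> {0, 1, 2}" "n \<in> {0, 1, 2}" for m n
    using hom_mult [OF f(1), of m n] that by (simp add: carrier_mod_3)
  have 0: "f 0 = 0"
    using hom_one [OF f(1)] by simp
  have "f 1 \<noteq> f 0"
    using f(2) by (auto simp: bij_betw_def inj_on_def)
  moreover have "f 1 \<in> {0, 1, 2}" using f(2) by (auto simp: bij_betw_def)
  ultimately have 1: "f 1 = 1 \<or> f 1 = 2" using 0 by auto
  have "f 2 = (f 1 + f 1) mod 3" using add [of 1 1] by simp
  then show ?thesis using 0 1 by auto
qed

text \<open>The automorphisms of Z_3 are the multiplications by 1 and -1, so a nontrivial action is
  the same thing as a nontrivial sign character \<open>e\<close>.\<close>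

lemma mod_3_action_sign:
  assumes "group H" and \<phi>: "\<phi> \<in> nontrivial_actions H (integer_mod_group 3)"
  obtains e :: "'h \<Rightarrow> int" where
    "\<And>h. h \<in> carrier H \<Longrightarrow> e h = 1 \<or> e h = -1"
    "\<And>h n. h \<in> carrier H \<Longrightarrow> n \<in> {0, 1, 2} \<Longrightarrow> \<phi> h n = (e h * n) mod 3"
    "\<And>h h'. h \<in> carrier H \<Longrightarrow> h' \<in> carrier H \<Longrightarrow> e (h \<otimes>\<^bsub>H\<^esub> h') = e h * e h'"
    "\<exists>h \<in> carrier H. e h = -1"
proof -
  let ?N = "integer_mod_group 3"
  interpret H: group H by fact
  interpret \<phi>: group_hom H "AutoGroup ?N" \<phi>
    using \<phi> group.AutoGroup [OF group_integer_mod_group]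
    by (intro group_hom.intro group_hom_axioms.intro H.is_group) (auto simp: nontrivial_actions_def)
  have aut: "\<phi> h \<in> auto ?N" if "h \<in> carrier H" for h
    using \<phi>.hom_closed [OF that] by (simp add: AutoGroup_def)
  then have bij: "\<phi> h \<in> Bij (carrier ?N)" if "h \<in> carrier H" for h
    using that by (auto simp: auto_def)
  have comp: "\<phi> (h \<otimes>\<^bsub>H\<^esub> h') n = \<phi> h (\<phi> h' n)"
    if "h \<in> carrier H" "h' \<in> carrier H" "n \<in> carrier ?N" for h h' n
    using \<phi>.hom_mult [OF that(1,2)] bij that
    by (simp add: AutoGroup_def BijGroup_def compose_def)
  define e :: "'h \<Rightarrow> int" where "e h = (if \<phi> h 1 = 1 then 1 else -1)" for h
  have e: "\<phi> h n = (e h * n) mod 3" if "h \<in> carrier H" "n \<in> {0, 1, 2}" for h n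
    using auto_mod_3 [OF aut [OF that(1)]] that(2) by (auto simp: e_def)
  show thesis
  proof (rule that [of e])
    show "e h = 1 \<or> e h = -1" for h by (simp add: e_def)
    show "\<phi> h n = (e h * n) mod 3" if "h \<in> carrier H" "n \<in> {0, 1, 2}" for h n
      by (rule e [OF that])
    show "e (h \<otimes>\<^bsub>H\<^esub> h') = e h * e h'" if h: "h \<in> carrier H" "h' \<in> carrier H" for h h'
    proof -
      have "\<phi> (h \<otimes>\<^bsub>H\<^esub> h') 1 = \<phi> h (\<phi> h' 1)"
        using comp [OF h, of 1] by (simp add: carrier_mod_3)
      also have "\<dots> = (e h * (e h' mod 3)) mod 3"
      proof -
        have "\<phi> h' 1 = e h' mod 3" using e [OF h(2), of 1] by simp
        moreover have "e h' mod 3 \<in> {0, 1, 2}" by (simp add: e_def)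
        ultimately show ?thesis using e [OF h(1)] by simp
      qed
      finally have "\<phi> (h \<otimes>\<^bsub>H\<^esub> h') 1 = (e h * (e h' mod 3)) mod 3" .
      then show ?thesis by (auto simp: e_def split: if_splits)
    qed
    show "\<exists>h \<in> carrier H. e h = -1"
    proof (rule ccontr)
      assume "\<not> (\<exists>h \<in> carrier H. e h = -1)"
      then have "e h = 1" if "h \<in> carrier H" for h
        using that e_def [of h] by metis
      then have "\<phi> h n = n" if "h \<in> carrier H" "n \<in> {0, 1, 2}" for h n
        using e [OF that] that by auto
      then have "\<phi> h = (\<lambda>x\<in>carrier ?N. x)" if "h \<in> carrier H" for h
        using bij [OF that] that by (intro extensionalityI [of _ "carrier ?N"])
          (auto simp: Bij_def carrier_mod_3)
      then have "\<phi> h = \<one>\<^bsub>AutoGroup ?N\<^esub>" if "h \<in> carrier H" for h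
        using that by (simp add: AutoGroup_def BijGroup_def)
      then show False using \<phi> by (auto simp: nontrivial_actions_def)
    qed
  qed
qed

context dbl_gens
begin

text \<open>Every \<open>E i j\<close> centralises \<open>a\<close>, whereas conjugation by
  \<open>x\<close> sends \<open>a\<close> to \<open>E p r\<close>.\<close>

lemma x_not_E:
  assumes "E p r \<noteq> a"
  shows "x \<noteq> E i j"
proof
  assume x: "x = E i j"
  have "E p r \<otimes> x = x \<otimes> a" using x_a by (simp add: E_def)
  also have "\<dots> = E i j \<otimes> E 1 0" unfolding x by (simp add: E_def)
  also have "\<dots> = E 1 0 \<otimes> E i j" by (simp add: E_mult add.commute)
  also have "\<dots> = a \<otimes> x" unfolding x by (simp add: E_def)
  finally show False using assms by simp
qed

end

text \<open>\<open>u\<close> acts trivially and has order 4, so (1, u) has order 12;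
  \<open>v\<close> inverts both Z_3 and \<open>u\<close>, so (0, v) inverts (1, u), and its square
  u^2 is the sixth power of (1, u). These are the model generators.\<close>

lemma semidirect_dicyclic:
  assumes "group H" and H: "finite (carrier H)" "order H = 8"
    and \<phi>: "\<phi> \<in> hom H (AutoGroup (integer_mod_group 3))"
    and act: "\<And>n. n \<in> {0, 1, 2} \<Longrightarrow> \<phi> u n = n" "\<phi> v 1 = 2" "\<And>h. h \<in> carrier H \<Longrightarrow> \<phi> h 0 = 0"
    and uv: "u \<in> carrier H" "v \<in> carrier H" "u \<otimes>\<^bsub>H\<^esub> u \<noteq> \<one>\<^bsub>H\<^esub>"
      "u \<otimes>\<^bsub>H\<^esub> (u \<otimes>\<^bsub>H\<^esub> (u \<otimes>\<^bsub>H\<^esub> u)) = \<one>\<^bsub>H\<^esub>" "v \<otimes>\<^bsub>H\<^esub> v = u \<otimes>\<^bsub>H\<^esub> u"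
      "v \<otimes>\<^bsub>H\<^esub> u = u \<otimes>\<^bsub>H\<^esub> (u \<otimes>\<^bsub>H\<^esub> (u \<otimes>\<^bsub>H\<^esub> v))"
  shows "semidirect_product (integer_mod_group 3) H \<phi> \<cong> dbl 12 1 11 0 0 6 0"
proof -
  let ?N = "integer_mod_group 3"
  let ?S = "semidirect_product ?N H \<phi>"
  interpret H: group H by fact
  interpret S: group ?S
    by (rule group_semidirect_product [OF group_integer_mod_group \<open>group H\<close> \<phi>])
  have mult: "(n, h) \<otimes>\<^bsub>?S\<^esub> (n', h') = ((n + \<phi> h n') mod 3, h \<otimes>\<^bsub>H\<^esub> h')" for n h n' h'
    by (simp add: semidirect_product_def)
  have carr: "carrier ?S = {0, 1, 2} \<times> carrier H"
    by (simp add: semidirect_product_def carrier_mod_3)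
  have one: "\<one>\<^bsub>?S\<^esub> = (0, \<one>\<^bsub>H\<^esub>)"
    by (simp add: semidirect_product_def)
  let ?a = "(1, u)" and ?x = "(0, v)"
  have S_a: "?a \<in> carrier ?S" using uv(1) by (simp add: carr)
  have S_x: "?x \<in> carrier ?S" using uv(2) by (simp add: carr)
  have pow: "?a [^]\<^bsub>?S\<^esub> k = (int k mod 3, u [^]\<^bsub>H\<^esub> k)" for k :: nat
  proof (induction k)
    case 0
    show ?case by (simp add: one)
  next
    case (Suc k)
    have "int k mod 3 \<in> {0, 1, 2}" by (rule mod_3_cases)
    then show ?case
      using Suc act(1) uv(1)
      by (simp only: S.nat_pow_Suc2 [OF S_a] H.nat_pow_Suc2 mult) (simp add: mod_simps)
  qed
  have uuw: "u \<otimes>\<^bsub>H\<^esub> (u \<otimes>\<^bsub>H\<^esub> (u \<otimes>\<^bsub>H\<^esub> (u \<otimes>\<^bsub>H\<^esub> w))) = w" if "w \<in> carrier H" for w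
    using arg_cong [OF uv(4), of "\<lambda>z. z \<otimes>\<^bsub>H\<^esub> w"] that uv(1) by (simp add: H.m_assoc)
  have u4: "u [^]\<^bsub>H\<^esub> (4::nat) = \<one>\<^bsub>H\<^esub>"
    using uv(1,4) by (simp add: eval_nat_numeral H.m_assoc)
  have ord_u: "H.ord u = 4"
  proof -
    have "H.ord u dvd 4" using u4 uv(1) by (simp add: H.pow_eq_id)
    then have "H.ord u \<in> {1, 2, 4}"
    proof -
      have "H.ord u \<le> 4" using \<open>H.ord u dvd 4\<close> by (auto dest: dvd_imp_le)
      moreover have "H.ord u \<noteq> 0" "H.ord u \<noteq> 3" using \<open>H.ord u dvd 4\<close> by (auto intro: Nat.gr0I)
      ultimately show ?thesis by auto
    qed
    moreover have "\<not> H.ord u dvd 2"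
      using H.pow_eq_id [OF uv(1), of 2] uv(1,3) by (simp add: eval_nat_numeral)
    ultimately show ?thesis by auto
  qed
  have ord_a: "S.ord ?a = 12"
  proof -
    have "?a [^]\<^bsub>?S\<^esub> k = \<one>\<^bsub>?S\<^esub> \<longleftrightarrow> 12 dvd k" for k :: nat
    proof -
      have "?a [^]\<^bsub>?S\<^esub> k = \<one>\<^bsub>?S\<^esub> \<longleftrightarrow> int k mod 3 = 0 \<and> 4 dvd k"
        using H.pow_eq_id [OF uv(1), of k] by (simp add: pow one ord_u)
      also have "\<dots> \<longleftrightarrow> 12 dvd k" by presburger
      finally show ?thesis .
    qed
    then show ?thesis using uv(1) by (subst S.ord_unique) (auto simp: carr)
  qed
  have u_pow: "u [^]\<^bsub>H\<^esub> (12::nat) = \<one>\<^bsub>H\<^esub>" "u [^]\<^bsub>H\<^esub> (6::nat) = u \<otimes>\<^bsub>H\<^esub> u"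
    "u [^]\<^bsub>H\<^esub> (11::nat) = u \<otimes>\<^bsub>H\<^esub> (u \<otimes>\<^bsub>H\<^esub> u)"
    using uv(1) by (simp_all add: eval_nat_numeral H.m_assoc uuw uv(4))
  interpret dbl_gens ?S ?a "\<one>\<^bsub>?S\<^esub>" ?x 12 1 11 0 0 6 0
  proof (intro dbl_gens.intro dbl_gens_axioms.intro S.is_group)
    show "?a [^]\<^bsub>?S\<^esub> (12::nat) = \<one>\<^bsub>?S\<^esub>"
      by (simp add: pow one u_pow)
    show "?x \<otimes>\<^bsub>?S\<^esub> ?a = ?a [^]\<^bsub>?S\<^esub> (11::int) \<otimes>\<^bsub>?S\<^esub> \<one>\<^bsub>?S\<^esub> [^]\<^bsub>?S\<^esub> (0::int) \<otimes>\<^bsub>?S\<^esub> ?x"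
      using uv act by (simp add: S.int_pow_numeral pow mult one u_pow H.m_assoc)
    show "?x \<otimes>\<^bsub>?S\<^esub> ?x = ?a [^]\<^bsub>?S\<^esub> (6::int) \<otimes>\<^bsub>?S\<^esub> \<one>\<^bsub>?S\<^esub> [^]\<^bsub>?S\<^esub> (0::int)"
      using uv act by (simp add: S.int_pow_numeral pow mult one u_pow)
  qed (use S_a S_x in simp_all)
  show ?thesis
  proof (rule iso_dbl_order)
    show "group (dbl 12 1 11 0 0 6 0)" by (rule group_models)
    show "finite (carrier ?S)" using H by (simp add: carr)
    show "order ?S = 2 * 12 * 1" using H by (simp add: carr order_def card_cartesian_product)
    show "?x \<noteq> E i j" for i j
    proof (rule x_not_E)
      have "?a [^]\<^bsub>?S\<^esub> (11::int) \<noteq> ?a [^]\<^bsub>?S\<^esub> (1::int)"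
        using uv(1) by (subst S.int_pow_eq) (auto simp: carr ord_a)
      then show "E 11 0 \<noteq> ?a"
        using S_a S.r_one [of "?a [^]\<^bsub>?S\<^esub> (11::int)"] by (simp add: E_def)
    qed
    show "int 12 dvd i \<and> int 1 dvd j" if "E i j = \<one>\<^bsub>?S\<^esub>" for i j
    proof -
      have "?a [^]\<^bsub>?S\<^esub> i = \<one>\<^bsub>?S\<^esub>" using that by (simp add: E_def)
      then show ?thesis using S.int_pow_eq_id [of ?a i] uv(1) ord_a by (simp add: carr)
    qed
  qed
qed

text \<open>The kernel of a nontrivial sign on Q_8 is one of the three cyclic subgroups of order 4.
  Any generator \<open>u\<close> of it and any \<open>v\<close> outside it satisfy the standard
  relations, which is why the choice among the three actions is immaterial.\<close>

lemma dbl_4_8_facts: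
  fixes e :: "(int \<times> int) \<times> bool \<Rightarrow> int"
  assumes sgn: "\<And>d. d \<in> carrier (dbl 4 1 3 0 0 2 0) \<Longrightarrow> e d = 1 \<or> e d = -1"
    and mult: "\<And>d d'. d \<in> carrier (dbl 4 1 3 0 0 2 0) \<Longrightarrow> d' \<in> carrier (dbl 4 1 3 0 0 2 0) \<Longrightarrow> e (d \<otimes>\<^bsub>dbl 4 1 3 0 0 2 0\<^esub> d') = e d * e d'"
    and nontriv: "\<exists>d \<in> carrier (dbl 4 1 3 0 0 2 0). e d = -1"
  obtains u v where "u \<in> carrier (dbl 4 1 3 0 0 2 0)" "v \<in> carrier (dbl 4 1 3 0 0 2 0)" "e u = 1" "e v = -1"
    "u \<otimes>\<^bsub>dbl 4 1 3 0 0 2 0\<^esub> u \<noteq> \<one>\<^bsub>dbl 4 1 3 0 0 2 0\<^esub>" "u \<otimes>\<^bsub>dbl 4 1 3 0 0 2 0\<^esub> (u \<otimes>\<^bsub>dbl 4 1 3 0 0 2 0\<^esub> (u \<otimes>\<^bsub>dbl 4 1 3 0 0 2 0\<^esub> u)) = \<one>\<^bsub>dbl 4 1 3 0 0 2 0\<^esub>"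
    "v \<otimes>\<^bsub>dbl 4 1 3 0 0 2 0\<^esub> v = u \<otimes>\<^bsub>dbl 4 1 3 0 0 2 0\<^esub> u" "v \<otimes>\<^bsub>dbl 4 1 3 0 0 2 0\<^esub> u = u \<otimes>\<^bsub>dbl 4 1 3 0 0 2 0\<^esub> (u \<otimes>\<^bsub>dbl 4 1 3 0 0 2 0\<^esub> (u \<otimes>\<^bsub>dbl 4 1 3 0 0 2 0\<^esub> v))"
proof -
  let ?a = "((1, 0), False) :: (int \<times> int) \<times> bool" and ?b = "((0, 0), True) :: (int \<times> int) \<times> bool"
  have carr: "((i, j), k) \<in> carrier (dbl 4 1 3 0 0 2 0) \<longleftrightarrow> 0 \<le> i \<and> i < 4 \<and> j = 0" for i j :: int and k
    by (auto simp: carrier_dbl)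
  note carr = carr carr [unfolded One_nat_def]
  note m = mult_dbl one_dbl
  have e2: "e ((2, 0), False) = e ?a * e ?a" using mult [of ?a ?a] by (simp add: carr m)
  have e3: "e ((3, 0), False) = e ?a * e ((2, 0), False)"
    using mult [of ?a "((2, 0), False)"] by (simp add: carr m)
  have e0: "e ((0, 0), False) = e ?a * e ((3, 0), False)"
    using mult [of ?a "((3, 0), False)"] by (simp add: carr m)
  have eb: "e ((i, 0), True) = e ((i, 0), False) * e ?b" if "0 \<le> i" "i < 4" for i
    using mult [of "((i, 0), False)" ?b] that by (simp add: carr m)
  have not_both: "e ?a = -1 \<or> e ?b = -1"
  proof (rule ccontr)
    assume "\<not> ?thesis"
    then have 1: "e ?a = 1" "e ?b = 1" using sgn [of ?a] sgn [of ?b] by (auto simp: carr)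
    obtain i j k where d: "((i, j), k) \<in> carrier (dbl 4 1 3 0 0 2 0)" "e ((i, j), k) = -1"
      using nontriv by (metis surj_pair)
    then have "i = 0 \<or> i = 1 \<or> i = 2 \<or> i = 3" "j = 0" unfolding carr by auto
    then have "e ((i, j), False) = 1" using e0 e2 e3 1 by auto
    then have "e ((i, j), k) = 1" using d(1) eb [of i] 1 by (cases k) (auto simp: carr)
    then show False using d(2) by simp
  qed
  have ab: "e ((1, 0), True) = e ?a * e ?b" using eb [of 1] by simp
  \<comment> \<open>The three cases name the kernel: it is generated by a, by b, or by a b.\<close>
  consider "e ?a = 1" "e ?b = -1" | "e ?a = -1" "e ?b = 1" | "e ?a = -1" "e ?b = -1"
    using not_both sgn [of ?a] sgn [of ?b] by (auto simp: carr)
  then show thesis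
  proof cases
    case 1
    then show thesis by (intro that [of ?a ?b]) (simp_all add: carr m)
  next
    case 2
    then show thesis by (intro that [of ?b ?a]) (simp_all add: carr m)
  next
    case 3
    then show thesis by (intro that [of "((1, 0), True)" ?b]) (simp_all add: carr m ab)
  qed
qed

lemma semidirect_quaternion:
  assumes \<phi>: "\<phi> \<in> nontrivial_actions (gen_quaternion 3) (integer_mod_group 3)"
  shows "semidirect_product (integer_mod_group 3) (gen_quaternion 3) \<phi> \<cong> dbl 12 1 11 0 0 6 0"
proof -
  let ?Q = "gen_quaternion 3"
  define D where "D = dbl 4 1 3 0 0 2 0"
  interpret Q: group ?Q
    unfolding gen_quaternion_def Let_def by (rule group_presented_group)
  interpret D: group D unfolding D_def by (rule group_models)
  obtain e where e: "\<And>h. h \<in> carrier ?Q \<Longrightarrow> e h = 1 \<or> e h = (-1 :: int)"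
    "\<And>h n. h \<in> carrier ?Q \<Longrightarrow> n \<in> {0, 1, 2} \<Longrightarrow> \<phi> h n = (e h * n) mod 3"
    "\<And>h h'. h \<in> carrier ?Q \<Longrightarrow> h' \<in> carrier ?Q \<Longrightarrow> e (h \<otimes>\<^bsub>?Q\<^esub> h') = e h * e h'"
    "\<exists>h \<in> carrier ?Q. e h = -1"
    by (rule mod_3_action_sign [OF Q.is_group \<phi>]) blast
  obtain g where g: "g \<in> iso D ?Q"
    using Q.iso_sym [OF gen_quaternion_3 [folded D_def]] by (auto simp: is_iso_def)
  then have hom: "g \<in> hom D ?Q" and bij: "bij_betw g (carrier D) (carrier ?Q)"
    by (auto simp: iso_def)
  interpret g: group_hom D ?Q g
    by (rule group_hom.intro [OF D.is_group Q.is_group group_hom_axioms.intro [OF hom]])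
  have inj: "inj_on g (carrier D)" and img: "g ` carrier D = carrier ?Q"
    using bij by (auto simp: bij_betw_def)
  have "\<exists>d \<in> carrier D. e (g d) = -1"
    using e(4) unfolding img [symmetric] by blast
  moreover have "e (g (d \<otimes>\<^bsub>D\<^esub> d')) = e (g d) * e (g d')" if "d \<in> carrier D" "d' \<in> carrier D" for d d'
    using that e(3) by simp
  moreover have "e (g d) = 1 \<or> e (g d) = -1" if "d \<in> carrier D" for d
    using that e(1) by simp
  ultimately obtain u v where uv: "u \<in> carrier D" "v \<in> carrier D" "e (g u) = 1" "e (g v) = -1"
    "u \<otimes>\<^bsub>D\<^esub> u \<noteq> \<one>\<^bsub>D\<^esub>" "u \<otimes>\<^bsub>D\<^esub> (u \<otimes>\<^bsub>D\<^esub> (u \<otimes>\<^bsub>D\<^esub> u)) = \<one>\<^bsub>D\<^esub>"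
    "v \<otimes>\<^bsub>D\<^esub> v = u \<otimes>\<^bsub>D\<^esub> u" "v \<otimes>\<^bsub>D\<^esub> u = u \<otimes>\<^bsub>D\<^esub> (u \<otimes>\<^bsub>D\<^esub> (u \<otimes>\<^bsub>D\<^esub> v))"
    using dbl_4_8_facts [folded D_def, of "\<lambda>d. e (g d)"] by blast
  show ?thesis
  proof (rule semidirect_dicyclic [OF Q.is_group])
    have "finite (carrier D)" by (simp add: D_def carrier_dbl)
    then show "finite (carrier ?Q)" unfolding img [symmetric] by simp
    show "order ?Q = 8"
      using iso_same_card [OF gen_quaternion_3 [folded D_def]] order_dbl [of 4 1 3 0 0 2 0, folded D_def]
      by (simp add: order_def)
    show "\<phi> \<in> hom ?Q (AutoGroup (integer_mod_group 3))"
      using \<phi> by (simp add: nontrivial_actions_def)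
    show "\<phi> (g u) n = n" if "n \<in> {0, 1, 2}" for n
      using that uv e(2) by auto
    show "\<phi> (g v) 1 = 2" using uv e(2) by simp
    show "\<phi> h 0 = 0" if "h \<in> carrier ?Q" for h using e(2) that by simp
    have "g (u \<otimes>\<^bsub>D\<^esub> u) \<noteq> g \<one>\<^bsub>D\<^esub>"
      using inj uv by (metis D.m_closed D.one_closed inj_onD)
    then show "g u \<otimes>\<^bsub>?Q\<^esub> g u \<noteq> \<one>\<^bsub>?Q\<^esub>" using uv by simp
    show "g u \<otimes>\<^bsub>?Q\<^esub> (g u \<otimes>\<^bsub>?Q\<^esub> (g u \<otimes>\<^bsub>?Q\<^esub> g u)) = \<one>\<^bsub>?Q\<^esub>"
      using arg_cong [OF uv(6), of g] uv(1) by simp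
    show "g v \<otimes>\<^bsub>?Q\<^esub> g v = g u \<otimes>\<^bsub>?Q\<^esub> g u"
      using arg_cong [OF uv(7), of g] uv(1,2) by simp
    show "g v \<otimes>\<^bsub>?Q\<^esub> g u = g u \<otimes>\<^bsub>?Q\<^esub> (g u \<otimes>\<^bsub>?Q\<^esub> (g u \<otimes>\<^bsub>?Q\<^esub> g v))"
      using arg_cong [OF uv(8), of g] uv(1,2) by simp
  qed (use uv in simp_all)
qed

section \<open>Direct products with semidirect factors, and existence of actions\<close>

text \<open>With q = r = 0 and d = 0 the generator t is central and no relation produces it, so its
  exponent is a direct factor; the isomorphism merely moves that coordinate.\<close>

lemma direct_product_dbl:
  assumes D: "group (dbl m 1 p 0 0 c 0)" and m: "m > 0"
  shows "integer_mod_group 2 \<times>\<times> dbl m 1 p 0 0 c 0 \<cong> dbl m 2 p 0 0 c 0"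
proof (rule is_isoI)
  let ?h = "\<lambda>(w, ((i, j), k)). ((i, w), k)" 
  show "?h \<in> iso (integer_mod_group 2 \<times>\<times> dbl m 1 p 0 0 c 0) (dbl m 2 p 0 0 c 0)"
  proof (rule isoI)
    have "?h (x \<otimes>\<^bsub>integer_mod_group 2 \<times>\<times> dbl m 1 p 0 0 c 0\<^esub> y) = ?h x \<otimes>\<^bsub>dbl m 2 p 0 0 c 0\<^esub> ?h y" for x y
      by (cases x; cases y) (auto simp: mult_dbl)
    then show "?h \<in> hom (integer_mod_group 2 \<times>\<times> dbl m 1 p 0 0 c 0) (dbl m 2 p 0 0 c 0)"
      using m by (intro homI) (auto simp: carrier_dbl carrier_integer_mod_group)
    show "bij_betw ?h (carrier (integer_mod_group 2 \<times>\<times> dbl m 1 p 0 0 c 0)) (carrier (dbl m 2 p 0 0 c 0))"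
      by (rule bij_betwI [where g = "\<lambda>((i, w), k). (w, ((i, 0), k))"])
        (use m in \<open>auto simp: carrier_dbl carrier_integer_mod_group\<close>)
  qed
qed

text \<open>By the Chinese remainder theorem a^i splits into i modulo 4, the direct factor, and i
  modulo 3, the normal factor. The exponent 5 is 1 modulo 4 and -1 modulo 3, so x centralises the
  former and inverts the latter. As x^2 = t, the element t^j x^k becomes 2 j + k in the acting Z_4,
  whose sign is its parity.\<close>

lemma semidirect_mod_4:
  assumes \<phi>: "\<phi> \<in> nontrivial_actions (integer_mod_group 4) (integer_mod_group 3)"
  shows "integer_mod_group 4 \<times>\<times> semidirect_product (integer_mod_group 3) (integer_mod_group 4) \<phi>
    \<cong> dbl 12 2 5 0 0 0 1"
proof -
  let ?Z = "integer_mod_group 4" and ?D = "dbl 12 2 5 0 0 0 1"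
  let ?S = "semidirect_product (integer_mod_group 3) ?Z \<phi>"
  obtain e where e: "\<And>h. h \<in> carrier ?Z \<Longrightarrow> e h = 1 \<or> e h = (-1 :: int)"
    "\<And>h n. h \<in> carrier ?Z \<Longrightarrow> n \<in> {0, 1, 2} \<Longrightarrow> \<phi> h n = (e h * n) mod 3"
    "\<And>h h'. h \<in> carrier ?Z \<Longrightarrow> h' \<in> carrier ?Z \<Longrightarrow> e (h \<otimes>\<^bsub>?Z\<^esub> h') = e h * e h'"
    "\<exists>h \<in> carrier ?Z. e h = -1"
    by (rule mod_3_action_sign [OF group_integer_mod_group \<phi>]) blast
  have carr: "carrier ?Z = {0, 1, 2, 3}"
    by (auto simp: carrier_integer_mod_group)
  have e2: "e 2 = e 1 * e 1" and e3: "e 3 = e 1 * e 2" and e0: "e 0 = e 1 * e 3"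
    using e(3) [of 1 1] e(3) [of 1 2] e(3) [of 1 3] by (simp_all add: carr)
  have "e 1 = -1"
  proof (rule ccontr)
    assume "e 1 \<noteq> -1"
    then have "e 1 = 1" using e(1) [of 1] by (simp add: carr)
    then show False using e(4) e0 e2 e3 by (auto simp: carr)
  qed
  then have sgn: "e h = (if even h then 1 else -1)" if "h \<in> {0, 1, 2, 3}" for h
    using that e0 e2 e3 by auto
  interpret D: group ?D by (rule group_models)
  interpret S: group ?S
    using \<phi> by (intro group_semidirect_product) (simp_all add: nontrivial_actions_def)
  have mult: "(n, h) \<otimes>\<^bsub>?S\<^esub> (n', h') = ((n + \<phi> h n') mod 3, (h + h') mod 4)" for n h n' h'
    by (simp add: semidirect_product_def)
  have carrS: "carrier ?S = {0, 1, 2} \<times> {0, 1, 2, 3}"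
    by (simp add: semidirect_product_def carrier_mod_3 carr)
  let ?f = "\<lambda>((i, j), k). (i mod 4, (i mod 3, 2 * j + of_bool k)) :: int \<times> (int \<times> int)"
  have hom: "?f \<in> hom ?D (?Z \<times>\<times> ?S)"
  proof (rule homI)
    fix x assume x: "x \<in> carrier ?D"
    obtain i j k where ijk: "x = ((i, j), k)" by (metis surj_pair)
    have j: "j = 0 \<or> j = 1" using x by (auto simp: ijk carrier_dbl)
    have i: "i mod 4 \<in> {0, 1, 2, 3}" "i mod 3 \<in> {0, 1, 2}" by (rule mod_4_cases, rule mod_3_cases)
    have "(a, (b, 2 * j + of_bool k)) \<in> carrier (?Z \<times>\<times> ?S)"
      if "j = 0 \<or> j = 1" "a \<in> {0, 1, 2, 3}" "b \<in> {0, 1, 2}" for a b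
    proof -
      have "2 * j + of_bool k \<in> {0, 1, 2, 3}" using that(1) by (cases k) auto
      then show ?thesis unfolding carrier_DirProd carrS carr using that(2,3) by blast
    qed
    from this [OF j i] show "?f x \<in> carrier (?Z \<times>\<times> ?S)"
      by (simp only: ijk prod.case)
  next
    fix x y assume xy: "x \<in> carrier ?D" "y \<in> carrier ?D"
    obtain i j k i' j' k' where ijk: "x = ((i, j), k)" "y = ((i', j'), k')" by (metis surj_pair)
    have j: "j = 0 \<or> j = 1" "j' = 0 \<or> j' = 1"
      using xy by (auto simp: ijk carrier_dbl)
    have act: "\<phi> (2 * j + of_bool k) (i' mod 3) = ((if k then -1 else 1) * (i' mod 3)) mod 3"
    proof -
      have 1: "2 * j + of_bool k \<in> {0, 1, 2, 3}" using j(1) by (cases k) auto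
      have 2: "i' mod 3 \<in> {0, 1, 2}" by (rule mod_3_cases)
      have "e (2 * j + of_bool k) = (if k then -1 else 1)"
        using sgn [OF 1] by simp
      then show ?thesis using e(2) [of "2 * j + of_bool k" "i' mod 3"] 1 2 carr by simp
    qed
    have m: "x mod 12 mod 4 = x mod 4" "x mod 12 mod 3 = x mod 3" for x :: int
      by (simp_all add: mod_mod_cancel)
    have f1: "(i + (if k then 5 * i' else i')) mod 12 mod 4 = (i mod 4 + i' mod 4) mod 4"
    proof (cases k)
      case True
      have "(i + 5 * i') mod 4 = (i + i') mod 4" by (simp add: mod_eq_dvd_iff)
      then show ?thesis using True by (simp add: m mod_add_eq)
    qed (simp add: m mod_add_eq)
    have f2: "(i + (if k then 5 * i' else i')) mod 12 mod 3 =
        (i mod 3 + ((if k then -1 else 1) * (i' mod 3)) mod 3) mod 3"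
    proof (cases k)
      case True
      have "(i + 5 * i') mod 3 = (i - i') mod 3" by (simp add: mod_eq_dvd_iff)
      moreover have "(i mod 3 + (-1 * (i' mod 3)) mod 3) mod 3 = (i - i') mod 3"
        by (simp add: mod_simps)
      ultimately show ?thesis using True by (simp add: m)
    qed (simp add: m mod_add_eq)
    have f3: "2 * ((j + j' + (if k \<and> k' then 1 else 0)) mod 2) + of_bool (k \<noteq> k') =
        (2 * j + of_bool k + (2 * j' + of_bool k')) mod (4::int)"
      using j by auto
    have xy_eq: "x \<otimes>\<^bsub>?D\<^esub> y = (((i + (if k then 5 * i' else i')) mod 12,
        (j + j' + (if k \<and> k' then 1 else 0)) mod 2), k \<noteq> k')"
      by (simp add: ijk mult_dbl)
    show "?f (x \<otimes>\<^bsub>?D\<^esub> y) = ?f x \<otimes>\<^bsub>?Z \<times>\<times> ?S\<^esub> ?f y"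
      unfolding xy_eq unfolding ijk
      by (simp only: prod.case mult_DirProd mult_integer_mod_group mult act f1 f2 f3 of_nat_numeral)
  qed
  have inj: "inj_on ?f (carrier ?D)"
  proof (rule inj_onI)
    fix x y assume xy: "x \<in> carrier ?D" "y \<in> carrier ?D" "?f x = ?f y"
    obtain i j k i' j' k' where ijk: "x = ((i, j), k)" "y = ((i', j'), k')" by (metis surj_pair)
    have "0 \<le> i" "i < 12" "0 \<le> i'" "i' < 12" "i mod 4 = i' mod 4" "i mod 3 = i' mod 3"
      using xy by (auto simp: ijk carrier_dbl)
    then have "4 dvd i - i'" "3 dvd i - i'" "\<bar>i - i'\<bar> < 12" by (auto simp flip: mod_eq_dvd_iff)
    moreover have "d = 0" if "4 dvd d" "3 dvd d" "\<bar>d\<bar> < 12" for d :: int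
      using that by presburger
    ultimately have "i = i'" using right_minus_eq by blast
    moreover have "2 * j + of_bool k = 2 * j' + of_bool k'" using xy by (simp add: ijk)
    then have "j = j' \<and> k = k'" by (cases k; cases k'; simp; presburger)
    ultimately show "x = y" by (simp add: ijk)
  qed
  have "card (?f ` carrier ?D) = card (carrier (?Z \<times>\<times> ?S))"
    using card_image [OF inj] order_dbl [of 12 2 5 0 0 0 1]
    by (simp add: order_def carrS carr card_cartesian_product)
  then have "?f ` carrier ?D = carrier (?Z \<times>\<times> ?S)"
    by (intro card_subset_eq hom_carrier [OF hom]) (simp_all add: carrS carr)
  then have "?f \<in> iso ?D (?Z \<times>\<times> ?S)"
    using inj by (intro isoI hom) (simp add: bij_betw_def)
  then show ?thesis by (intro D.iso_sym is_isoI)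
qed

text \<open>Restricted to the carrier because elements of \<open>AutoGroup\<close> are extensional
  functions.\<close>

definition mod_3_neg :: "int \<Rightarrow> int" where
  "mod_3_neg = (\<lambda>n \<in> carrier (integer_mod_group 3). (- n) mod 3)"

lemma mod_3_neg_closed: "mod_3_neg \<in> carrier (AutoGroup (integer_mod_group 3))"
proof -
  have "bij_betw mod_3_neg {0, 1, 2} {0, 1, 2}"
    by (auto simp: bij_betw_def mod_3_neg_def carrier_mod_3 inj_on_def)
  moreover have "mod_3_neg \<in> hom (integer_mod_group 3) (integer_mod_group 3)"
    by (rule homI) (auto simp: mod_3_neg_def carrier_mod_3)
  ultimately show ?thesis
    by (auto simp: AutoGroup_def auto_def Bij_def mod_3_neg_def carrier_mod_3)
qed

lemma mod_3_neg_square: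
  "mod_3_neg \<otimes>\<^bsub>AutoGroup (integer_mod_group 3)\<^esub> mod_3_neg = \<one>\<^bsub>AutoGroup (integer_mod_group 3)\<^esub>"
proof -
  have "mod_3_neg \<in> Bij (carrier (integer_mod_group 3))"
    using mod_3_neg_closed by (simp add: AutoGroup_def auto_def)
  moreover have "compose (carrier (integer_mod_group 3)) mod_3_neg mod_3_neg =
      (\<lambda>x\<in>carrier (integer_mod_group 3). x)"
  proof
    fix x
    show "compose (carrier (integer_mod_group 3)) mod_3_neg mod_3_neg x =
        (\<lambda>x\<in>carrier (integer_mod_group 3). x) x"
      by (cases "x \<in> {0, 1, 2}") (auto simp: compose_def mod_3_neg_def carrier_mod_3)
  qed
  ultimately show ?thesis by (simp add: AutoGroup_def BijGroup_def)
qed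

lemma mod_3_neg_not_one: "mod_3_neg \<noteq> \<one>\<^bsub>AutoGroup (integer_mod_group 3)\<^esub>"
proof
  assume "mod_3_neg = \<one>\<^bsub>AutoGroup (integer_mod_group 3)\<^esub>"
  then have "mod_3_neg 1 = (\<lambda>x\<in>carrier (integer_mod_group 3). x) 1"
    by (simp add: AutoGroup_def BijGroup_def)
  then show False by (simp add: mod_3_neg_def carrier_mod_3)
qed

text \<open>By the universal property it is enough that \<open>mod_3_neg\<close> squares to one: a
  acts trivially and b by negation. Existence is needed to pass from a model back to a quantified
  action.\<close>

lemma ex_quaternion_action:
  "nontrivial_actions (gen_quaternion 3) (integer_mod_group 3) \<noteq> {}"
proof -
  let ?A = "AutoGroup (integer_mod_group 3)"
  interpret A: group ?A by (rule group.AutoGroup [OF group_integer_mod_group])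
  define R where "R = (let a = Gen A2; b = Gen B2 in
    {a ^ 4 \<doteq> 1, b\<^sup>2 \<doteq> a ^ 2, b * a * inverse b \<doteq> inverse a})"
  have Q: "gen_quaternion 3 = presented_group R"
    by (simp add: gen_quaternion_def R_def Let_def)
  let ?f = "case_gen2 \<one>\<^bsub>?A\<^esub> mod_3_neg"
  have "\<exists>h \<in> hom (presented_group R) ?A. \<forall>g. h (pres_class R (Gen g)) = ?f g"
  proof (rule presented_group_universal [OF A.is_group])
    show "?f g \<in> carrier ?A" for g by (cases g) (simp_all add: mod_3_neg_closed)
    show "term_val ?A ?f s = term_val ?A ?f t" if "(s, t) \<in> R" for s t
      using that mod_3_neg_closed
      by (auto simp: R_def Let_def term_val_simps term_val_power_numeral mod_3_neg_square)
  qed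
  then obtain h where h: "h \<in> hom (presented_group R) ?A" "h (pres_class R (Gen B2)) = mod_3_neg"
    by (metis gen2.case(2))
  then have "h \<in> nontrivial_actions (gen_quaternion 3) (integer_mod_group 3)"
    unfolding nontrivial_actions_def Q using mod_3_neg_not_one pres_class_closed by force
  then show ?thesis by blast
qed

lemma ex_mod_4_action:
  "nontrivial_actions (integer_mod_group 4) (integer_mod_group 3) \<noteq> {}"
proof -
  let ?A = "AutoGroup (integer_mod_group 3)"
  interpret A: group ?A by (rule group.AutoGroup [OF group_integer_mod_group])
  let ?h = "\<lambda>k :: int. if even k then \<one>\<^bsub>?A\<^esub> else mod_3_neg"
  have "?h \<in> hom (integer_mod_group 4) ?A"
  proof (rule homI)
    show "?h x \<in> carrier ?A" for x by (simp add: mod_3_neg_closed)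
    show "?h (x \<otimes>\<^bsub>integer_mod_group 4\<^esub> y) = ?h x \<otimes>\<^bsub>?A\<^esub> ?h y" for x y
    proof -
      have "even ((x + y) mod 4) \<longleftrightarrow> even (x + y)" by presburger
      then show ?thesis by (auto simp: mod_3_neg_closed mod_3_neg_square)
    qed
  qed
  moreover have "?h 1 \<noteq> \<one>\<^bsub>?A\<^esub>" using mod_3_neg_not_one by simp
  ultimately have "?h \<in> nontrivial_actions (integer_mod_group 4) (integer_mod_group 3)"
    unfolding nontrivial_actions_def by (auto intro!: bexI [of _ 1])
  then show ?thesis by blast
qed

lemma involution_count_mod:
  assumes "k > 0"
  shows "involution_count (integer_mod_group (2 * k)) = 1"
proof -
  interpret Z: group "integer_mod_group (2 * k)" by (rule group_integer_mod_group)
  have "{x \<in> carrier (integer_mod_group (2 * k)). x \<noteq> \<one>\<^bsub>integer_mod_group (2 * k)\<^esub> \<and>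
      x \<otimes>\<^bsub>integer_mod_group (2 * k)\<^esub> x = \<one>\<^bsub>integer_mod_group (2 * k)\<^esub>} = {int k}"
    using assms by (auto simp: carrier_integer_mod_group dvd_less_double_iff)
  then show ?thesis unfolding Z.involution_count_eq by simp
qed

lemma involution_count_mod_times_2:
  assumes "k > 0"
  shows "involution_count (integer_mod_group (2 * k) \<times>\<times> integer_mod_group 2) = 3"
proof -
  let ?Z = "integer_mod_group (2 * k) \<times>\<times> integer_mod_group 2"
  interpret Z: group ?Z by (intro DirProd_group group_integer_mod_group)
  have "{x \<in> carrier ?Z. x \<noteq> \<one>\<^bsub>?Z\<^esub> \<and> x \<otimes>\<^bsub>?Z\<^esub> x = \<one>\<^bsub>?Z\<^esub>} = {(int k, 0), (0, 1), (int k, 1)}"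
    using assms by (auto simp: carrier_integer_mod_group dvd_less_double_iff)
  then show ?thesis unfolding Z.involution_count_eq using assms by simp
qed

section \<open>Groups with few cyclic subgroups of large order\<close>

lemma totient_gt_2: "totient n > 2 \<Longrightarrow> totient n \<ge> 4"
proof -
  assume n: "totient n > 2"
  then have "n > 2" using totient_le [of n] by linarith
  then have "even (totient n)" by (rule totient_even)
  moreover have "totient n \<noteq> 3" using \<open>even (totient n)\<close> by auto
  ultimately show ?thesis using n by linarith
qed

context group
begin

lemma big_cyclic_cases:
  assumes fin: "finite (carrier G)" and half: "2 * card (cyclic_subgroups G) = order G"
  shows "4 * card big_cyclic \<le> (\<Sum>C\<in>big_cyclic. totient (card C))"
    and "(\<Sum>C\<in>big_cyclic. totient (card C)) = 1 + involution_count G + 2 * card big_cyclic"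
    and "2 * card big_cyclic \<le> 1 + involution_count G" "card big_cyclic > 0"
proof -
  have "(\<Sum>C\<in>big_cyclic. 4) \<le> (\<Sum>C\<in>big_cyclic. totient (card C))"
    by (rule sum_mono) (auto simp: big_cyclic_def intro: totient_gt_2)
  then show 1: "4 * card big_cyclic \<le> (\<Sum>C\<in>big_cyclic. totient (card C))"
    by (simp add: mult.commute)
  show 2: "(\<Sum>C\<in>big_cyclic. totient (card C)) = 1 + involution_count G + 2 * card big_cyclic"
    by (rule sum_big_cyclic [OF fin half])
  show "2 * card big_cyclic \<le> 1 + involution_count G" using 1 2 by linarith
  show "card big_cyclic > 0"
  proof (rule ccontr)
    assume "\<not> card big_cyclic > 0"
    then have "big_cyclic = {}" using finite_big_cyclic [OF fin] by simp
    then show False using 2 by simp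
  qed
qed

lemma big_cyclic_memI: "y \<in> carrier G \<Longrightarrow> totient (ord y) > 2 \<Longrightarrow> cyc y \<in> big_cyclic"
  by (simp add: big_cyclic_def cyclic_subgroups_eq_image generate_pow_card)

lemma big_cyclic_memE:
  assumes "C \<in> big_cyclic"
  obtains a where "a \<in> carrier G" "C = cyc a" "totient (card C) = totient (ord a)" "totient (ord a) > 2"
proof -
  have "C \<in> cyc ` carrier G" "totient (card C) > 2"
    using assms unfolding big_cyclic_def cyclic_subgroups_eq_image by blast+
  then obtain a where "a \<in> carrier G" "C = cyc a" by blast
  then show thesis using that [of a] \<open>totient (card C) > 2\<close> generate_pow_card [of a] by simp
qed

lemma one_involution_big_cyclic:
  assumes fin: "finite (carrier G)" and half: "2 * card (cyclic_subgroups G) = order G"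
    and inv: "involution_count G = 1"
  obtains a where "a \<in> carrier G" "totient (ord a) = 4"
    "\<And>y. y \<in> carrier G \<Longrightarrow> totient (ord y) > 2 \<Longrightarrow> cyc y = cyc a"
proof -
  note cases = big_cyclic_cases [OF fin half]
  have "card big_cyclic = 1" using cases inv by linarith
  then obtain C where C: "big_cyclic = {C}" by (auto simp: card_1_singleton_iff)
  have mem: "C \<in> big_cyclic" using C by simp
  from mem obtain a where a: "a \<in> carrier G" "C = cyc a" "totient (card C) = totient (ord a)"
    by (rule big_cyclic_memE)
  show thesis
  proof (rule that [OF a(1)])
    show "totient (ord a) = 4" using cases(2) inv a(3) by (simp add: C)
    show "cyc y = cyc a" if "y \<in> carrier G" "totient (ord y) > 2" for y
      using big_cyclic_memI [OF that] unfolding C a(2) by (rule singletonD)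
  qed
qed

lemma three_involutions_big_cyclic:
  assumes fin: "finite (carrier G)" and half: "2 * card (cyclic_subgroups G) = order G"
    and inv: "involution_count G = 3"
  obtains
    (one) a where "a \<in> carrier G" "totient (ord a) = 6"
      "\<And>y. y \<in> carrier G \<Longrightarrow> totient (ord y) > 2 \<Longrightarrow> cyc y = cyc a"
  | (two) a b where "a \<in> carrier G" "b \<in> carrier G" "totient (ord a) = 4" "totient (ord b) = 4"
      "cyc a \<noteq> cyc b"
      "\<And>y. y \<in> carrier G \<Longrightarrow> totient (ord y) > 2 \<Longrightarrow> cyc y = cyc a \<or> cyc y = cyc b"
proof -
  note cases = big_cyclic_cases [OF fin half]
  consider "card big_cyclic = 1" | "card big_cyclic = 2" using cases inv by linarith
  then show thesis
  proof cases
    case 1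
    then obtain C where C: "big_cyclic = {C}" by (auto simp: card_1_singleton_iff)
    have mem: "C \<in> big_cyclic" using C by simp
    from mem obtain a where a: "a \<in> carrier G" "C = cyc a" "totient (card C) = totient (ord a)"
      by (rule big_cyclic_memE)
    show thesis
    proof (rule one [OF a(1)])
      show "totient (ord a) = 6" using cases(2) inv a(3) by (simp add: C)
      show "cyc y = cyc a" if "y \<in> carrier G" "totient (ord y) > 2" for y
        using big_cyclic_memI [OF that] unfolding C a(2) by (rule singletonD)
    qed
  next
    case 2
    then obtain C D where CD: "big_cyclic = {C, D}" "C \<noteq> D" by (auto simp: card_2_iff)
    have mem: "C \<in> big_cyclic" "D \<in> big_cyclic" using CD by simp_all
    from mem(1) obtain a where a: "a \<in> carrier G" "C = cyc a" "totient (card C) = totient (ord a)"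
      "totient (ord a) > 2"
      by (rule big_cyclic_memE)
    from mem(2) obtain b where b: "b \<in> carrier G" "D = cyc b" "totient (card D) = totient (ord b)"
      "totient (ord b) > 2"
      by (rule big_cyclic_memE)
    have "(\<Sum>C\<in>big_cyclic. totient (card C)) = totient (card C) + totient (card D)"
      using CD(2) by (simp add: CD(1))
    then have "totient (ord a) + totient (ord b) = 8"
      using cases(2) inv CD(2) a(3) b(3) by (simp add: CD(1))
    then have t: "totient (ord a) = 4" "totient (ord b) = 4"
      using totient_gt_2 [OF a(4)] totient_gt_2 [OF b(4)] by linarith+
    show thesis
    proof (rule two [OF a(1) b(1) t])
      show "cyc a \<noteq> cyc b" using CD(2) a(2) b(2) by simp
      show "cyc y = cyc a \<or> cyc y = cyc b" if "y \<in> carrier G" "totient (ord y) > 2" for y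
        using big_cyclic_memI [OF that] unfolding CD(1) a(2) b(2) by blast
    qed
  qed
qed

section \<open>Conjugation acting on the big cyclic subgroups\<close>

lemma ord_dvd_if_mem_cyc:
  assumes "x \<in> carrier G" "y \<in> cyc x"
  shows "ord y dvd ord x"
proof -
  obtain k :: int where k: "y = x [^] k" using assms by (auto simp: cyc_mem_iff)
  have "y [^] ord x = x [^] (k * int (ord x))"
    using assms(1) by (simp add: k int_pow_pow flip: int_pow_int)
  also have "\<dots> = \<one>" using assms(1) by (simp add: int_pow_eq_id)
  finally show ?thesis using assms k by (simp add: pow_eq_id)
qed

lemma cyc_pow_closed: "x \<in> carrier G \<Longrightarrow> y \<in> cyc x \<Longrightarrow> y [^] (k::int) \<in> cyc x"
  by (rule subgroup_int_pow_closed [OF generate_is_subgroup]) auto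

lemma cyc_mult_closed: "x \<in> carrier G \<Longrightarrow> y \<in> cyc x \<Longrightarrow> y' \<in> cyc x \<Longrightarrow> y \<otimes> y' \<in> cyc x"
  by (rule generate.eng)

lemma cyc_inv_closed: "x \<in> carrier G \<Longrightarrow> y \<in> cyc x \<Longrightarrow> inv y \<in> cyc x"
  by (rule generate_m_inv_closed) auto

lemma conj_hom: "g \<in> carrier G \<Longrightarrow> (\<lambda>u. g \<otimes> u \<otimes> inv g) \<in> hom G G"
  by (intro homI) (simp_all add: m_assoc)

lemma conj_nat_pow:
  "g \<in> carrier G \<Longrightarrow> u \<in> carrier G \<Longrightarrow> (g \<otimes> u \<otimes> inv g) [^] (k::nat) = g \<otimes> u [^] k \<otimes> inv g"
  using hom_nat_pow [OF conj_hom _ is_group is_group, of g u k] by simp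

lemma conj_int_pow':
  "g \<in> carrier G \<Longrightarrow> u \<in> carrier G \<Longrightarrow> (g \<otimes> u \<otimes> inv g) [^] (k::int) = g \<otimes> u [^] k \<otimes> inv g"
  using hom_int_pow [OF conj_hom _ is_group is_group, of g u k] by simp

lemma conj_eq_iff:
  "g \<in> carrier G \<Longrightarrow> u \<in> carrier G \<Longrightarrow> v \<in> carrier G \<Longrightarrow>
    g \<otimes> u \<otimes> inv g = v \<longleftrightarrow> g \<otimes> u = v \<otimes> g"
  by (metis inv_solve_right' m_closed)

lemma conj_eq_one_iff:
  "g \<in> carrier G \<Longrightarrow> u \<in> carrier G \<Longrightarrow> g \<otimes> u \<otimes> inv g = \<one> \<longleftrightarrow> u = \<one>"
  by (simp add: conj_eq_iff)

lemma ord_conj: "g \<in> carrier G \<Longrightarrow> u \<in> carrier G \<Longrightarrow> ord (g \<otimes> u \<otimes> inv g) = ord u"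
  by (subst ord_unique) (simp_all add: conj_nat_pow conj_eq_one_iff pow_eq_id)

text \<open>Conjugation by \<open>g\<close> permutes the two cyclic subgroups, hence conjugation by \<open>g\<^sup>2\<close> fixes both.\<close>

lemma square_normalizes:
  assumes fin: "finite (carrier G)" and a: "a \<in> carrier G" and b: "b \<in> carrier G" and g: "g \<in> carrier G"
    and two: "\<And>y. y \<in> carrier G \<Longrightarrow> ord y = ord a \<Longrightarrow> cyc y = cyc a \<or> cyc y = cyc b"
  obtains k :: int where "g \<otimes> g \<otimes> a = a [^] k \<otimes> (g \<otimes> g)" "ord (a [^] k) = ord a"
proof -
  define a1 where "a1 = g \<otimes> a \<otimes> inv g"
  define a2 where "a2 = g \<otimes> a1 \<otimes> inv g"
  have c: "a1 \<in> carrier G" "a2 \<in> carrier G" using a g by (simp_all add: a1_def a2_def)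
  have o: "ord a1 = ord a" "ord a2 = ord a"
    using a g c by (simp_all add: ord_conj a1_def a2_def)
  have "a2 \<in> cyc a"
  proof (cases "cyc a1 = cyc a")
    case True
    then obtain k :: int where k: "a1 = a [^] k" using cyc_self [of a1] a by (auto simp: cyc_mem_iff)
    have "a2 = g \<otimes> a [^] k \<otimes> inv g" by (simp add: a2_def k)
    also have "\<dots> = a1 [^] k" using a g by (simp add: a1_def conj_int_pow')
    finally have "a2 = a1 [^] k" .
    then show ?thesis using True cyc_self [of a1] cyc_pow_closed [OF c(1)] by simp
  next
    case False
    then have 1: "cyc a1 = cyc b" using two [OF c(1) o(1)] by blast
    show ?thesis
    proof (cases "cyc a2 = cyc a")
      case True
      then show ?thesis using cyc_self [of a2] by simp
    next
      case False
      \<comment> \<open>Otherwise both conjugates generate \<open>cyc b\<close>. Then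
        \<open>a2\<close> is a power of \<open>a1\<close>, and undoing the conjugation makes
        \<open>a1\<close> a power of \<open>a\<close>.\<close>
      then have "cyc a2 = cyc a1" using 1 two [OF c(2) o(2)] by blast
      then obtain k :: int where k: "a2 = a1 [^] k"
        using cyc_self [of a2] c by (auto simp: cyc_mem_iff)
      then have "g \<otimes> a1 \<otimes> inv g = g \<otimes> a [^] k \<otimes> inv g"
        using a g by (simp add: a1_def conj_int_pow' a2_def)
      then have "a1 = a [^] k" using a g c by simp
      then have "a1 \<in> cyc a" using a by (auto simp: cyc_mem_iff)
      then have "cyc a1 = cyc a" by (rule cyc_eqI [OF fin a _ o(1)])
      then show ?thesis using \<open>cyc a1 \<noteq> cyc a\<close> by simp
    qed
  qed
  then obtain k :: int where k: "a2 = a [^] k" using a by (auto simp: cyc_mem_iff)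
  have "a2 \<otimes> (g \<otimes> g) = g \<otimes> g \<otimes> a"
    using a g by (simp add: a2_def a1_def m_assoc)
  then show thesis using that [of k] k o by simp
qed

lemma conj_int_pow_iterate:
  assumes "h \<in> carrier G" "a \<in> carrier G" "h \<otimes> a = a [^] (k::int) \<otimes> h"
  shows "h [^] (n::nat) \<otimes> a = a [^] (k ^ n) \<otimes> h [^] n"
proof (induction n)
  case 0
  show ?case using assms by simp
next
  case (Suc n)
  have "h [^] Suc n \<otimes> a = h [^] n \<otimes> (a [^] k \<otimes> h)"
    using assms by (simp add: m_assoc)
  also have "\<dots> = (h [^] n \<otimes> a [^] k) \<otimes> h" using assms by (simp add: m_assoc)
  also have "h [^] n \<otimes> a [^] k = (a [^] (k ^ n)) [^] k \<otimes> h [^] n"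
    using assms Suc by (intro conj_int_pow) simp_all
  finally show ?case using assms by (simp add: int_pow_pow m_assoc mult.commute)
qed

text \<open>If \<open>d\<close> divided \<open>k\<close>, the power a^k would already be killed by
  the exponent ord a / d.\<close>

lemma int_pow_ord_coprime:
  assumes a: "a \<in> carrier G" and o: "ord (a [^] (k::int)) = ord a" and d: "d dvd ord a" "d > 1" "ord a > 0"
  shows "\<not> int d dvd k"
proof
  assume "int d dvd k"
  then obtain l where l: "k = int d * l" by (elim dvdE)
  obtain m where m: "ord a = d * m" using d(1) by (elim dvdE)
  have "(a [^] k) [^] m = a [^] (int (ord a) * l)"
    using a by (simp add: l m int_pow_pow mult_ac flip: int_pow_int)
  also have "\<dots> = \<one>" using a by (simp add: int_pow_eq_id)
  finally have "ord a dvd m" using a o by (simp add: pow_eq_id)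
  moreover have "0 < m" "m < ord a" using d m by auto
  ultimately show False by (auto dest: dvd_imp_le)
qed

lemma odd_square_mod_8: "odd (k::int) \<Longrightarrow> 8 dvd k ^ 2 - 1"
proof -
  assume "odd k"
  then obtain l where "k = 2 * l + 1" by (elim oddE)
  then have "k ^ 2 - 1 = 4 * (l * (l + 1))" by (simp add: power2_eq_square algebra_simps)
  moreover have "2 dvd l * (l + 1)" by simp
  then have "4 * 2 dvd 4 * (l * (l + 1))" by (rule mult_dvd_mono [OF dvd_refl])
  ultimately show ?thesis by simp
qed

lemma square_mod_3: "\<not> 3 dvd (k::int) \<Longrightarrow> 3 dvd k ^ 2 - 1"
proof -
  assume "\<not> 3 dvd k"
  then have "3 dvd k - 1 \<or> 3 dvd k + 1" by presburger
  then have "3 dvd (k - 1) * (k + 1)" by auto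
  then show ?thesis by (simp add: power2_eq_square algebra_simps)
qed

text \<open>g^2 acts on \<open>cyc a\<close> by an exponent prime to the order, and units modulo 8
  or 12 square to 1.\<close>

lemma fourth_power_commutes:
  assumes fin: "finite (carrier G)" and a: "a \<in> carrier G" and b: "b \<in> carrier G" and g: "g \<in> carrier G"
    and n: "ord a = 8 \<or> ord a = 12"
    and two: "\<And>y. y \<in> carrier G \<Longrightarrow> ord y = ord a \<Longrightarrow> cyc y = cyc a \<or> cyc y = cyc b"
  shows "g [^] (4::nat) \<otimes> a = a \<otimes> g [^] (4::nat)"
proof -
  obtain k :: int where k: "g \<otimes> g \<otimes> a = a [^] k \<otimes> (g \<otimes> g)" "ord (a [^] k) = ord a"
    using square_normalizes [OF fin a b g two] by blast
  have "\<not> int 2 dvd k" by (rule int_pow_ord_coprime [OF a k(2)]) (use n in auto)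
  then have 8: "8 dvd k ^ 2 - 1" using odd_square_mod_8 by simp
  have "int (ord a) dvd k ^ 2 - 1"
  proof (cases "ord a = 8")
    case False
    then have "\<not> int 3 dvd k" by (intro int_pow_ord_coprime [OF a k(2)]) (use n in auto)
    then have "3 dvd k ^ 2 - 1" using square_mod_3 by simp
    with 8 have "12 dvd k ^ 2 - 1" by presburger
    then show ?thesis using n False by simp
  qed (use 8 in simp)
  then have "a [^] (1::int) = a [^] (k ^ 2)" using a by (simp only: int_pow_eq)
  then have "(g \<otimes> g) [^] (2::nat) \<otimes> a = a \<otimes> (g \<otimes> g) [^] (2::nat)"
    using conj_int_pow_iterate [OF _ a k(1), of 2] g a by simp
  then show ?thesis using g by (simp add: eval_nat_numeral m_assoc)
qed

lemma order_3_commutes: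
  assumes fin: "finite (carrier G)" and a: "a \<in> carrier G" and b: "b \<in> carrier G" and w: "w \<in> carrier G"
    and n: "ord a = 8 \<or> ord a = 12" and w3: "ord w = 3"
    and two: "\<And>y. y \<in> carrier G \<Longrightarrow> ord y = ord a \<Longrightarrow> cyc y = cyc a \<or> cyc y = cyc b"
  shows "w \<otimes> a = a \<otimes> w"
proof -
  have "w [^] (3::nat) = \<one>" using w w3 by (simp add: pow_eq_id)
  then have "w [^] (4::nat) = w" using w by (simp add: eval_nat_numeral)
  then show ?thesis using fourth_power_commutes [OF fin a b w n two] by simp
qed

text \<open>\<open>k\<close> is a Chinese remainder coefficient: raising x y to the power
  \<open>k\<close> keeps \<open>x\<close> and kills \<open>y\<close>.\<close>

lemma mem_cyc_mult:
  assumes "x \<in> carrier G" "y \<in> carrier G" "x \<otimes> y = y \<otimes> x"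
    and "int (ord x) dvd k - 1" "int (ord y) dvd k"
  shows "x \<in> cyc (x \<otimes> y)"
proof -
  have "(x \<otimes> y) [^] k = x [^] k \<otimes> y [^] k" by (rule int_pow_mult_distrib [OF assms(3,1,2)])
  also have "y [^] k = \<one>" using assms by (simp add: int_pow_eq_id)
  also have "x [^] k = x [^] (1::int)" using assms by (simp only: int_pow_eq dvd_diff_commute)
  finally have "x = (x \<otimes> y) [^] k" using assms by simp
  then show ?thesis using assms by (auto simp: cyc_mem_iff)
qed

lemma mem_cyc_mult2:
  assumes "x \<in> carrier G" "y \<in> carrier G" "x \<otimes> y = y \<otimes> x"
    and "int (ord x) dvd k" "int (ord y) dvd k - 1"
  shows "y \<in> cyc (x \<otimes> y)"
  using mem_cyc_mult [OF assms(2,1) assms(3)[symmetric] assms(5,4)] assms(3) by simp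

section \<open>Elements of order 3\<close>

text \<open>\<open>w\<close> commutes with \<open>a\<close>, so the order of w a is a multiple of 24
  and its totient is at least 8, while both big subgroups have totient 4.\<close>

lemma no_order_3_if_8:
  assumes fin: "finite (carrier G)" and a: "a \<in> carrier G" and b: "b \<in> carrier G" and w: "w \<in> carrier G"
    and a8: "ord a = 8" and tb: "totient (ord b) = 4" and w3: "ord w = 3"
    and big: "\<And>y. y \<in> carrier G \<Longrightarrow> totient (ord y) > 2 \<Longrightarrow> cyc y = cyc a \<or> cyc y = cyc b"
  shows False
proof -
  have wa: "w \<otimes> a = a \<otimes> w"
    by (rule order_3_commutes [OF fin a b w]) (use a8 w3 big in \<open>auto simp: totient_values\<close>)
  have c: "w \<otimes> a \<in> carrier G" using w a by simp
  have "w \<in> cyc (w \<otimes> a)" by (rule mem_cyc_mult [OF w a wa, of 16]) (simp_all add: a8 w3)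
  then have 3: "3 dvd ord (w \<otimes> a)" using ord_dvd_if_mem_cyc [OF c] w3 by metis
  have "a \<in> cyc (w \<otimes> a)" by (rule mem_cyc_mult2 [OF w a wa, of 9]) (simp_all add: a8 w3)
  then have "8 dvd ord (w \<otimes> a)" using ord_dvd_if_mem_cyc [OF c] a8 by metis
  with 3 have "24 dvd ord (w \<otimes> a)" by presburger
  then have 8: "totient (ord (w \<otimes> a)) \<ge> 8"
    using totient_dvd_mono [of 24] ord_ge_1 [OF fin c] by (simp add: totient_values)
  then have "cyc (w \<otimes> a) = cyc a \<or> cyc (w \<otimes> a) = cyc b" using big [OF c] by simp
  then have "ord (w \<otimes> a) = ord a \<or> ord (w \<otimes> a) = ord b"
    using ord_eq_if_cyc_eq c a b by blast
  then show False using 8 a8 tb by (auto simp: totient_values)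
qed

text \<open>Split \<open>a\<close> into f = a^3 of order 4 and y = a^4 of order 3. For an element v
  of order 3 outside \<open>cyc a\<close> that commutes with f, the order of f v is divisible by 12,
  so f v generates \<open>cyc b\<close>, which therefore contains f and v. Applied to
  \<open>w\<close> and to y w this puts f and y, hence \<open>a\<close>, into \<open>cyc b\<close>;
  the two subgroups coincide although only one contains \<open>w\<close>.\<close>

lemma order_3_mem_cyc_if_12:
  assumes fin: "finite (carrier G)" and a: "a \<in> carrier G" and b: "b \<in> carrier G" and w: "w \<in> carrier G"
    and a12: "ord a = 12" and tb: "totient (ord b) = 4" and w3: "ord w = 3"
    and big: "\<And>y. y \<in> carrier G \<Longrightarrow> totient (ord y) > 2 \<Longrightarrow> cyc y = cyc a \<or> cyc y = cyc b"
  shows "w \<in> cyc a"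
proof (rule ccontr)
  assume not: "w \<notin> cyc a"
  have wa: "w \<otimes> a = a \<otimes> w"
    by (rule order_3_commutes [OF fin a b w]) (use a12 w3 big in \<open>auto simp: totient_values\<close>)
  define f y where "f = a [^] (3::int)" and "y = a [^] (4::int)"
  have c [simp]: "f \<in> carrier G" "y \<in> carrier G" using a by (simp_all add: f_def y_def)
  have mem: "f \<in> cyc a" "y \<in> cyc a" using a by (auto simp: cyc_mem_iff f_def y_def)
  have of: "ord f = 4" and oy: "ord y = 3"
    using a a12 by (simp_all add: f_def y_def int_pow_numeral ord_pow)
  have fw: "f \<otimes> w = w \<otimes> f" and yw: "y \<otimes> w = w \<otimes> y"
    using conj_int_pow [OF w a a wa] by (simp_all add: f_def y_def)
  have key: "f \<in> cyc b \<and> v \<in> cyc b" if v: "v \<in> carrier G" "ord v = 3" "f \<otimes> v = v \<otimes> f" "v \<notin> cyc a" for v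
  proof -
    have c': "f \<otimes> v \<in> carrier G" using v by simp
    have f: "f \<in> cyc (f \<otimes> v)" by (rule mem_cyc_mult [of _ _ 9]) (use v of in simp_all)
    have v': "v \<in> cyc (f \<otimes> v)" by (rule mem_cyc_mult2 [of _ _ 4]) (use v of in simp_all)
    have "4 dvd ord (f \<otimes> v)" "3 dvd ord (f \<otimes> v)"
      using ord_dvd_if_mem_cyc [OF c' f] ord_dvd_if_mem_cyc [OF c' v'] v of by auto
    then have "12 dvd ord (f \<otimes> v)" by presburger
    then have "totient (ord (f \<otimes> v)) \<ge> 4"
      using totient_dvd_mono [of 12] ord_ge_1 [OF fin c'] by (simp add: totient_values)
    then have "cyc (f \<otimes> v) = cyc a \<or> cyc (f \<otimes> v) = cyc b" using big [OF c'] by simp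
    then show ?thesis using f v' v(4) by auto
  qed
  have fb: "f \<in> cyc b" and wb: "w \<in> cyc b" using key [OF w w3 fw not] by auto
  have v: "y \<otimes> w \<in> carrier G" using w by simp
  have yw_not: "y \<otimes> w \<notin> cyc a"
  proof
    assume "y \<otimes> w \<in> cyc a"
    then have "inv y \<otimes> (y \<otimes> w) \<in> cyc a"
      using a mem cyc_inv_closed cyc_mult_closed by blast
    then show False using not w by simp
  qed
  have "ord (y \<otimes> w) = 3"
  proof -
    have "(y \<otimes> w) [^] (3::nat) = \<one>"
      using w pow_ord_eq_1 [OF w] pow_ord_eq_1 [OF c(2)] w3 oy by (simp add: pow_mult_distrib [OF yw])
    then have "ord (y \<otimes> w) dvd 3" using v by (simp add: pow_eq_id)
    moreover have "y \<otimes> w \<noteq> \<one>" using yw_not generate.one by metis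
    ultimately show ?thesis using ord_eq_1 [OF v] prime_nat_iff [of 3] by auto
  qed
  moreover have "f \<otimes> (y \<otimes> w) = y \<otimes> w \<otimes> f"
  proof -
    have "f \<otimes> y = y \<otimes> f" using a by (simp add: f_def y_def flip: int_pow_mult)
    then have "f \<otimes> (y \<otimes> w) = y \<otimes> (f \<otimes> w)" using w by (simp flip: m_assoc)
    then show ?thesis using w by (simp add: fw m_assoc)
  qed
  ultimately have "y \<otimes> w \<in> cyc b" using key [OF v _ _ yw_not] by blast
  then have "y \<otimes> w \<otimes> inv w \<in> cyc b"
    using b wb cyc_inv_closed cyc_mult_closed by blast
  then have yb: "y \<in> cyc b" using w by (simp add: m_assoc)
  \<comment> \<open>Exponents: 3 * 3 - 4 * 2 = 1.\<close>
  have "a = f [^] (3::int) \<otimes> y [^] (-2::int)"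
    using a by (simp add: f_def y_def int_pow_pow flip: int_pow_mult)
  then have ab: "a \<in> cyc b" using b fb yb by (metis cyc_pow_closed cyc_mult_closed)
  have "ord b \<in> {5, 8, 10, 12}" by (rule totient_eq_4 [OF tb])
  moreover have "12 dvd ord b" using ord_dvd_if_mem_cyc [OF b ab] a12 by simp
  ultimately have "ord b = ord a" using a12 by auto
  then have "cyc a = cyc b" by (intro cyc_eqI [OF fin b ab]) simp
  then show False using wb not by simp
qed

section \<open>Excluding elements of order 5, 7 and 9\<close>

text \<open>Twice either exponent is an odd multiple of \<open>ord x\<close>. The difference of two
  odd multiples is an even one, so the exponents agree modulo \<open>ord x\<close>.\<close>

lemma involution_in_cyc_unique:
  assumes x: "x \<in> carrier G" and u: "u \<in> cyc x" "u \<otimes> u = \<one>" "u \<noteq> \<one>"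
    and v: "v \<in> cyc x" "v \<otimes> v = \<one>" "v \<noteq> \<one>"
  shows "u = v"
proof -
  obtain i j :: int where ij: "u = x [^] i" "v = x [^] j"
    using u(1) v(1) x by (auto simp: cyc_mem_iff)
  have "int (ord x) dvd i + i" "\<not> int (ord x) dvd i" "int (ord x) dvd j + j" "\<not> int (ord x) dvd j"
    using u v x by (simp_all add: ij flip: int_pow_eq_id int_pow_mult)
  then have "int (ord x) dvd j - i"
  proof -
    assume *: "int (ord x) dvd i + i" "\<not> int (ord x) dvd i" "int (ord x) dvd j + j" "\<not> int (ord x) dvd j"
    obtain l where l: "i + i = int (ord x) * l" using *(1) by (elim dvdE)
    obtain m where m: "j + j = int (ord x) * m" using *(3) by (elim dvdE)
    have "odd l"
    proof
      assume "even l"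
      then obtain l' where "l = 2 * l'" by (elim evenE)
      then have "i = int (ord x) * l'" using l by simp
      then show False using *(2) by simp
    qed
    moreover have "odd m"
    proof
      assume "even m"
      then obtain m' where "m = 2 * m'" by (elim evenE)
      then have "j = int (ord x) * m'" using m by simp
      then show False using *(4) by simp
    qed
    ultimately have "even (m - l)" by simp
    then obtain d where "m - l = 2 * d" by (elim evenE)
    moreover have "2 * (j - i) = int (ord x) * (m - l)" using l m by (simp add: algebra_simps)
    ultimately have "j - i = int (ord x) * d" by simp
    then show ?thesis by simp
  qed
  then show ?thesis using x by (simp add: ij int_pow_eq)
qed

text \<open>If an involution \<open>t\<close> inverted \<open>c\<close>, the elements \<open>c\<^sup>i t\<close> would be at least five involutions.\<close>

lemma involution_commutes_odd:
  assumes fin: "finite (carrier G)" and c: "c \<in> carrier G" and q: "ord c \<in> {5, 7, 9}"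
    and unique: "\<And>y. y \<in> carrier G \<Longrightarrow> ord y = ord c \<Longrightarrow> cyc y = cyc c"
    and t: "t \<in> carrier G" "t \<otimes> t = \<one>" "t \<noteq> \<one>"
    and few: "card {u \<in> carrier G. u \<noteq> \<one> \<and> u \<otimes> u = \<one>} \<le> 3"
  shows "t \<otimes> c = c \<otimes> t"
proof (rule ccontr)
  assume not: "t \<otimes> c \<noteq> c \<otimes> t"
  have "cyc (t \<otimes> c \<otimes> inv t) = cyc c"
    by (rule unique) (use t c in \<open>simp_all add: ord_conj\<close>)
  then obtain k :: int where "t \<otimes> c \<otimes> inv t = c [^] k"
    using cyc_self [of "t \<otimes> c \<otimes> inv t"] c by (auto simp: cyc_mem_iff)
  then have k: "t \<otimes> c = c [^] k \<otimes> t" using t c by (simp add: conj_eq_iff)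
  have "t [^] (2::nat) \<otimes> c = c [^] (k ^ 2) \<otimes> t [^] (2::nat)"
    by (rule conj_int_pow_iterate [OF t(1) c k])
  then have "c [^] (1::int) = c [^] (k ^ 2)"
    using t c by (simp add: eval_nat_numeral)
  then have k2: "int (ord c) dvd (k - 1) * (k + 1)"
    using c by (simp add: int_pow_eq power2_eq_square algebra_simps del: int_pow_1)
  have "\<not> int (ord c) dvd k - 1"
  proof
    assume "int (ord c) dvd k - 1"
    then have "c [^] (1::int) = c [^] k" using c by (simp only: int_pow_eq)
    then show False using not k c by simp
  qed
  \<comment> \<open>For the primes 5 and 7 this is immediate from k^2 = 1. For 9 the point is that 3
    cannot divide both k - 1 and k + 1.\<close>
  then have "int (ord c) dvd k + 1"
  proof -
    assume *: "\<not> int (ord c) dvd k - 1"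
    consider "ord c = 5" | "ord c = 7" | "ord c = 9" using q by auto
    then show ?thesis
    proof cases
      case 1
      then show ?thesis using k2 * prime_dvd_mult_iff [of "5::int" "k - 1" "k + 1"] by simp
    next
      case 2
      then show ?thesis using k2 * prime_dvd_mult_iff [of "7::int" "k - 1" "k + 1"] by simp
    next
      case 3
      show ?thesis
      proof (cases "3 dvd k - 1")
        case True
        then have "\<not> 3 dvd k + 1" by presburger
        then have "coprime (k + 1) 3"
          using prime_imp_coprime [of "3::int" "k + 1"] by (simp add: coprime_commute)
        then have "coprime (k + 1) 9" using coprime_power_right_iff [of "k + 1" 3 2] by simp
        then have "9 dvd k - 1"
          using k2 3 by (simp add: coprime_commute coprime_dvd_mult_left_iff)
        then show ?thesis using * 3 by simp
      next
        case False
        then have "coprime (k - 1) 3"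
          using prime_imp_coprime [of "3::int" "k - 1"] by (simp add: coprime_commute)
        then have "coprime (k - 1) 9" using coprime_power_right_iff [of "k - 1" 3 2] by simp
        then show ?thesis
          using k2 3 by (simp add: coprime_commute coprime_dvd_mult_right_iff)
      qed
    qed
  qed
  then have "c [^] k = c [^] (-1 :: int)" using c by (simp add: int_pow_eq) (metis add.inverse_inverse diff_minus_eq_add dvd_minus_iff minus_diff_eq)
  then have tc: "t \<otimes> c = c [^] (-1::int) \<otimes> t" using k by simp
  have tci: "t \<otimes> c [^] i = c [^] (- i) \<otimes> t" for i :: int
    using conj_int_pow [OF t(1) c _ tc, of i] c by (simp add: int_pow_pow)
  \<comment> \<open>Five exponents exceed the allowed three involutions and still give distinct
    powers, since \<open>ord c\<close> is at least 5.\<close>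
  let ?f = "\<lambda>i::nat. c [^] (int i) \<otimes> t"
  have "?f ` {..<5} \<subseteq> {u \<in> carrier G. u \<noteq> \<one> \<and> u \<otimes> u = \<one>}"
  proof (intro image_subsetI CollectI conjI)
    fix i :: nat
    show "?f i \<in> carrier G" using c t by simp
    show "?f i \<otimes> ?f i = \<one>"
    proof -
      have "?f i \<otimes> ?f i = c [^] int i \<otimes> (t \<otimes> c [^] int i) \<otimes> t"
        using c t by (simp add: m_assoc del: int_pow_int)
      also have "\<dots> = c [^] int i \<otimes> c [^] (- int i) \<otimes> (t \<otimes> t)"
        unfolding tci using c t(1) by (simp add: m_assoc)
      also have "\<dots> = \<one>" using c t by (simp flip: int_pow_mult)
      finally show ?thesis .
    qed
    show "?f i \<noteq> \<one>"
    proof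
      assume 1: "?f i = \<one>"
      then have "t = inv (c [^] int i)" using c t by (metis inv_equality inv_inv int_pow_closed)
      then have "t = c [^] (- int i)" using c by (simp add: int_pow_neg)
      then have "t \<otimes> c = c \<otimes> t" using c int_pow_commute [of c c] by simp
      then show False using not by simp
    qed
  qed
  then have "card (?f ` {..<5}) \<le> card {u \<in> carrier G. u \<noteq> \<one> \<and> u \<otimes> u = \<one>}"
    using fin by (intro card_mono) simp_all
  then have "card (?f ` {..<5}) \<le> 3" using few by (rule le_trans)
  moreover have "inj_on ?f {..<5}"
  proof (rule inj_onI)
    fix i j :: nat assume ij: "i \<in> {..<5}" "j \<in> {..<5}" "?f i = ?f j"
    then have "c [^] int i = c [^] int j" using c t by simp
    then have "int (ord c) dvd int j - int i" using c int_pow_eq by blast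
    moreover have "\<bar>int j - int i\<bar> < int (ord c)" using ij q by auto
    ultimately have "int j - int i = 0"
      using dvd_imp_le_int [of "int j - int i" "int (ord c)"] by (metis abs_of_nat linorder_not_le)
    then show "i = j" by simp
  qed
  ultimately show False by (simp add: card_image)
qed

lemma two_coprime_commuting:
  assumes fin: "finite (carrier G)" and c: "c \<in> carrier G" "odd (ord c)"
    and t: "t \<in> carrier G" "t \<otimes> t = \<one>" "t \<noteq> \<one>" and comm: "t \<otimes> c = c \<otimes> t"
  shows "c \<in> cyc (t \<otimes> c)" "t \<in> cyc (t \<otimes> c)" "t \<notin> cyc c" "ord c dvd ord (t \<otimes> c)"
proof -
  have t2: "ord t = 2" using t ord_eq_2_iff by blast
  show 1: "c \<in> cyc (t \<otimes> c)"
    by (rule mem_cyc_mult2 [OF t(1) c(1) comm, of "int (ord c) + 1"]) (use c t2 in auto)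
  show "t \<in> cyc (t \<otimes> c)"
    by (rule mem_cyc_mult [OF t(1) c(1) comm, of "int (ord c)"]) (use c t2 in auto)
  show "t \<notin> cyc c"
    using ord_dvd_if_mem_cyc [OF c(1), of t] t2 c(2) by auto
  show "ord c dvd ord (t \<otimes> c)"
    using ord_dvd_if_mem_cyc [OF _ 1] t c by simp
qed

text \<open>The product with a commuting involution has twice the order, so it generates another
  subgroup whose totient is still above 2.\<close>

lemma odd_cyc_big:
  assumes fin: "finite (carrier G)" and c: "c \<in> carrier G" and q: "ord c \<in> {5, 7, 9}"
    and t: "t \<in> carrier G" "t \<otimes> t = \<one>" "t \<noteq> \<one>" and comm: "t \<otimes> c = c \<otimes> t"
  shows "totient (ord (t \<otimes> c)) > 2" "cyc (t \<otimes> c) \<noteq> cyc c"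
proof -
  have odd: "odd (ord c)" using q by auto
  note * = two_coprime_commuting [OF fin c odd t comm]
  have "totient (ord c) > 2" using q by (auto simp: totient_values)
  then show "totient (ord (t \<otimes> c)) > 2"
    using totient_dvd_mono [OF *(4)] ord_ge_1 [OF fin, of "t \<otimes> c"] t c by simp
  show "cyc (t \<otimes> c) \<noteq> cyc c" using * by blast
qed

text \<open>Both \<open>cyc c\<close> and \<open>cyc (t \<otimes> c)\<close> would be big, but there
  is only one big subgroup.\<close>

lemma no_odd_one:
  assumes fin: "finite (carrier G)" and c: "c \<in> carrier G" and q: "ord c \<in> {5, 7, 9}"
    and big: "\<And>y. y \<in> carrier G \<Longrightarrow> totient (ord y) > 2 \<Longrightarrow> cyc y = cyc a"
    and t: "t \<in> carrier G" "t \<otimes> t = \<one>" "t \<noteq> \<one>"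
    and few: "card {u \<in> carrier G. u \<noteq> \<one> \<and> u \<otimes> u = \<one>} \<le> 3"
  shows False
proof -
  have t2: "totient (ord c) > 2" using q by (auto simp: totient_values)
  have "t \<otimes> c = c \<otimes> t"
    by (rule involution_commutes_odd [OF fin c q _ t few]) (use big c t2 in auto)
  note * = odd_cyc_big [OF fin c q t this]
  show False using * big [OF c t2] big [of "t \<otimes> c"] t c by simp
qed

text \<open>Once \<open>cyc c\<close> is the only subgroup of order 5, both involutions centralise
  \<open>c\<close>, and \<open>c\<close>, t c, s c generate three different big subgroups. If there
  were a second subgroup of order 5, generated by d, then d^2 would normalise \<open>cyc c\<close>;
  units modulo 5 have exponent 4, so d^8 centralises \<open>c\<close>, hence so does d, and c d
  generates a third subgroup of order 5.\<close>

lemma no_order_5_two: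
  assumes fin: "finite (carrier G)" and c: "c \<in> carrier G" and q: "ord c = 5"
    and big: "\<And>y. y \<in> carrier G \<Longrightarrow> totient (ord y) > 2 \<Longrightarrow> cyc y = cyc a \<or> cyc y = cyc b"
    and t: "t \<in> carrier G" "t \<otimes> t = \<one>" "t \<noteq> \<one>"
    and s: "s \<in> carrier G" "s \<otimes> s = \<one>" "s \<noteq> \<one>" "s \<noteq> t"
    and few: "card {u \<in> carrier G. u \<noteq> \<one> \<and> u \<otimes> u = \<one>} \<le> 3"
  shows False
proof -
  have big5: "cyc y = cyc a \<or> cyc y = cyc b" if "y \<in> carrier G" "ord y = 5" for y
    using big that by (simp add: totient_values)
  have unique: "cyc d = cyc c" if d: "d \<in> carrier G" "ord d = ord c" for d
  proof (rule ccontr)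
    assume not: "cyc d \<noteq> cyc c"
    then have two: "cyc y = cyc c \<or> cyc y = cyc d" if "y \<in> carrier G" "ord y = ord c" for y
      using big5 [OF c] big5 [of d] big5 [of y] d that q by auto
    obtain k :: int where k: "d \<otimes> d \<otimes> c = c [^] k \<otimes> (d \<otimes> d)" "ord (c [^] k) = ord c"
      using square_normalizes [OF fin c d(1) d(1) two] by blast
    have "\<not> int 5 dvd k" by (rule int_pow_ord_coprime [OF c k(2)]) (use q in auto)
    then have "k mod 5 \<noteq> 0" by (simp add: dvd_eq_mod_eq_0)
    moreover have "0 \<le> k mod 5" "k mod 5 < 5" by simp_all
    ultimately have "k mod 5 \<in> {1, 2, 3, 4}" by force
    then have "(k mod 5) ^ 4 mod 5 = 1" by auto
    then have "k ^ 4 mod 5 = 1 mod 5" by (simp add: power_mod)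
    then have "5 dvd k ^ 4 - 1" by (simp only: mod_eq_dvd_iff)
    then have "c [^] (1::int) = c [^] (k ^ 4)" using c q by (subst int_pow_eq) simp_all
    then have "(d \<otimes> d) [^] (4::nat) \<otimes> c = c \<otimes> (d \<otimes> d) [^] (4::nat)"
      using conj_int_pow_iterate [OF _ c k(1), of 4] d c by simp
    moreover have d5: "d [^] (5::nat) = \<one>" using d q by (simp add: pow_eq_id)
    ultimately have 8: "d [^] (8::nat) \<otimes> c = c \<otimes> d [^] (8::nat)"
      using d by (simp add: eval_nat_numeral m_assoc)
    then have "c \<otimes> d [^] (8::nat) = d [^] (8::nat) \<otimes> c" by simp
    \<comment> \<open>d is recovered from d^8 as d^16, because 16 = 1 modulo 5.\<close>
    then have "c \<otimes> (d [^] (8::nat)) [^] (2::int) = (d [^] (8::nat)) [^] (2::int) \<otimes> c"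
      using conj_int_pow [of c "d [^] (8::nat)" "d [^] (8::nat)" 2] c d by simp
    moreover have "(d [^] (8::nat)) [^] (2::int) = d"
    proof -
      have "(d [^] (8::nat)) [^] (2::int) = d [^] (16::int)"
        using d by (simp add: int_pow_pow flip: int_pow_int)
      also have "\<dots> = d [^] (1::int)" using d q by (subst int_pow_eq) simp_all
      finally show ?thesis using d by simp
    qed
    ultimately have cd: "c \<otimes> d = d \<otimes> c" by simp
    have cd5: "(c \<otimes> d) [^] (5::nat) = \<one>"
      using cd c d q d5 pow_ord_eq_1 [OF c] by (simp add: pow_mult_distrib)
    have "c \<otimes> d \<noteq> \<one>"
    proof
      assume "c \<otimes> d = \<one>"
      then have "d = inv c" using c d cd by (metis inv_equality)
      then have "d \<in> cyc c" using c cyc_self cyc_inv_closed by blast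
      then show False using not cyc_eqI [OF fin c] d by simp
    qed
    moreover have "ord (c \<otimes> d) dvd 5" using cd5 c d by (simp add: pow_eq_id)
    ultimately have "ord (c \<otimes> d) = 5"
      using ord_eq_1 [of "c \<otimes> d"] c d prime_nat_iff [of 5] by auto
    then have "cyc (c \<otimes> d) = cyc c \<or> cyc (c \<otimes> d) = cyc d" using two [of "c \<otimes> d"] c d q by simp
    then show False
    proof
      assume "cyc (c \<otimes> d) = cyc c"
      then have "c \<otimes> d \<in> cyc c" using cyc_self by blast
      then have "inv c \<otimes> (c \<otimes> d) \<in> cyc c"
        using c cyc_self cyc_inv_closed cyc_mult_closed by blast
      then have "d \<in> cyc c" using c d by simp
      then show False using not cyc_eqI [OF fin c] d by simp
    next
      assume "cyc (c \<otimes> d) = cyc d"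
      then have "c \<otimes> d \<in> cyc d" using cyc_self by blast
      then have "c \<otimes> d \<otimes> inv d \<in> cyc d"
        using d cyc_self cyc_inv_closed cyc_mult_closed by blast
      then have "c \<in> cyc d" using c d by (simp add: m_assoc)
      then show False using not cyc_eqI [OF fin d(1)] d by simp
    qed
  qed
  have q': "ord c \<in> {5, 7, 9}" using q by simp
  have odd: "odd (ord c)" using q by simp
  have tc: "t \<otimes> c = c \<otimes> t" by (rule involution_commutes_odd [OF fin c q' unique t few])
  have sc: "s \<otimes> c = c \<otimes> s" by (rule involution_commutes_odd [OF fin c q' unique s(1-3) few])
  note T = odd_cyc_big [OF fin c q' t tc] two_coprime_commuting [OF fin c odd t tc]
  note S = odd_cyc_big [OF fin c q' s(1-3) sc] two_coprime_commuting [OF fin c odd s(1-3) sc]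
  \<comment> \<open>A cyclic group has at most one involution, and these two contain
    \<open>t\<close> and \<open>s\<close> respectively.\<close>
  have "cyc (t \<otimes> c) \<noteq> cyc (s \<otimes> c)"
    using involution_in_cyc_unique [of "t \<otimes> c" t s] t s c T S by auto
  moreover have "cyc (t \<otimes> c) = cyc a \<or> cyc (t \<otimes> c) = cyc b" using big T(1) t c by simp
  moreover have "cyc (s \<otimes> c) = cyc a \<or> cyc (s \<otimes> c) = cyc b" using big S(1) s c by simp
  moreover have "cyc c = cyc a \<or> cyc c = cyc b" using big5 [OF c q] .
  ultimately show False using T(2) S(2) by metis
qed

end

section \<open>The structure of the groups\<close>

text \<open>An odd power of a t equal to one would make the same power of \<open>a\<close> equal to
  \<open>t\<close>, so twice an odd number would be divisible by 4.\<close>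

lemma (in group) ord_mult_involution:
  assumes [simp]: "a \<in> carrier G" "t \<in> carrier G"
    and at: "a \<otimes> t = t \<otimes> a" and tt: "t \<otimes> t = \<one>" and 4: "4 dvd ord a"
  shows "ord (a \<otimes> t) = ord a"
proof -
  have c: "a \<otimes> t \<in> carrier G" by simp
  have t2: "ord t dvd 2" using pow_eq_id [of t 2] tt by (simp add: numeral_2_eq_2)
  have t_even: "t [^] k = \<one>" if "even k" for k :: nat
    using dvd_trans [OF t2 that] by (simp add: pow_eq_id)
  have "(a \<otimes> t) [^] (k::nat) = \<one> \<longleftrightarrow> ord a dvd k" for k
  proof -
    have pw: "(a \<otimes> t) [^] k = a [^] k \<otimes> t [^] k" by (rule pow_mult_distrib [OF at]) simp_all
    show ?thesis
    proof (cases "even k")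
      case True
      then show ?thesis using pw t_even pow_eq_id [of a k] by simp
    next
      case False
      have "\<not> ord a dvd k" using False 4 by (metis dvd_trans even_numeral)
      moreover have "(a \<otimes> t) [^] k \<noteq> \<one>"
      proof
        assume 1: "(a \<otimes> t) [^] k = \<one>"
        obtain l where l: "k = 2 * l + 1" using False by (elim oddE)
        have "t [^] k = t [^] (2 * l) \<otimes> t" by (simp add: l)
        then have "t [^] k = t" using t_even [of "2 * l"] by simp
        then have "a [^] k \<otimes> t = \<one>" using pw 1 by simp
        then have "a [^] k \<otimes> t \<otimes> t = t" by simp
        then have "a [^] k = t" using tt by (simp add: m_assoc)
        then have "a [^] k \<otimes> a [^] k = \<one>" using tt by simp
        then have "a [^] (k + k) = \<one>" by (simp add: nat_pow_mult)
        then have "ord a dvd k + k" by (simp add: pow_eq_id)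
        with 4 have "4 dvd k + k" by (rule dvd_trans)
        then show False using False by presburger
      qed
      ultimately show ?thesis by simp
    qed
  qed
  then show ?thesis using ord_unique [OF c] by blast
qed

text \<open>The case \<open>t = \<one>\<close> covers the groups with one involution, the case \<open>t \<noteq> \<one>\<close> those with three.\<close>

locale few_big = group G for G (structure) +
  fixes a t z and n :: nat
  assumes fin: "finite (carrier G)"
    and closed [simp]: "a \<in> carrier G" "t \<in> carrier G"
    and ord_a: "ord a = n" and n: "n = 8 \<or> n = 12"
    and z_def: "z = a [^] (int n div 2)"
    and tt: "t \<otimes> t = \<one>" and at: "a \<otimes> t = t \<otimes> a" and t_not: "t = \<one> \<or> t \<notin> cyc a"
    and inv_cases: "\<And>u. u \<in> carrier G \<Longrightarrow> u \<otimes> u = \<one> \<Longrightarrow> u \<in> {\<one>, z, t, z \<otimes> t}"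
    and big: "\<And>y. y \<in> carrier G \<Longrightarrow> totient (ord y) > 2 \<Longrightarrow> cyc y = cyc a \<or> cyc y = cyc (a \<otimes> t)"
begin

definition A :: "'a set" where "A = {a [^] (i::int) \<otimes> t [^] (j::int) | i j. True}"

definition E :: "'a set" where "E = {u \<in> carrier G. u \<otimes> u = \<one>}"

lemma z_closed [simp]: "z \<in> carrier G"
  by (simp add: z_def)

lemma A_I: "a [^] (i::int) \<otimes> t [^] (j::int) \<in> A"
  by (auto simp: A_def)

lemma A_closed: "u \<in> A \<Longrightarrow> u \<in> carrier G"
  by (auto simp: A_def)

lemma a_A: "a \<in> A" and t_A: "t \<in> A" and one_A: "\<one> \<in> A" and z_A: "z \<in> A"
  using A_I [of 1 0] A_I [of 0 1] A_I [of 0 0] A_I [of "int n div 2" 0] by (simp_all add: z_def)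

lemma A_mult_eq:
  "a [^] (i::int) \<otimes> t [^] (j::int) \<otimes> (a [^] (i'::int) \<otimes> t [^] (j'::int)) = a [^] (i + i') \<otimes> t [^] (j + j')"
proof -
  have "t [^] j \<otimes> (a [^] i' \<otimes> t [^] j') = a [^] i' \<otimes> (t [^] j \<otimes> t [^] j')"
    using int_pow_commute2 [of a t i' j] at by (simp flip: m_assoc)
  then show ?thesis by (simp add: m_assoc int_pow_mult)
qed

lemma A_mult: "u \<in> A \<Longrightarrow> v \<in> A \<Longrightarrow> u \<otimes> v \<in> A"
  unfolding A_def using A_mult_eq by blast

lemma A_comm: "u \<in> A \<Longrightarrow> v \<in> A \<Longrightarrow> u \<otimes> v = v \<otimes> u"
  by (auto simp: A_def A_mult_eq add.commute)

lemma A_inv: "u \<in> A \<Longrightarrow> inv u \<in> A"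
proof -
  assume "u \<in> A"
  then obtain i j :: int where u: "u = a [^] i \<otimes> t [^] j" by (auto simp: A_def)
  have "inv u = a [^] (- i) \<otimes> t [^] (- j)"
    by (rule inv_equality) (simp_all add: u A_mult_eq)
  then show ?thesis using A_I by simp
qed

lemma A_subgroup: "subgroup A G"
  by (rule subgroupI) (use A_closed one_A A_inv A_mult in auto)

lemma A_mult_iff: "u \<in> A \<Longrightarrow> y \<in> carrier G \<Longrightarrow> u \<otimes> y \<in> A \<longleftrightarrow> y \<in> A"
proof
  assume u: "u \<in> A" and y: "y \<in> carrier G" and "u \<otimes> y \<in> A"
  then have "inv u \<otimes> (u \<otimes> y) \<in> A" using A_inv A_mult by blast
  then show "y \<in> A" using u y A_closed by simp
qed (rule A_mult)

lemma cyc_A: "u \<in> A \<Longrightarrow> cyc u \<subseteq> A"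
  by (rule generate_subgroup_incl [OF _ A_subgroup]) simp

lemma E_A: "E \<subseteq> A"
  using inv_cases one_A z_A t_A A_mult by (auto simp: E_def)

lemma E_closed: "u \<in> E \<Longrightarrow> u \<in> carrier G" and E_square: "u \<in> E \<Longrightarrow> u \<otimes> u = \<one>"
  by (simp_all add: E_def)

lemma E_mult: "u \<in> E \<Longrightarrow> v \<in> E \<Longrightarrow> u \<otimes> v \<in> E"
proof -
  assume u: "u \<in> E" and v: "v \<in> E"
  then have "v \<otimes> u = u \<otimes> v" using A_comm E_A by blast
  then have "u \<otimes> v \<otimes> (u \<otimes> v) = u \<otimes> u \<otimes> (v \<otimes> v)"
    using u v E_closed by (metis m_assoc m_closed)
  then show ?thesis using u v by (simp add: E_def)
qed

lemma E_inv: "u \<in> E \<Longrightarrow> inv u = u"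
  by (rule inv_equality) (simp_all add: E_def)

lemma E_conj: "u \<in> E \<Longrightarrow> y \<in> carrier G \<Longrightarrow> y \<otimes> u \<otimes> inv y \<in> E"
  using mult_tail [of u u \<one> "inv y"] by (simp add: E_def m_assoc)

lemma zz: "z \<otimes> z = \<one>"
proof -
  have "z \<otimes> z = a [^] int n"
    using n by (auto simp: z_def simp flip: int_pow_mult)
  then show ?thesis using int_pow_eq_id [of a "int n"] ord_a by simp
qed

lemma z_E: "z \<in> E" and t_E: "t \<in> E" and one_E: "\<one> \<in> E"
  using zz tt by (simp_all add: E_def)

lemma z_not_one: "z \<noteq> \<one>"
proof -
  have "\<not> int (ord a) dvd int n div 2" using n ord_a by auto
  then show ?thesis by (simp add: z_def int_pow_eq_id)
qed

lemma E_eq: "E = {\<one>, z, t, z \<otimes> t}"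
  using inv_cases z_E t_E one_E E_mult by (auto simp: E_def)

lemma a4: "a [^] (4::int) \<noteq> \<one>"
  using n ord_a by (auto simp: int_pow_eq_id)

lemma totient_ord_a: "totient (ord a) = 4"
  using n ord_a by (auto simp: totient_values)

lemma ord_at: "ord (a \<otimes> t) = n"
proof -
  have "4 dvd ord a" using n ord_a by auto
  then show ?thesis using ord_mult_involution [OF closed at tt] ord_a by simp
qed

lemma totient_ord_at: "a \<otimes> t \<in> carrier G" "totient (ord (a \<otimes> t)) = 4"
  using totient_ord_a ord_a ord_at by simp_all

lemma big_A: "y \<in> carrier G \<Longrightarrow> totient (ord y) > 2 \<Longrightarrow> y \<in> A"
  using big [of y] cyc_self [of y] cyc_A a_A t_A A_mult by blast

lemma order_3_A:
  assumes w: "w \<in> carrier G" "ord w = 3"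
  shows "w \<in> A"
  using n
proof
  assume "n = 8"
  then have False
    using no_order_3_if_8 [OF fin closed(1) totient_ord_at(1) w(1) _ totient_ord_at(2) w(2) big] ord_a by simp
  then show ?thesis ..
next
  assume "n = 12"
  then have "w \<in> cyc a"
    using order_3_mem_cyc_if_12 [OF fin closed(1) totient_ord_at(1) w(1) _ totient_ord_at(2) w(2) big] ord_a by simp
  then show ?thesis using cyc_A a_A by blast
qed

text \<open>The big cyclic subgroups lie in \<open>A\<close>, so \<open>y\<close> has order 1, 2, 3,
  4 or 6. All these except 4 would put \<open>y\<close> into \<open>A\<close>, because
  \<open>A\<close> contains every involution and every element of order 3.\<close>

lemma square_outside:
  assumes y: "y \<in> carrier G" "y \<notin> A"
  shows "y \<otimes> y \<in> E" "y \<otimes> y \<noteq> \<one>"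
proof -
  show 1: "y \<otimes> y \<noteq> \<one>" using y E_A by (auto simp: E_def)
  have "totient (ord y) \<le> 2" using big_A y by (meson not_le)
  moreover have "ord y > 0" using ord_ge_1 [OF fin y(1)] by simp
  ultimately have "ord y \<in> {1, 2, 3, 4, 6}" by (rule totient_le_2)
  moreover have "ord y \<noteq> 1" using ord_eq_1 [OF y(1)] y one_A by auto
  moreover have "ord y \<noteq> 2" using ord_eq_2_iff [OF y(1)] 1 by blast
  moreover have "ord y \<noteq> 3" using order_3_A y by blast
  moreover have "ord y \<noteq> 6"
  proof
    \<comment> \<open>y is the inverse of y^2 times y^3, a product of an element of order 3 and an
      involution.\<close>
    assume 6: "ord y = 6"
    then have o: "ord (y [^] (2::nat)) = 3" "ord (y [^] (3::nat)) = 2"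
      using y by (simp_all add: ord_pow)
    have "y [^] (2::nat) \<in> A" using order_3_A [OF _ o(1)] y by simp
    moreover have "y [^] (3::nat) \<in> A"
      using ord_eq_2_iff [of "y [^] (3::nat)"] o(2) y E_A by (auto simp: E_def)
    ultimately have "inv (y [^] (2::nat)) \<otimes> y [^] (3::nat) \<in> A" using A_inv A_mult by blast
    then show False using y by (simp add: eval_nat_numeral m_assoc inv_mult_group)
  qed
  ultimately have "ord y = 4" by blast
  then have "y [^] (4::nat) = \<one>" using y(1) by (simp add: pow_eq_id)
  then show "y \<otimes> y \<in> E" using y(1) by (simp add: E_def eval_nat_numeral m_assoc)
qed

text \<open>With b the conjugate of \<open>a\<close> by \<open>y\<close>, the square of a y is (a b)
  y^2. Both \<open>y\<close> and a y lie outside \<open>A\<close>, so both squares are in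
  \<open>E\<close>; hence e = a b is in \<open>E\<close>, and it differs from y^2 because (a y)^2 is
  not one.\<close>

lemma conj_outside:
  assumes y: "y \<in> carrier G" "y \<notin> A"
  obtains e where "e \<in> E" "y \<otimes> a = inv a \<otimes> e \<otimes> y" "e \<noteq> y \<otimes> y"
proof -
  define b where "b = y \<otimes> a \<otimes> inv y"
  have b: "b \<in> carrier G" "y \<otimes> a = b \<otimes> y" using y by (simp_all add: b_def m_assoc)
  define e where "e = a \<otimes> b"
  have ay: "a \<otimes> y \<in> carrier G" "a \<otimes> y \<notin> A" using y a_A A_mult_iff by simp_all
  note E1 = square_outside [OF ay] and E2 = square_outside [OF y]
  have sq: "a \<otimes> y \<otimes> (a \<otimes> y) = e \<otimes> (y \<otimes> y)"
  proof -
    have "a \<otimes> y \<otimes> (a \<otimes> y) = a \<otimes> (y \<otimes> a) \<otimes> y" using y by (simp add: m_assoc)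
    also have "\<dots> = e \<otimes> (y \<otimes> y)" unfolding b(2) e_def using y b(1) by (simp add: m_assoc)
    finally show ?thesis .
  qed
  have c: "e \<in> carrier G" using b by (simp add: e_def)
  have "e = (a \<otimes> y \<otimes> (a \<otimes> y)) \<otimes> (y \<otimes> y)"
    unfolding sq using c y E_square [OF E2(1)] by (simp add: m_assoc)
  then have "e \<in> E" using E_mult [OF E1(1) E2(1)] by simp
  moreover have "y \<otimes> a = inv a \<otimes> e \<otimes> y" using b y by (simp add: e_def)
  moreover have "e \<noteq> y \<otimes> y" using sq E1(2) E_square [OF E2(1)] by auto
  ultimately show thesis by (rule that)
qed

text \<open>If y, x and y x were all outside \<open>A\<close>, each would invert \<open>a\<close>
  modulo \<open>E\<close>. But two inversions cancel, so a^2 would lie in \<open>E\<close> and a^4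
  would be one. It follows that \<open>A\<close> has index at most 2.\<close>

lemma mult_outside:
  assumes y: "y \<in> carrier G" "y \<notin> A" and x: "x \<in> carrier G" "x \<notin> A"
  shows "y \<otimes> x \<in> A"
proof (rule ccontr)
  assume yx: "y \<otimes> x \<notin> A"
  obtain e where e: "e \<in> E" "y \<otimes> a = inv a \<otimes> e \<otimes> y" using conj_outside [OF y] by blast
  obtain f where f: "f \<in> E" "x \<otimes> a = inv a \<otimes> f \<otimes> x" using conj_outside [OF x] by blast
  obtain g where g: "g \<in> E" "y \<otimes> x \<otimes> a = inv a \<otimes> g \<otimes> (y \<otimes> x)"
    using conj_outside [OF _ yx] y x by blast
  have c: "e \<in> carrier G" "f \<in> carrier G" "g \<in> carrier G" using e f g E_closed by auto
  define f' where "f' = y \<otimes> f \<otimes> inv y"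
  have f': "f' \<in> E" "y \<otimes> f = f' \<otimes> y"
    using E_conj [OF f(1) y(1)] y c by (simp_all add: f'_def m_assoc)
  have f'c: "f' \<in> carrier G" using f'(1) E_closed by simp
  have yia: "y \<otimes> inv a = inv (inv a \<otimes> e) \<otimes> y"
    using conj_int_pow [OF y(1) closed(1) _ e(2), of "-1"] c by (simp add: int_pow_neg)
  have "y \<otimes> x \<otimes> a = y \<otimes> (inv a \<otimes> f \<otimes> x)" using x y f(2) by (simp add: m_assoc)
  also have "\<dots> = (y \<otimes> inv a) \<otimes> f \<otimes> x" using x y c by (simp add: m_assoc)
  also have "\<dots> = inv (inv a \<otimes> e) \<otimes> (y \<otimes> f) \<otimes> x" unfolding yia using x y c by (simp add: m_assoc)
  also have "\<dots> = inv (inv a \<otimes> e) \<otimes> f' \<otimes> (y \<otimes> x)" unfolding f'(2) using x y c f'c by (simp add: m_assoc)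
  finally have "inv a \<otimes> g \<otimes> (y \<otimes> x) = inv (inv a \<otimes> e) \<otimes> f' \<otimes> (y \<otimes> x)" using g(2) by simp
  then have "inv a \<otimes> g = inv (inv a \<otimes> e) \<otimes> f'" using x y c f'c by simp
  also have "\<dots> = e \<otimes> a \<otimes> f'" using c E_inv [OF e(1)] by (simp add: inv_mult_group)
  finally have "a \<otimes> (inv a \<otimes> g) = a \<otimes> (e \<otimes> a \<otimes> f')" by simp
  then have "g = a \<otimes> (e \<otimes> a) \<otimes> f'" using c f'c by (simp add: m_assoc)
  also have "e \<otimes> a = a \<otimes> e" using A_comm e(1) E_A a_A by blast
  finally have g2: "g = a \<otimes> a \<otimes> (e \<otimes> f')" using c f'c by (simp add: m_assoc)
  have ef: "e \<otimes> f' \<in> E" by (rule E_mult [OF e(1) f'(1)])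
  have "a \<otimes> a = g \<otimes> (e \<otimes> f')"
    unfolding g2 using E_square [OF ef] E_closed [OF ef] by (simp add: m_assoc)
  then have "a \<otimes> a \<in> E" using E_mult [OF g(1) ef] by simp
  then have "a [^] (4::int) = \<one>" by (simp add: E_def int_pow_numeral eval_nat_numeral m_assoc)
  then show False using a4 by simp
qed

lemma carrier_eq:
  assumes x: "x \<in> carrier G" "x \<notin> A"
  shows "carrier G = A \<union> (\<lambda>u. u \<otimes> x) ` A"
proof
  show "A \<union> (\<lambda>u. u \<otimes> x) ` A \<subseteq> carrier G" using x A_closed by auto
  show "carrier G \<subseteq> A \<union> (\<lambda>u. u \<otimes> x) ` A"
  proof
    fix g assume g: "g \<in> carrier G"
    show "g \<in> A \<union> (\<lambda>u. u \<otimes> x) ` A"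
    proof (cases "g \<in> A")
      case False
      have "inv x \<notin> A" using x A_inv [of "inv x"] by auto
      then have "g \<otimes> inv x \<in> A" using mult_outside g x False by simp
      moreover have "g = g \<otimes> inv x \<otimes> x" using g x by (simp add: m_assoc)
      ultimately show ?thesis by blast
    qed simp
  qed
qed

text \<open>\<open>x\<close> fixes \<open>z\<close>, so it sends \<open>t\<close> to
  \<open>t\<close> or to z t. In the second case look at x^2: if it is \<open>z\<close>, then t x is
  an involution outside \<open>A\<close>; if it is \<open>t\<close> or z t, then \<open>x\<close>
  would not commute with its own square.\<close>

lemma t_commutes:
  assumes x: "x \<in> carrier G" "x \<notin> A"
  shows "x \<otimes> t = t \<otimes> x"
proof (cases "t = \<one>")
  case False
  then have t_not': "t \<notin> cyc a" using t_not by simp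
  have z_cyc: "z \<in> cyc a" by (auto simp: z_def cyc_mem_iff)
  obtain e where e: "e \<in> E" "x \<otimes> a = inv a \<otimes> e \<otimes> x" using conj_outside [OF x] by blast
  have ec: "e \<in> carrier G" using e(1) E_closed by simp
  have xz: "x \<otimes> z = z \<otimes> x"
  proof -
    have "x \<otimes> z = (inv a \<otimes> e) [^] (int n div 2) \<otimes> x"
      unfolding z_def by (rule conj_int_pow) (use x ec e(2) in simp_all)
    also have "(inv a \<otimes> e) [^] (int n div 2) = inv a [^] (int n div 2) \<otimes> e [^] (int n div 2)"
    proof (rule int_pow_mult_distrib)
      show "inv a \<otimes> e = e \<otimes> inv a" using A_comm A_inv a_A e(1) E_A by blast
    qed (simp_all add: ec)
    \<comment> \<open>Half of 8 or 12 is even, so the factor \<open>e\<close> of square one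
      disappears.\<close>
    also have "e [^] (int n div 2) = \<one>"
    proof -
      have "ord e dvd 2"
        using pow_eq_id [OF ec, of 2] E_square [OF e(1)] ec by (simp add: eval_nat_numeral)
      then have "int (ord e) dvd int 2" by (simp only: of_nat_dvd_iff)
      then have "int (ord e) dvd 2" by simp
      moreover have "2 dvd int n div 2" using n by auto
      ultimately show ?thesis using ec by (simp only: int_pow_eq_id) (rule dvd_trans)
    qed
    also have "inv a [^] (int n div 2) = inv z" by (simp add: z_def int_pow_inv)
    also have "inv z = z" by (rule E_inv [OF z_E])
    finally show ?thesis by simp
  qed
  define u where "u = x \<otimes> t \<otimes> inv x"
  have u: "u \<in> E" using E_conj [OF t_E x(1)] by (simp add: u_def)
  have uc: "u \<in> carrier G" "x \<otimes> t = u \<otimes> x" using x by (simp_all add: u_def m_assoc)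
  have "u \<noteq> \<one>"
  proof
    assume "u = \<one>"
    then have "x \<otimes> t = x" using uc(2) x by simp
    then show False using x False by simp
  qed
  moreover have "u \<noteq> z"
  proof
    assume "u = z"
    then have "x \<otimes> t = x \<otimes> z" using uc(2) xz by simp
    then show False using x t_not' z_cyc by simp
  qed
  moreover have "u \<noteq> z \<otimes> t"
  proof
    assume "u = z \<otimes> t"
    then have xt: "x \<otimes> t = z \<otimes> t \<otimes> x" using uc(2) by simp
    define w where "w = x \<otimes> x"
    have w: "w \<in> E" "w \<noteq> \<one>" using square_outside [OF x] by (simp_all add: w_def)
    have xw: "x \<otimes> w = w \<otimes> x" using x by (simp add: w_def m_assoc)
    have zt: "z \<otimes> t = t \<otimes> z" by (rule A_comm [OF z_A t_A])
    have ne: "t \<noteq> z \<otimes> t" using z_not_one by simp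
    consider "w = z" | "w = t" | "w = z \<otimes> t" using w E_eq by auto
    then show False
    proof cases
      case 1
      have "t \<otimes> x \<otimes> (t \<otimes> x) = t \<otimes> (x \<otimes> t) \<otimes> x" using x by (simp add: m_assoc)
      also have "\<dots> = t \<otimes> (t \<otimes> z) \<otimes> (x \<otimes> x)" unfolding xt zt using x by (simp add: m_assoc)
      also have "x \<otimes> x = z" using 1 by (simp add: w_def)
      also have "t \<otimes> (t \<otimes> z) \<otimes> z = \<one>" using tt zz by (simp flip: m_assoc) 
      finally have "t \<otimes> x \<in> E" using x by (simp add: E_def)
      then have "t \<otimes> x \<in> A" using E_A by blast
      then show False using A_mult_iff [OF t_A x(1)] x by simp
    next
      case 2
      then have "t \<otimes> x = z \<otimes> t \<otimes> x" using xw xt by simp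
      then show False using x ne by simp
    next
      case 3
      have "z \<otimes> t \<otimes> x = x \<otimes> (z \<otimes> t)" using xw 3 by simp
      also have "\<dots> = z \<otimes> (x \<otimes> t)" using x xz by (simp flip: m_assoc)
      also have "\<dots> = z \<otimes> z \<otimes> t \<otimes> x" unfolding xt using x by (simp add: m_assoc)
      also have "\<dots> = t \<otimes> x" using zz by simp
      finally show False using x ne by simp
    qed
  qed
  ultimately have "u = t" using u E_eq by blast
  then show ?thesis using uc by simp
qed (use x in simp)

end

lemma (in group) iso_integer_mod_group:
  assumes a: "a \<in> carrier G" and n: "ord a = n" "n > 0" and surj: "carrier G \<subseteq> cyc a"
  shows "G \<cong> integer_mod_group n"
proof -
  have a_n: "a [^] n = \<one>" using a n pow_ord_eq_1 [OF a] by simp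
  have hom: "(\<lambda>i. a [^] i) \<in> hom (integer_mod_group n) G"
    by (intro homI) (use a in \<open>simp_all add: int_pow_mod [OF a a_n] int_pow_mult\<close>)
  have "bij_betw (\<lambda>i. a [^] i) (carrier (integer_mod_group n)) (carrier G)"
    unfolding bij_betw_def
  proof
    show "inj_on (\<lambda>i. a [^] i) (carrier (integer_mod_group n))"
    proof (rule inj_onI)
      fix i j assume ij: "i \<in> carrier (integer_mod_group n)" "j \<in> carrier (integer_mod_group n)"
        "a [^] i = a [^] j"
      then have "int n dvd j - i" using a n by (simp add: int_pow_eq)
      then have "j mod int n = i mod int n" by (simp add: mod_eq_dvd_iff)
      then show "i = j" using ij n by (simp add: carrier_integer_mod_group)
    qed
    show "(\<lambda>i. a [^] i) ` carrier (integer_mod_group n) = carrier G"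
    proof
      show "(\<lambda>i. a [^] i) ` carrier (integer_mod_group n) \<subseteq> carrier G" using a by auto
      show "carrier G \<subseteq> (\<lambda>i. a [^] i) ` carrier (integer_mod_group n)"
      proof
        fix g assume "g \<in> carrier G"
        then obtain k :: int where "g = a [^] k" using surj cyc_mem_iff [OF a] by blast
        then have "g = a [^] (k mod int n)" by (simp add: int_pow_mod [OF a a_n])
        moreover have "k mod int n \<in> carrier (integer_mod_group n)"
          using n by (simp add: carrier_integer_mod_group)
        ultimately show "g \<in> (\<lambda>i. a [^] i) ` carrier (integer_mod_group n)" by blast
      qed
    qed
  qed
  then have "(\<lambda>i. a [^] i) \<in> iso (integer_mod_group n) G" by (intro isoI hom)
  then have "integer_mod_group n \<cong> G" by (rule is_isoI)
  then show ?thesis by (rule group.iso_sym [OF group_integer_mod_group])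
qed

section \<open>Identifying the group with a model\<close>

context few_big
begin

lemma n_pos: "n > 0"
  using n by auto

lemma a_n: "a [^] n = \<one>"
  using pow_ord_eq_1 [OF closed(1)] ord_a by simp

lemma t_int_pow: "t [^] (j::int) = (if even j then \<one> else t)"
proof -
  have "ord t dvd 2" using pow_eq_id [of t 2] tt by (simp add: numeral_2_eq_2)
  then have "int (ord t) dvd int 2" by (simp only: of_nat_dvd_iff)
  then have 2: "t [^] j = \<one>" if "even j" for j :: int
    using that by (simp add: int_pow_eq_id) (rule dvd_trans)
  show ?thesis
  proof (cases "even j")
    case False
    have "t [^] j = t [^] (j - 1) \<otimes> t [^] (1::int)"
      using int_pow_mult [OF closed(2), of "j - 1" 1] by simp
    also have "t [^] (j - 1) = \<one>" using False by (intro 2) simp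
    finally show ?thesis using False by simp
  qed (simp add: 2)
qed

lemma A_independent:
  assumes "a [^] (i::int) \<otimes> t [^] (j::int) = \<one>"
  shows "int n dvd i \<and> (t = \<one> \<or> even j)"
proof (cases "t = \<one> \<or> even j")
  case True
  then have "t [^] j = \<one>" by (auto simp: t_int_pow)
  then have "a [^] i = \<one>" using assms by simp
  then show ?thesis using True by (simp add: int_pow_eq_id ord_a)
next
  case False
  then have "a [^] i \<otimes> t = \<one>" using assms by (simp add: t_int_pow)
  then have "t = inv (a [^] i)" by (metis closed inv_comm inv_equality int_pow_closed)
  then have "t = a [^] (- i)" by (simp add: int_pow_neg)
  then have "t \<in> cyc a" by (auto simp: cyc_mem_iff)
  then show ?thesis using t_not False by simp
qed

lemma iso_abelian:
  assumes A: "carrier G = A"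
  shows "t = \<one> \<Longrightarrow> G \<cong> integer_mod_group n"
    and "t \<noteq> \<one> \<Longrightarrow> G \<cong> integer_mod_group n \<times>\<times> integer_mod_group 2"
proof -
  assume t: "t = \<one>"
  have "u \<in> cyc a" if "u \<in> A" for u
  proof -
    from that obtain i j :: int where "u = a [^] i \<otimes> t [^] j" by (auto simp: A_def)
    then have "u = a [^] i" by (simp add: t_int_pow t)
    then show ?thesis using cyc_mem_iff [OF closed(1)] by blast
  qed
  then have "carrier G \<subseteq> cyc a" unfolding A by blast
  then show "G \<cong> integer_mod_group n" by (rule iso_integer_mod_group [OF closed(1) ord_a n_pos])
next
  assume t: "t \<noteq> \<one>"
  have t2: "t [^] (2::nat) = \<one>" using tt by (simp add: numeral_2_eq_2)
  let ?Z = "integer_mod_group n \<times>\<times> integer_mod_group 2"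
  let ?f = "\<lambda>(i, j). a [^] (i::int) \<otimes> t [^] (j::int)"
  have Z: "group ?Z" by (intro DirProd_group group_integer_mod_group)
  have f_mod: "?f (i mod int n, j mod int 2) = ?f (i, j)" for i j
    by (simp only: prod.case int_pow_mod [OF closed(1) a_n] int_pow_mod [OF closed(2) t2])
  have hom: "?f \<in> hom ?Z G"
  proof (rule homI)
    fix x y assume "x \<in> carrier ?Z" "y \<in> carrier ?Z"
    obtain i j i' j' where xy: "x = (i, j)" "y = (i', j')" by (metis surj_pair)
    have "?f (x \<otimes>\<^bsub>?Z\<^esub> y) = ?f ((i + i') mod int n, (j + j') mod int 2)" by (simp add: xy)
    also have "\<dots> = ?f (i + i', j + j')" by (rule f_mod)
    also have "\<dots> = ?f x \<otimes> ?f y" by (simp add: xy A_mult_eq)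
    finally show "?f (x \<otimes>\<^bsub>?Z\<^esub> y) = ?f x \<otimes> ?f y" .
  qed auto
  interpret F: group_hom ?Z G ?f
    by (rule group_hom.intro [OF Z is_group group_hom_axioms.intro [OF hom]])
  have "inj_on ?f (carrier ?Z)"
    unfolding F.inj_on_one_iff
  proof (intro allI impI)
    fix x assume x: "x \<in> carrier ?Z" "?f x = \<one>"
    obtain i j where ij: "x = (i, j)" by (metis surj_pair)
    have "int n dvd i" "even j" using A_independent [of i j] x(2) t by (auto simp: ij)
    moreover have "0 \<le> i" "i < int n" "0 \<le> j" "j < 2"
      using x(1) n_pos by (auto simp: ij carrier_integer_mod_group)
    ultimately have "i = 0" "j = 0" by (auto dest: zdvd_imp_le)
    then show "x = \<one>\<^bsub>?Z\<^esub>" by (simp add: ij)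
  qed
  moreover have "?f ` carrier ?Z = carrier G"
  proof
    show "?f ` carrier ?Z \<subseteq> carrier G" by auto
    show "carrier G \<subseteq> ?f ` carrier ?Z"
    proof
      fix g assume "g \<in> carrier G"
      then obtain i j where "g = ?f (i, j)" unfolding A by (auto simp: A_def)
      then have "g = ?f (i mod int n, j mod int 2)" using f_mod by simp
      moreover have "(i mod int n, j mod int 2) \<in> carrier ?Z"
        using n_pos by (auto simp: carrier_integer_mod_group)
      ultimately show "g \<in> ?f ` carrier ?Z" by blast
    qed
  qed
  ultimately have "?f \<in> iso ?Z G" by (intro isoI hom) (simp add: bij_betw_def)
  then have "?Z \<cong> G" by (rule is_isoI)
  then show "G \<cong> ?Z" by (rule group.iso_sym [OF Z])
qed

text \<open>The parameter q is 0 because of \<open>t_commutes\<close>; \<open>s\<close> records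
  whether \<open>t\<close> is trivial.\<close>

lemma iso_outside:
  assumes x: "x \<in> carrier G" "x \<notin> A" and s: "s = 1 \<and> t = \<one> \<or> s = 2 \<and> t \<noteq> \<one>"
    and xa: "x \<otimes> a = a [^] p \<otimes> t [^] r \<otimes> x" and xx: "x \<otimes> x = a [^] c \<otimes> t [^] d"
    and D: "group (dbl n s p 0 r c d)"
  shows "G \<cong> dbl n s p 0 r c d"
proof -
  have "t [^] s = \<one>" using s tt by (auto simp: numeral_2_eq_2)
  interpret D: dbl_gens G a t x n s p 0 r c d
    by (intro dbl_gens.intro dbl_gens_axioms.intro is_group)
      (use x n_pos s a_n at t_commutes [OF x] xa xx \<open>t [^] s = \<one>\<close> in auto)
  show ?thesis
  proof (rule D.iso_dbl [OF _ _ D])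
    show "int n dvd i \<and> int s dvd j" if "D.E i j = \<one>" for i j
      using A_independent [of i j] that s by (auto simp: D.E_def)
    show "x \<noteq> D.E i j" for i j using x(2) A_I by (auto simp: D.E_def)
    show "carrier G \<subseteq> range (\<lambda>(i, j). D.E i j) \<union> range (\<lambda>(i, j). D.E i j \<otimes> x)"
      unfolding carrier_eq [OF x] D.E_def A_def by auto
  qed
qed

lemma inv_a: "inv a = a [^] (int n - 1)"
proof -
  have "a [^] (int n - 1) = a [^] int n \<otimes> inv (a [^] (1::int))"
    using int_pow_diff [OF closed(1), of "int n" 1] by simp
  also have "a [^] int n = \<one>" using a_n int_pow_int [of G a n] by simp
  finally show ?thesis by simp
qed

lemma one_involution_iso:
  assumes t: "t = \<one>"
  shows "G \<cong> integer_mod_group n \<or> G \<cong> dbl n 1 (int n - 1) 0 0 (int n div 2) 0"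
proof (cases "carrier G \<subseteq> A")
  case True
  then show ?thesis using iso_abelian(1) A_closed t by blast
next
  case False
  then obtain x where x: "x \<in> carrier G" "x \<notin> A" by blast
  obtain e where e: "e \<in> E" "x \<otimes> a = inv a \<otimes> e \<otimes> x" "e \<noteq> x \<otimes> x" using conj_outside [OF x] by blast
  have w: "x \<otimes> x = z" using square_outside [OF x] E_eq t by auto
  \<comment> \<open>Here \<open>E\<close> is {1, z}, x^2 is \<open>z\<close>, and \<open>e\<close>
    differs from x^2.\<close>
  have "e = \<one>" using e(1,3) w E_eq t by auto
  have "G \<cong> dbl n 1 (int n - 1) 0 0 (int n div 2) 0"
  proof (rule iso_outside [OF x])
    show "x \<otimes> a = a [^] (int n - 1) \<otimes> t [^] (0::int) \<otimes> x"
      using e(2) \<open>e = \<one>\<close> by (simp add: inv_a)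
    show "x \<otimes> x = a [^] (int n div 2) \<otimes> t [^] (0::int)" using w z_def by simp
    show "group (dbl n 1 (int n - 1) 0 0 (int n div 2) 0)"
      using n group_models by auto
  qed (use t in simp)
  then show ?thesis ..
qed

text \<open>For n = 8 these are Q_16 x Z_2, [32,14], [32,13], [32,10]; for n = 12 they are Z_2 x
  (Z_3 by Q_8), [48,13], Z_4 x (Z_3 by Z_4), [48,12]. The last exponent depends on \<open>n\<close>
  only to agree with the generators chosen in the presentations.\<close>

definition three_models :: bool where
  "three_models \<longleftrightarrow> G \<cong> dbl n 2 (int n - 1) 0 0 (int n div 2) 0 \<or> G \<cong> dbl n 2 (int n - 1) 0 0 0 1 \<or>
    G \<cong> dbl n 2 (int n div 2 - 1) 0 0 0 1 \<or>
    G \<cong> dbl n 2 (int n - 1) 0 1 (int n div 2) (if n = 8 then 0 else 1)"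

lemma three_models_if:
  assumes t: "t \<noteq> \<one>" and x: "x \<in> carrier G" "x \<notin> A" and e: "x \<otimes> a = inv a \<otimes> e \<otimes> x"
    and ew: "(e, x \<otimes> x) \<in> {(\<one>, z), (\<one>, t), (z, t), (t, z), (t, z \<otimes> t)}"
  shows three_models
proof -
  have ia: "inv a \<otimes> \<one> = a [^] (int n - 1) \<otimes> t [^] (0::int)"
    "inv a \<otimes> z = a [^] (int n div 2 - 1) \<otimes> t [^] (0::int)"
    "inv a \<otimes> t = a [^] (int n - 1) \<otimes> t [^] (1::int)"
  proof -
    have "inv a \<otimes> z = a [^] (-1::int) \<otimes> a [^] (int n div 2)" by (simp add: z_def int_pow_neg)
    also have "\<dots> = a [^] (int n div 2 - 1)" by (simp flip: int_pow_mult)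
    finally show "inv a \<otimes> z = a [^] (int n div 2 - 1) \<otimes> t [^] (0::int)" by simp
  qed (simp_all add: inv_a)
  have w: "\<one> \<otimes> z = a [^] (int n div 2) \<otimes> t [^] (0::int)" "\<one> \<otimes> t = a [^] (0::int) \<otimes> t [^] (1::int)"
    "z \<otimes> t = a [^] (int n div 2) \<otimes> t [^] (1::int)"
    by (simp_all add: z_def)
  have s: "(2::nat) = 1 \<and> t = \<one> \<or> (2::nat) = 2 \<and> t \<noteq> \<one>" using t by simp
  consider "e = \<one>" "x \<otimes> x = z" | "e = \<one>" "x \<otimes> x = t" | "e = z" "x \<otimes> x = t"
    | "e = t" "x \<otimes> x = z \<or> x \<otimes> x = z \<otimes> t" using ew by auto
  then show ?thesis
  proof cases
    case 1
    have "G \<cong> dbl n 2 (int n - 1) 0 0 (int n div 2) 0"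
      by (rule iso_outside [OF x s]) (use e 1 ia w n group_models in auto)
    then show ?thesis by (simp add: three_models_def)
  next
    case 2
    have "G \<cong> dbl n 2 (int n - 1) 0 0 0 1"
      by (rule iso_outside [OF x s]) (use e 2 ia w n group_models in auto)
    then show ?thesis by (simp add: three_models_def)
  next
    case 3
    have "G \<cong> dbl n 2 (int n div 2 - 1) 0 0 0 1"
      by (rule iso_outside [OF x s]) (use e 3 ia w n group_models in auto)
    then show ?thesis by (simp add: three_models_def)
  next
    case 4
    \<comment> \<open>When e = t, the values z and z t of x^2 give the same group: a x acts on
      \<open>a\<close> as \<open>x\<close> does, and its square is t x^2. So the square can be
      normalised to the one in the model.\<close>
    define v where "v = (if n = 8 then z else z \<otimes> t)"
    have fin: "G \<cong> dbl n 2 (int n - 1) 0 1 (int n div 2) (if n = 8 then 0 else 1)"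
      if y: "y \<in> carrier G" "y \<notin> A" "y \<otimes> a = inv a \<otimes> t \<otimes> y" "y \<otimes> y = v" for y
    proof (rule iso_outside [OF y(1,2) s])
      show "y \<otimes> a = a [^] (int n - 1) \<otimes> t [^] (1::int) \<otimes> y" using y(3) ia by simp
      show "y \<otimes> y = a [^] (int n div 2) \<otimes> t [^] (if n = 8 then 0 else 1 :: int)"
        using y(4) w by (simp add: v_def z_def)
      show "group (dbl n 2 (int n - 1) 0 1 (int n div 2) (if n = 8 then 0 else 1))"
        using n group_models by auto
    qed
    have "G \<cong> dbl n 2 (int n - 1) 0 1 (int n div 2) (if n = 8 then 0 else 1)"
    proof (cases "x \<otimes> x = v")
      case True
      then show ?thesis using fin [OF x] e 4(1) by simp
    next
      case False
      then have xx: "x \<otimes> x = t \<otimes> v"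
        using 4(2) tt A_comm [OF z_A t_A] by (auto simp: v_def mult_tail)
      have vc: "v \<in> carrier G" by (simp add: v_def)
      have ita: "inv a \<otimes> t = t \<otimes> inv a" using A_comm [OF A_inv [OF a_A] t_A] .
      show ?thesis
      proof (rule fin)
        show "a \<otimes> x \<in> carrier G" "a \<otimes> x \<notin> A" using x a_A A_mult_iff by simp_all
        have "a \<otimes> x \<otimes> a = a \<otimes> (inv a \<otimes> t \<otimes> x)" using x e 4(1) by (simp add: m_assoc)
        also have "\<dots> = t \<otimes> x" using x by (simp add: m_assoc)
        finally have axa: "a \<otimes> x \<otimes> a = t \<otimes> x" .
        also have "\<dots> = inv a \<otimes> t \<otimes> (a \<otimes> x)" unfolding ita using x by (simp add: m_assoc)
        finally show "a \<otimes> x \<otimes> a = inv a \<otimes> t \<otimes> (a \<otimes> x)" .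
        have "a \<otimes> x \<otimes> (a \<otimes> x) = a \<otimes> x \<otimes> a \<otimes> x" using x by (simp add: m_assoc)
        also have "\<dots> = t \<otimes> (x \<otimes> x)" unfolding axa using x by (simp add: m_assoc)
        also have "\<dots> = v" unfolding xx using tt vc by (simp flip: m_assoc)
        finally show "a \<otimes> x \<otimes> (a \<otimes> x) = v" .
      qed
    qed
    then show ?thesis by (simp add: three_models_def)
  qed
qed

text \<open>\<open>t\<close> and z t play symmetric roles, as \<open>z\<close> is a power of
  \<open>a\<close>. Using this symmetry roughly halves the cases for e and x^2.\<close>

lemma few_big_swap:
  assumes t: "t \<noteq> \<one>"
  shows "few_big G a (z \<otimes> t) z n"
proof (intro few_big.intro few_big_axioms.intro is_group fin closed(1) ord_a n z_def)
  have zt: "z \<otimes> t = t \<otimes> z" by (rule A_comm [OF z_A t_A])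
  show "z \<otimes> t \<in> carrier G" by simp
  show "z \<otimes> t \<otimes> (z \<otimes> t) = \<one>" using E_mult [OF z_E t_E] by (rule E_square)
  show "a \<otimes> (z \<otimes> t) = z \<otimes> t \<otimes> a" by (rule A_comm [OF a_A A_mult [OF z_A t_A]])
  have z_cyc: "z \<in> cyc a" by (auto simp: z_def cyc_mem_iff)
  have not: "z \<otimes> t \<notin> cyc a"
  proof
    assume "z \<otimes> t \<in> cyc a"
    then have "inv z \<otimes> (z \<otimes> t) \<in> cyc a" using cyc_mult_closed cyc_inv_closed z_cyc closed(1) by blast
    then show False using t_not t by simp
  qed
  then show "z \<otimes> t = \<one> \<or> z \<otimes> t \<notin> cyc a" ..
  show "u \<in> {\<one>, z, z \<otimes> t, z \<otimes> (z \<otimes> t)}" if "u \<in> carrier G" "u \<otimes> u = \<one>" for u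
    using inv_cases [OF that] mult_tail [OF zz, of t] by auto
  have at': "a \<otimes> (z \<otimes> t) \<in> cyc (a \<otimes> t)"
  proof -
    \<comment> \<open>The exponent n/2 + 1 is odd, so it keeps \<open>t\<close> and turns
      \<open>a\<close> into a z.\<close>
    have "(a \<otimes> t) [^] (int n div 2 + 1) = a [^] (int n div 2 + 1) \<otimes> t [^] (int n div 2 + 1)"
      by (rule int_pow_mult_distrib [OF at]) simp_all
    also have "t [^] (int n div 2 + 1) = t" using n by (auto simp: t_int_pow)
    also have "a [^] (int n div 2 + 1) = a \<otimes> z"
      using int_pow_mult [OF closed(1), of 1 "int n div 2"] by (simp add: z_def add.commute)
    finally have "a \<otimes> (z \<otimes> t) = (a \<otimes> t) [^] (int n div 2 + 1)" by (simp add: m_assoc)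
    then show ?thesis using cyc_pow_closed [OF totient_ord_at(1) cyc_self] by simp
  qed
  have "ord (a \<otimes> (z \<otimes> t)) = n"
    using ord_mult_involution [of a "z \<otimes> t"] A_comm [OF a_A A_mult [OF z_A t_A]]
      E_square [OF E_mult [OF z_E t_E]] n ord_a by auto
  then have "cyc (a \<otimes> (z \<otimes> t)) = cyc (a \<otimes> t)"
    by (intro cyc_eqI [OF fin totient_ord_at(1) at']) (simp add: ord_at)
  then show "cyc y = cyc a \<or> cyc y = cyc (a \<otimes> (z \<otimes> t))" if "y \<in> carrier G" "totient (ord y) > 2" for y
    using big [OF that] by simp
qed

lemma three_involutions_iso:
  assumes t: "t \<noteq> \<one>"
  shows "G \<cong> integer_mod_group n \<times>\<times> integer_mod_group 2 \<or> three_models"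
proof (cases "carrier G \<subseteq> A")
  case True
  then show ?thesis using iso_abelian(2) A_closed t by blast
next
  case False
  then obtain x where x: "x \<in> carrier G" "x \<notin> A" by blast
  obtain e where e: "e \<in> E" "x \<otimes> a = inv a \<otimes> e \<otimes> x" "e \<noteq> x \<otimes> x" using conj_outside [OF x] by blast
  interpret S: few_big G a "z \<otimes> t" z n by (rule few_big_swap [OF t])
  have zzt: "z \<otimes> (z \<otimes> t) = t" using mult_tail [OF zz, of t] by simp
  have SA: "S.A \<subseteq> A"
  proof
    fix u assume "u \<in> S.A"
    then obtain i j :: int where u: "u = a [^] i \<otimes> (z \<otimes> t) [^] j" unfolding S.A_def by blast
    have "a [^] i \<in> A" by (rule subgroup_int_pow_closed [OF A_subgroup a_A])
    moreover have "(z \<otimes> t) [^] j \<in> A"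
      by (rule subgroup_int_pow_closed [OF A_subgroup A_mult [OF z_A t_A]])
    ultimately show "u \<in> A" unfolding u by (rule A_mult)
  qed
  have w: "x \<otimes> x \<in> {z, t, z \<otimes> t}" using square_outside [OF x] E_eq by auto
  have ne: "z \<otimes> t \<noteq> \<one>" 
  proof
    assume "z \<otimes> t = \<one>"
    then have "z \<otimes> (z \<otimes> t) = z" by simp
    then have "t = z" using zzt by simp
    moreover have "z \<in> cyc a" by (auto simp: z_def cyc_mem_iff)
    ultimately show False using t_not t by simp
  qed
  \<comment> \<open>Nine pairs remain, as x^2 is not one and differs from \<open>e\<close>. The
    second set is the first with \<open>t\<close> and z t exchanged, and together they contain all
    nine.\<close>
  have "(e, x \<otimes> x) \<in> {(\<one>, z), (\<one>, t), (z, t), (t, z), (t, z \<otimes> t)} \<or>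
      (e, x \<otimes> x) \<in> {(\<one>, z), (\<one>, z \<otimes> t), (z, z \<otimes> t), (z \<otimes> t, z), (z \<otimes> t, z \<otimes> (z \<otimes> t))}"
    using w e(1,3) unfolding E_eq zzt by auto
  then have three_models
  proof
    assume "(e, x \<otimes> x) \<in> {(\<one>, z), (\<one>, z \<otimes> t), (z, z \<otimes> t), (z \<otimes> t, z), (z \<otimes> t, z \<otimes> (z \<otimes> t))}"
    then have S.three_models by (rule S.three_models_if [OF ne x(1) _ e(2), rotated]) (use SA x in blast)
    then show ?thesis unfolding S.three_models_def three_models_def .
  qed (rule three_models_if [OF t x e(2)])
  then show ?thesis ..
qed

end

section \<open>The modular group of order 16\<close>

context group
begin

lemma involution_mult_eq_one:
  assumes "x \<in> carrier G" "y \<in> carrier G" "x \<otimes> x = \<one>" "x \<otimes> y = \<one>"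
  shows "y = x"
  using mult_tail [OF assms(3), of y] assms by simp

text \<open>\<open>a\<close> exchanges \<open>t\<close> and z t. The set M of normal forms is the
  subgroup generated by \<open>a\<close> and \<open>t\<close>, which contains all involutions and
  both big cyclic subgroups. An element outside M fixes \<open>z\<close>; it or its product with
  \<open>a\<close> commutes with \<open>t\<close>, and from such an element an involution outside M
  can be built.\<close>

lemma modular_case:
  assumes fin: "finite (carrier G)" and [simp]: "a \<in> carrier G" "t \<in> carrier G" and b: "b \<in> carrier G"
    and ord_a: "ord a = 8" and tb: "totient (ord b) = 4"
    and z_def: "z = a [^] (4::int)" and tt: "t \<otimes> t = \<one>" and t_not: "t \<notin> cyc a"
    and at: "a \<otimes> t = z \<otimes> t \<otimes> a"
    and inv_cases: "\<And>u. u \<in> carrier G \<Longrightarrow> u \<otimes> u = \<one> \<Longrightarrow> u \<in> {\<one>, z, t, z \<otimes> t}"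
    and big: "\<And>y. y \<in> carrier G \<Longrightarrow> totient (ord y) > 2 \<Longrightarrow> cyc y = cyc a \<or> cyc y = cyc b"
  shows "G \<cong> dbl 4 2 1 2 0 1 0"
proof -
  have z [simp]: "z \<in> carrier G" by (simp add: z_def)
  have a8: "a [^] (8::int) = \<one>" using int_pow_eq_id [of a 8] ord_a by simp
  have zz: "z \<otimes> z = \<one>" using a8 by (simp add: z_def flip: int_pow_mult)
  have z1: "z \<noteq> \<one>" using int_pow_eq_id [of a 4] ord_a by (simp add: z_def)
  have az: "a \<otimes> z = z \<otimes> a" unfolding z_def by (rule conj_int_pow) simp_all
  have z_cyc: "z \<in> cyc a" by (auto simp: z_def cyc_mem_iff)
  have zzu: "z \<otimes> (z \<otimes> u) = u" if "u \<in> carrier G" for u using mult_tail [OF zz, of u] that by simp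
  have ttu: "t \<otimes> (t \<otimes> u) = u" if "u \<in> carrier G" for u using mult_tail [OF tt, of u] that by simp
  have at': "a \<otimes> t = z \<otimes> (t \<otimes> a)" using at by (simp add: m_assoc)
  have atu: "a \<otimes> (t \<otimes> u) = z \<otimes> (t \<otimes> (a \<otimes> u))" if "u \<in> carrier G" for u
    using mult_tail [OF at' , of u] that by (simp add: m_assoc)
  have azu: "a \<otimes> (z \<otimes> u) = z \<otimes> (a \<otimes> u)" if "u \<in> carrier G" for u
    using mult_tail [OF az, of u] that by (simp add: m_assoc)
  have aat: "a \<otimes> (a \<otimes> t) = t \<otimes> (a \<otimes> a)"
    by (simp add: at' azu atu zzu)
  have zt: "z \<otimes> t = t \<otimes> z"
  proof -
    have zaa: "z = a \<otimes> a \<otimes> (a \<otimes> a)" by (simp add: z_def int_pow_numeral eval_nat_numeral m_assoc)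
    have c: "a \<otimes> a \<otimes> t = t \<otimes> (a \<otimes> a)" using aat by (simp add: m_assoc)
    have "z \<otimes> t = a \<otimes> a \<otimes> (a \<otimes> a \<otimes> t)" unfolding zaa by (simp add: m_assoc)
    also have "\<dots> = a \<otimes> a \<otimes> (t \<otimes> (a \<otimes> a))" by (simp only: c)
    also have "\<dots> = a \<otimes> a \<otimes> t \<otimes> (a \<otimes> a)" by (simp add: m_assoc)
    also have "\<dots> = t \<otimes> (a \<otimes> a) \<otimes> (a \<otimes> a)" by (simp only: c)
    also have "\<dots> = t \<otimes> z" by (simp add: zaa m_assoc)
    finally show ?thesis .
  qed
  have tzu: "t \<otimes> (z \<otimes> u) = z \<otimes> (t \<otimes> u)" if "u \<in> carrier G" for u
    using mult_tail [OF zt [symmetric], of u] that by (simp add: m_assoc)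
  interpret D: dbl_gens G "a \<otimes> a" t a 4 2 1 2 0 1 0
  proof (intro dbl_gens.intro dbl_gens_axioms.intro is_group)
    show "(a \<otimes> a) [^] (4::nat) = \<one>"
      using a8 by (simp add: int_pow_numeral eval_nat_numeral m_assoc)
    show "t [^] (2::nat) = \<one>" using tt by (simp add: numeral_2_eq_2)
    show "a \<otimes> a \<otimes> t = t \<otimes> (a \<otimes> a)" using aat by (simp add: m_assoc)
    show "a \<otimes> t = (a \<otimes> a) [^] (2::int) \<otimes> t \<otimes> a"
      using at by (simp add: z_def int_pow_numeral eval_nat_numeral m_assoc)
  qed (simp_all add: m_assoc)
  define M where "M = range (\<lambda>(i, j). D.E i j) \<union> range (\<lambda>(i, j). D.E i j \<otimes> a)"
  have M_I: "D.E i j \<in> M" "D.E i j \<otimes> a \<in> M" for i j by (auto simp: M_def)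
  have M_E: "D.E i j \<otimes> m \<in> M" if "m \<in> M" for i j m
  proof -
    from that consider (1) k l where "m = D.E k l" | (2) k l where "m = D.E k l \<otimes> a"
      unfolding M_def by auto
    then show ?thesis by cases (simp_all add: D.E_mult M_I flip: m_assoc)
  qed
  have aE: "a \<otimes> D.E i j = D.E (i + 2 * j) j \<otimes> a" for i j
    using D.x_E [of i j] by simp
  have aa: "a \<otimes> a = D.E 1 0" by (simp add: D.E_def)
  have M_a: "a \<otimes> m \<in> M" if "m \<in> M" for m
  proof -
    from that consider (1) i j where "m = D.E i j" | (2) i j where "m = D.E i j \<otimes> a"
      unfolding M_def by auto
    then show ?thesis
    proof cases
      case 1
      then show ?thesis using aE M_I by simp
    next
      case 2
      then have "a \<otimes> m = a \<otimes> D.E i j \<otimes> a" by (simp add: m_assoc)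
      also have "\<dots> = D.E (i + 2 * j) j \<otimes> (a \<otimes> a)" by (simp only: aE) (simp add: m_assoc)
      also have "\<dots> = D.E (i + 2 * j) j \<otimes> D.E 1 0" by (rule arg_cong [OF aa])
      also have "\<dots> = D.E (i + 2 * j + 1) j" by (simp add: D.E_mult)
      finally show ?thesis using M_I by simp
    qed
  qed
  have M_closed: "m \<in> carrier G" if "m \<in> M" for m using that by (auto simp: M_def)
  have M_iaa: "inv a \<otimes> m \<in> M" if "m \<in> M" for m
  proof -
    have "inv a = D.E (-1) 0 \<otimes> a"
    proof -
      have "D.E (-1) 0 \<otimes> a = inv (a \<otimes> a) \<otimes> a" by (simp add: D.E_def int_pow_neg)
      also have "\<dots> = inv a" by (simp add: inv_mult_group m_assoc)
      finally show ?thesis by simp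
    qed
    then have "inv a \<otimes> m = D.E (-1) 0 \<otimes> (a \<otimes> m)" using M_closed [OF that] by (simp add: m_assoc)
    then show ?thesis using M_a M_E that by simp
  qed
  have M_t: "t \<otimes> m \<in> M" if "m \<in> M" for m
    using M_E [OF that, of 0 1] by (simp add: D.E_def)
  have one_M: "\<one> \<in> M" using M_I(1) [of 0 0] by (simp add: D.E_0)
  have a_M: "a \<in> M" using M_a [OF one_M] by simp
  \<comment> \<open>M is stable under left multiplication by a, its inverse and t, and contains one;
    so it is the subgroup that they generate.\<close>
  have M_sub: "subgroup M G"
  proof -
    have "M = generate G {a, t}"
    proof
      have t: "t \<in> generate G {a, t}" and a: "a \<in> generate G {a, t}" by (auto intro: generate.incl)
      have sub: "subgroup (generate G {a, t}) G" by (rule generate_is_subgroup) simp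
      have "D.E i j \<in> generate G {a, t}" for i j
        unfolding D.E_def
        by (intro generate.eng subgroup_int_pow_closed [OF sub]) (use a t generate.eng in auto)
      then show "M \<subseteq> generate G {a, t}" using a generate.eng by (fastforce simp: M_def)
      have "u \<in> generate G {a, t} \<Longrightarrow> \<forall>m\<in>M. u \<otimes> m \<in> M" for u
      proof (induction rule: generate.induct)
        case one
        then show ?case using M_closed by simp
      next
        case (incl h)
        then show ?case using M_a M_t by auto
      next
        case (inv h)
        moreover have "inv t = t" by (rule inv_equality) (simp_all add: tt)
        ultimately show ?case using M_iaa M_t by auto
      next
        case (eng h1 h2)
        have "h1 \<in> carrier G" "h2 \<in> carrier G"
          using eng.hyps subgroup.mem_carrier [OF sub] by auto
        then show ?case using eng.IH M_closed by (auto simp: m_assoc)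
      qed
      then show "generate G {a, t} \<subseteq> M"
        using one_M subgroup.mem_carrier [OF sub] by (metis r_one subsetI)
    qed
    then show ?thesis by (simp add: generate_is_subgroup)
  qed
  have M_mult: "u \<otimes> v \<in> M" if "u \<in> M" "v \<in> M" for u v
    using subgroup.m_closed [OF M_sub that] .
  have M_cancel: "y \<in> M" if "u \<in> M" "u \<otimes> y \<in> M" "y \<in> carrier G" for u y
  proof -
    have "inv u \<otimes> (u \<otimes> y) \<in> M"
      using that M_mult subgroup.m_inv_closed [OF M_sub] by blast
    then show ?thesis using that M_closed by simp
  qed
  have t_M: "t \<in> M" using M_t [OF one_M] by simp
  have z_M: "z \<in> M"
    unfolding z_def by (rule subgroup_int_pow_closed [OF M_sub a_M])
  have E_M: "u \<in> M" if "u \<in> carrier G" "u \<otimes> u = \<one>" for u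
    using inv_cases [OF that] one_M z_M t_M M_mult by auto
  \<comment> \<open>Squaring once more gives (a t)^4 = z: a t also has order 8 and shares the
    involution \<open>z\<close>, so \<open>cyc (a \<otimes> t)\<close> is the second big
    subgroup.\<close>
  have tat: "a \<otimes> t \<otimes> (a \<otimes> t) = z \<otimes> (a \<otimes> a)"
    by (simp add: m_assoc at' azu atu zzu tt ttu tzu)
  have at4: "(a \<otimes> t) [^] (4::int) = z"
  proof -
    have "(a \<otimes> t) [^] (4::int) = a \<otimes> t \<otimes> (a \<otimes> t) \<otimes> (a \<otimes> t \<otimes> (a \<otimes> t))"
      by (simp add: int_pow_numeral eval_nat_numeral m_assoc)
    also have "\<dots> = a \<otimes> (a \<otimes> (a \<otimes> a))" unfolding tat by (simp add: m_assoc azu zzu)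
    also have "\<dots> = z" by (simp add: z_def int_pow_numeral eval_nat_numeral m_assoc)
    finally show ?thesis .
  qed
  have c_at: "a \<otimes> t \<in> carrier G" by simp
  have z_cyc': "z \<in> cyc (a \<otimes> t)" using cyc_pow_closed [OF c_at cyc_self, of 4] at4 by simp
  have ord_at: "ord (a \<otimes> t) = 8"
  proof -
    have "(a \<otimes> t) [^] (8::int) = z \<otimes> z"
      using int_pow_mult [OF c_at, of 4 4] at4 by simp
    then have "int (ord (a \<otimes> t)) dvd 8" using int_pow_eq_id [OF c_at, of 8] zz by simp
    moreover have "\<not> int (ord (a \<otimes> t)) dvd 4" using int_pow_eq_id [OF c_at, of 4] at4 z1 by simp
    ultimately have "ord (a \<otimes> t) dvd 8" "\<not> ord (a \<otimes> t) dvd 4" by presburger+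
    then have "ord (a \<otimes> t) dvd 2 ^ 3" "\<not> ord (a \<otimes> t) dvd 4" by simp_all
    then obtain k where "k \<le> 3" "ord (a \<otimes> t) = 2 ^ k" using divides_primepow_nat [of 2 _ 3] by auto
    moreover have "k = 0 \<or> k = 1 \<or> k = 2 \<or> k = 3" using \<open>k \<le> 3\<close> by auto
    ultimately show ?thesis using \<open>\<not> ord (a \<otimes> t) dvd 4\<close> by auto
  qed
  have ne: "cyc (a \<otimes> t) \<noteq> cyc a"
  proof
    assume "cyc (a \<otimes> t) = cyc a"
    then have "a \<otimes> t \<in> cyc a" using cyc_self by blast
    then have "inv a \<otimes> (a \<otimes> t) \<in> cyc a"
      using cyc_mult_closed cyc_inv_closed cyc_self assms(2) by blast
    then show False using t_not by simp
  qed
  have big': "cyc y = cyc a \<or> cyc y = cyc (a \<otimes> t)" if "y \<in> carrier G" "totient (ord y) > 2" for y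
    using big [OF that] big [OF c_at] ne ord_at by (auto simp: totient_values)
  have big_M: "y \<in> M" if "y \<in> carrier G" "totient (ord y) > 2" for y
  proof -
    have "cyc u \<subseteq> M" if "u \<in> M" for u
      by (rule generate_subgroup_incl [OF _ M_sub]) (use that in simp)
    then have "cyc a \<subseteq> M" "cyc (a \<otimes> t) \<subseteq> M"
      using a_M t_M M_mult by blast+
    then show ?thesis using big' [OF that] cyc_self [of y] by blast
  qed
  have outside: "(y \<otimes> y) \<in> {z, t, z \<otimes> t}" if y: "y \<in> carrier G" "y \<notin> M" for y
  proof -
    have "totient (ord y) \<le> 2" using big_M y by (meson not_le)
    moreover have "ord y > 0" using ord_ge_1 [OF fin y(1)] by simp
    ultimately have o: "ord y \<in> {1, 2, 3, 4, 6}" by (rule totient_le_2)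
    have 1: "y \<otimes> y \<noteq> \<one>" using E_M y by blast
    have no3: "ord w \<noteq> 3" if "w \<in> carrier G" for w
      using no_order_3_if_8 [OF fin assms(2) b that ord_a tb _ big] by blast
    have "ord y \<noteq> 1" using ord_eq_1 [OF y(1)] y one_M by auto
    moreover have "ord y \<noteq> 2" using ord_eq_2_iff [OF y(1)] 1 by blast
    moreover have "ord y \<noteq> 3" by (rule no3 [OF y(1)])
    moreover have "ord y \<noteq> 6"
    proof
      assume 6: "ord y = 6"
      then have "ord (y [^] (2::nat)) = 3" using y by (simp add: ord_pow)
      then show False using no3 [of "y [^] (2::nat)"] y by simp
    qed
    ultimately have "ord y = 4" using o by simp
    then have "y [^] (4::nat) = \<one>" using y(1) by (simp add: pow_eq_id)
    then have "y \<otimes> y \<otimes> (y \<otimes> y) = \<one>" using y(1) by (simp add: eval_nat_numeral m_assoc)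
    then show ?thesis using inv_cases [of "y \<otimes> y"] 1 y(1) by auto
  qed
  have tz_ne: "t \<noteq> z \<otimes> t" using z1 by simp
  \<comment> \<open>a x exchanges t and z t, so its square v, which commutes with a x, can only be
    z. Then (a t x)^2 = z t v t is one.\<close>
  have no_commuting: False if x: "x \<in> carrier G" "x \<notin> M" "x \<otimes> t = t \<otimes> x" "x \<otimes> z = z \<otimes> x" for x
  proof -
    have xtu: "x \<otimes> (t \<otimes> u) = t \<otimes> (x \<otimes> u)" if "u \<in> carrier G" for u
      using mult_tail [OF x(3), of u] that x(1) by (simp add: m_assoc)
    have xzu: "x \<otimes> (z \<otimes> u) = z \<otimes> (x \<otimes> u)" if "u \<in> carrier G" for u
      using mult_tail [OF x(4), of u] that x(1) by (simp add: m_assoc)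
    have ax: "a \<otimes> x \<in> carrier G" "a \<otimes> x \<notin> M" using x M_cancel [OF a_M] by auto
    define v where "v = a \<otimes> x \<otimes> (a \<otimes> x)"
    have vc: "v \<otimes> (a \<otimes> x) = a \<otimes> x \<otimes> v" using x by (simp add: v_def m_assoc)
    have axt: "a \<otimes> x \<otimes> t = z \<otimes> t \<otimes> (a \<otimes> x)"
      using x by (simp add: m_assoc xtu x(3) atu)
    have axzt: "a \<otimes> x \<otimes> (z \<otimes> t) = t \<otimes> (a \<otimes> x)"
    proof -
      have "a \<otimes> x \<otimes> (z \<otimes> t) = z \<otimes> (a \<otimes> x \<otimes> t)" using x by (simp add: m_assoc xzu azu)
      also have "\<dots> = t \<otimes> (a \<otimes> x)" unfolding axt using x by (simp add: m_assoc zzu)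
      finally show ?thesis .
    qed
    have "v \<noteq> t" using vc axt ax tz_ne by auto
    moreover have "v \<noteq> z \<otimes> t" using vc axzt ax tz_ne by auto
    ultimately have v: "v = z" using outside [OF ax] by (auto simp: v_def)
    have "a \<otimes> t \<otimes> x \<otimes> (a \<otimes> t \<otimes> x) = a \<otimes> t \<otimes> (x \<otimes> a) \<otimes> (x \<otimes> t)"
      using x by (simp add: m_assoc)
    also have "\<dots> = z \<otimes> t \<otimes> v \<otimes> t"
      unfolding v_def at using x by (simp add: m_assoc)
    also have "\<dots> = \<one>" unfolding v zt using zz tt by (simp add: m_assoc zzu)
    finally have "a \<otimes> t \<otimes> x \<in> M" using x E_M by simp
    then show False using M_cancel [OF M_mult [OF a_M t_M]] x by blast
  qed
  have G_M: "carrier G \<subseteq> M"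
  proof
    fix x assume x: "x \<in> carrier G"
    show "x \<in> M"
    proof (rule ccontr)
      assume xM: "x \<notin> M"
      \<comment> \<open>z is the only involution in either big subgroup, and the conjugate of a
        generates one of them.\<close>
      have xz: "x \<otimes> z = z \<otimes> x"
      proof -
        define a' where "a' = x \<otimes> a \<otimes> inv x"
        have a': "a' \<in> carrier G" "ord a' = 8" using x ord_a by (simp_all add: a'_def ord_conj)
        have 4: "a' [^] (4::int) = x \<otimes> z \<otimes> inv x"
          using x by (simp add: a'_def z_def conj_int_pow')
        have inv: "a' [^] (4::int) \<otimes> a' [^] (4::int) = \<one>" "a' [^] (4::int) \<noteq> \<one>"
          using a' int_pow_eq_id [OF a'(1)] by (simp_all flip: int_pow_mult)
        have mem: "a' [^] (4::int) \<in> cyc a'" by (rule cyc_pow_closed [OF a'(1) cyc_self])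
        have "z \<in> cyc a'" using big' [OF a'(1)] a'(2) z_cyc z_cyc' by (auto simp: totient_values)
        then have "a' [^] (4::int) = z"
          using involution_in_cyc_unique [OF a'(1) mem inv _ zz z1] by blast
        then show ?thesis using 4 x by (simp add: conj_eq_iff)
      qed
      define u where "u = x \<otimes> t \<otimes> inv x"
      have u: "u \<in> carrier G" "x \<otimes> t = u \<otimes> x" using x by (simp_all add: u_def m_assoc)
      have "u \<otimes> u = x \<otimes> (t \<otimes> t) \<otimes> inv x" unfolding u_def using x by (simp add: m_assoc ttu)
      then have "u \<otimes> u = \<one>" using x tt by simp
      then have "u \<in> {\<one>, z, t, z \<otimes> t}" using inv_cases u(1) by blast
      moreover have "u \<noteq> \<one>"
      proof
        assume "u = \<one>"
        then have "t = \<one>" using u(2) x by simp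
        then show False using t_not generate.one by metis
      qed
      moreover have "u \<noteq> z"
      proof
        assume "u = z"
        then have "x \<otimes> t = x \<otimes> z" using u(2) xz by simp
        then show False using x t_not z_cyc by simp
      qed
      ultimately consider "x \<otimes> t = t \<otimes> x" | "x \<otimes> t = z \<otimes> t \<otimes> x" using u(2) by auto
      then show False
      proof cases
        case 1
        then show ?thesis using no_commuting x xM xz by blast
      next
        \<comment> \<open>x and a both exchange t and z t, so a x commutes with t.\<close>
        case 2
        have "a \<otimes> x \<otimes> t = a \<otimes> (z \<otimes> t \<otimes> x)" using x 2 by (simp add: m_assoc)
        also have "\<dots> = t \<otimes> (a \<otimes> x)" using x by (simp add: m_assoc azu atu zzu)
        finally have "a \<otimes> x \<otimes> t = t \<otimes> (a \<otimes> x)" .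
        moreover have "a \<otimes> x \<otimes> z = z \<otimes> (a \<otimes> x)" using x by (simp add: m_assoc xz azu)
        moreover have "a \<otimes> x \<notin> M" using M_cancel [OF a_M] x xM by blast
        ultimately show ?thesis using no_commuting [of "a \<otimes> x"] x by simp
      qed
    qed
  qed
  have E_cyc: "t \<in> cyc a" if E: "D.E i j = a [^] k" and odd: "odd j" for i j k :: int
  proof -
    obtain l where l: "j = 2 * l + 1" using odd by (elim oddE)
    have "t [^] (2 * l) = (t \<otimes> t) [^] l"
      using int_pow_pow [of t 2 l] by (simp add: int_pow_numeral numeral_2_eq_2)
    then have "t [^] (2 * l) = \<one>" using tt by simp
    then have "t [^] j = t" using int_pow_mult [of t "2 * l" 1] by (simp add: l)
    moreover have "(a \<otimes> a) [^] i = a [^] (2 * i)"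
      using int_pow_pow [of a 2 i] by (simp add: int_pow_numeral numeral_2_eq_2)
    ultimately have "a [^] (2 * i) \<otimes> t = a [^] k" using E by (simp add: D.E_def)
    then have "inv (a [^] (2 * i)) \<otimes> (a [^] (2 * i) \<otimes> t) = inv (a [^] (2 * i)) \<otimes> a [^] k" by simp
    then have "t = a [^] (- (2 * i) + k)"
      using int_pow_mult [OF assms(2), of "- (2 * i)" k] assms(2) by (simp add: int_pow_neg)
    then show ?thesis using cyc_mem_iff [OF assms(2)] by blast
  qed
  have E_even: "D.E i j = a [^] (2 * i)" if j: "even j" for i j :: int
  proof -
    obtain l where l: "j = 2 * l" using j by (elim evenE)
    have "t [^] (2 * l) = (t \<otimes> t) [^] l"
      using int_pow_pow [of t 2 l] by (simp add: int_pow_numeral numeral_2_eq_2)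
    moreover have "(a \<otimes> a) [^] i = a [^] (2 * i)"
      using int_pow_pow [of a 2 i] by (simp add: int_pow_numeral numeral_2_eq_2)
    ultimately show ?thesis using tt by (simp add: D.E_def l)
  qed
  show ?thesis
  proof (rule D.iso_dbl)
    show "int 4 dvd i \<and> int 2 dvd j" if "D.E i j = \<one>" for i j
    proof -
      have j: "even j" using E_cyc [of i j 0] that t_not by auto
      then have "a [^] (2 * i) = \<one>" using E_even that by simp
      then have "8 dvd 2 * i" using int_pow_eq_id [OF assms(2), of "2 * i"] ord_a by simp
      then show ?thesis using j by presburger
    qed
    show "a \<noteq> D.E i j" for i j
    proof
      assume *: "a = D.E i j"
      have j: "even j" using E_cyc [of i j 1] * t_not by auto
      then have "a [^] (1::int) = a [^] (2 * i)" using E_even * by simp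
      then have "8 dvd 2 * i - 1" using int_pow_eq [OF assms(2), of 1 "2 * i"] ord_a by simp
      then show False by presburger
    qed
    show "group (dbl 4 2 1 2 0 1 0)" by (rule group_models)
    show "carrier G \<subseteq> range (\<lambda>(i, j). D.E i j) \<union> range (\<lambda>(i, j). D.E i j \<otimes> a)"
      using G_M by (simp add: M_def)
  qed
qed

section \<open>Classification with one or three involutions\<close>

lemma one_involution_classification:
  assumes fin: "finite (carrier G)" and half: "2 * card (cyclic_subgroups G) = order G"
    and inv: "involution_count G = 1"
  shows "G \<cong> integer_mod_group 8 \<or> G \<cong> integer_mod_group 12 \<or>
    G \<cong> dbl 8 1 7 0 0 4 0 \<or> G \<cong> dbl 12 1 11 0 0 6 0"
proof -
  obtain a where a: "a \<in> carrier G" "totient (ord a) = 4"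
    and big: "\<And>y. y \<in> carrier G \<Longrightarrow> totient (ord y) > 2 \<Longrightarrow> cyc y = cyc a"
    using one_involution_big_cyclic [OF fin half inv] by metis
  have "card {u \<in> carrier G. u \<noteq> \<one> \<and> u \<otimes> u = \<one>} = 1"
    using inv involution_count_eq by simp
  then obtain z0 where z0: "{u \<in> carrier G. u \<noteq> \<one> \<and> u \<otimes> u = \<one>} = {z0}"
    by (auto simp: card_1_singleton_iff)
  have t: "z0 \<in> carrier G" "z0 \<otimes> z0 = \<one>" "z0 \<noteq> \<one>" using z0 by auto
  have few: "card {u \<in> carrier G. u \<noteq> \<one> \<and> u \<otimes> u = \<one>} \<le> 3" by (simp add: z0)
  have no5: "ord c \<noteq> 5" if "c \<in> carrier G" for c
    using no_odd_one [OF fin that _ big t few] by auto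
  have "ord a \<in> {5, 8, 10, 12}" by (rule totient_eq_4 [OF a(2)])
  moreover have "ord a \<noteq> 5" by (rule no5 [OF a(1)])
  moreover have "ord a \<noteq> 10"
  proof
    assume "ord a = 10"
    then have "ord (a [^] (2::nat)) = 5" using a by (simp add: ord_pow)
    then show False using no5 [of "a [^] (2::nat)"] a by simp
  qed
  ultimately have n: "ord a = 8 \<or> ord a = 12" by auto
  define z where "z = a [^] (int (ord a) div 2)"
  have zc: "z \<in> carrier G" using a by (simp add: z_def)
  have "z \<noteq> \<one>"
  proof -
    have "\<not> int (ord a) dvd int (ord a) div 2" using n by auto
    then show ?thesis using a by (simp add: z_def int_pow_eq_id)
  qed
  moreover have "z \<otimes> z = \<one>"
  proof -
    have "z \<otimes> z = a [^] (int (ord a) div 2 + int (ord a) div 2)"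
      unfolding z_def by (rule int_pow_mult [symmetric, OF a(1)])
    also have "\<dots> = \<one>" using n a by (auto simp: int_pow_eq_id)
    finally show ?thesis .
  qed
  ultimately have "z = z0" using z0 zc by blast
  interpret F: few_big G a \<one> z "ord a"
  proof (intro few_big.intro few_big_axioms.intro is_group fin a n z_def)
    show "u \<in> {\<one>, z, \<one>, z \<otimes> \<one>}" if "u \<in> carrier G" "u \<otimes> u = \<one>" for u
      using z0 that zc \<open>z = z0\<close> by auto
    show "cyc y = cyc a \<or> cyc y = cyc (a \<otimes> \<one>)" if "y \<in> carrier G" "totient (ord y) > 2" for y
      using big [OF that] by simp
  qed (use a in simp_all)
  show ?thesis using F.one_involution_iso n by auto
qed

text \<open>\<open>g\<close> fixes \<open>z\<close> and permutes the other two involutions. If it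
  exchanges them, g^2 centralises \<open>t\<close>, hence so does \<open>z\<close> as a power of
  g^2. Then z t is an involution different from \<open>z\<close> and \<open>t\<close>, so it is the
  third one.\<close>

lemma centralizes_or_swaps:
  assumes [simp]: "g \<in> carrier G" "z \<in> carrier G" "t \<in> carrier G" "t' \<in> carrier G"
    and set: "{u \<in> carrier G. u \<noteq> \<one> \<and> u \<otimes> u = \<one>} = {z, t, t'}" and ne: "z \<noteq> t" "z \<noteq> t'" "t \<noteq> t'"
    and gz: "g \<otimes> z = z \<otimes> g" and z: "z = (g \<otimes> g) [^] (k::int)"
  shows "g \<otimes> t = t \<otimes> g \<or> g \<otimes> t = z \<otimes> t \<otimes> g \<and> t' = z \<otimes> t"
proof (cases "g \<otimes> t = t \<otimes> g")
  case False
  have conj: "g \<otimes> u \<otimes> inv g \<in> {z, t, t'} - {z}" if "u \<in> {t, t'}" for u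
  proof -
    have u: "u \<in> carrier G" "u \<noteq> \<one>" "u \<otimes> u = \<one>" "u \<noteq> z" using that set ne by auto
    have "(g \<otimes> u \<otimes> inv g) [^] (2::nat) = g \<otimes> u [^] (2::nat) \<otimes> inv g"
      using u by (simp add: conj_nat_pow)
    then have "(g \<otimes> u \<otimes> inv g) \<otimes> (g \<otimes> u \<otimes> inv g) = \<one>" using u by (simp add: numeral_2_eq_2)
    moreover have "g \<otimes> u \<otimes> inv g \<noteq> \<one>" using u by (simp add: conj_eq_one_iff)
    ultimately have "g \<otimes> u \<otimes> inv g \<in> {u \<in> carrier G. u \<noteq> \<one> \<and> u \<otimes> u = \<one>}"
      using u by simp
    then have "g \<otimes> u \<otimes> inv g \<in> {z, t, t'}" unfolding set .
    moreover have "g \<otimes> u \<otimes> inv g \<noteq> z"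
    proof
      assume "g \<otimes> u \<otimes> inv g = z"
      then have "g \<otimes> u = g \<otimes> z" using u gz by (simp add: conj_eq_iff)
      then show False using u by simp
    qed
    ultimately show ?thesis by simp
  qed
  have gt: "g \<otimes> t = t' \<otimes> g"
    using conj [of t] False by (auto simp: conj_eq_iff)
  have gt': "g \<otimes> t' = t \<otimes> g"
  proof -
    have "g \<otimes> t' \<otimes> inv g \<noteq> t'"
    proof
      assume "g \<otimes> t' \<otimes> inv g = t'"
      then have "g \<otimes> t' = g \<otimes> t" using gt by (simp add: conj_eq_iff)
      then show False using ne by simp
    qed
    then show ?thesis using conj [of t'] by (auto simp: conj_eq_iff)
  qed
  have "t \<otimes> (g \<otimes> g) = g \<otimes> g \<otimes> t"
    using gt gt' by (metis m_assoc assms(1,3,4))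
  then have tz: "t \<otimes> z = z \<otimes> t" unfolding z using conj_int_pow [of t "g \<otimes> g" "g \<otimes> g" k] by simp
  have inv: "z \<otimes> z = \<one>" "t \<otimes> t = \<one>" "z \<noteq> \<one>" "t \<noteq> \<one>" using set by auto
  have "z \<otimes> t \<otimes> (z \<otimes> t) = z \<otimes> (t \<otimes> z) \<otimes> t" by (simp add: m_assoc)
  also have "\<dots> = \<one>" unfolding tz using inv mult_tail [of z z \<one> t] by (simp add: m_assoc)
  finally have "z \<otimes> t \<otimes> (z \<otimes> t) = \<one>" .
  moreover have "z \<otimes> t \<noteq> \<one>"
  proof
    assume "z \<otimes> t = \<one>"
    then have "t = z" by (rule involution_mult_eq_one [OF assms(2,3) inv(1)])
    then show False using ne by simp
  qed
  ultimately have "z \<otimes> t \<in> {u \<in> carrier G. u \<noteq> \<one> \<and> u \<otimes> u = \<one>}" by simp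
  then have "z \<otimes> t \<in> {z, t, t'}" unfolding set .
  moreover have "z \<otimes> t \<noteq> z" "z \<otimes> t \<noteq> t" using inv by simp_all
  ultimately have "z \<otimes> t = t'" by blast
  then show ?thesis using gt by simp
qed simp

text \<open>Once \<open>t\<close> centralises \<open>a\<close>, the remaining data are forced: the
  third involution is z t, and the second big subgroup is generated by a t.\<close>

lemma few_bigI:
  assumes fin: "finite (carrier G)" and a: "a \<in> carrier G" and n: "ord a = 8 \<or> ord a = 12"
    and b: "b \<in> carrier G" and ne: "cyc a \<noteq> cyc b"
    and big: "\<And>y. y \<in> carrier G \<Longrightarrow> totient (ord y) > 2 \<Longrightarrow> cyc y = cyc a \<or> cyc y = cyc b"
    and z: "z = a [^] (int (ord a) div 2)" and t: "t \<in> carrier G" "t' \<in> carrier G"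
    and set: "{u \<in> carrier G. u \<noteq> \<one> \<and> u \<otimes> u = \<one>} = {z, t, t'}" and zt: "z \<noteq> t" "z \<noteq> t'" "t \<noteq> t'"
    and at: "a \<otimes> t = t \<otimes> a"
  shows "few_big G a t z (ord a)"
proof (intro few_big.intro few_big_axioms.intro is_group fin a n z t(1) at HOL.refl)
  have i: "z \<in> carrier G" "z \<otimes> z = \<one>" "t \<otimes> t = \<one>" "z \<noteq> \<one>" "t \<noteq> \<one>" using set by auto
  show "t \<otimes> t = \<one>" by (rule i)
  have z_cyc: "z \<in> cyc a" using cyc_mem_iff [OF a] z by blast
  have t_not: "t \<notin> cyc a"
    using involution_in_cyc_unique [OF a z_cyc i(2,4) _ i(3,5)] zt by blast
  then show "t = \<one> \<or> t \<notin> cyc a" ..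
  have tz: "t \<otimes> z = z \<otimes> t"
    unfolding z by (rule conj_int_pow [OF t(1) a a at [symmetric]])
  have "z \<otimes> t \<otimes> (z \<otimes> t) = z \<otimes> (t \<otimes> z) \<otimes> t" using i t by (simp add: m_assoc)
  also have "\<dots> = \<one>" unfolding tz using i t mult_tail [of z z \<one> t] by (simp add: m_assoc)
  finally have "z \<otimes> t \<otimes> (z \<otimes> t) = \<one>" .
  moreover have "z \<otimes> t \<noteq> \<one>"
  proof
    assume "z \<otimes> t = \<one>"
    then have "t = z" by (rule involution_mult_eq_one [OF i(1) t(1) i(2)])
    then show False using zt by simp
  qed
  ultimately have "z \<otimes> t \<in> {u \<in> carrier G. u \<noteq> \<one> \<and> u \<otimes> u = \<one>}" using i t by simp
  then have "z \<otimes> t \<in> {z, t, t'}" unfolding set .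
  moreover have "z \<otimes> t \<noteq> z" "z \<otimes> t \<noteq> t" using i t by simp_all
  ultimately have t': "t' = z \<otimes> t" by blast
  show "u \<in> {\<one>, z, t, z \<otimes> t}" if "u \<in> carrier G" "u \<otimes> u = \<one>" for u
  proof (cases "u = \<one>")
    case False
    then have "u \<in> {u \<in> carrier G. u \<noteq> \<one> \<and> u \<otimes> u = \<one>}" using that by simp
    then show ?thesis unfolding set t' by blast
  qed simp
  have c: "a \<otimes> t \<in> carrier G" using a t by simp
  have "4 dvd ord a" using n by auto
  then have "ord (a \<otimes> t) = ord a" using ord_mult_involution [OF a t(1) at i(3)] by simp
  then have "totient (ord (a \<otimes> t)) > 2" using n by (auto simp: totient_values)
  moreover have "cyc (a \<otimes> t) \<noteq> cyc a"
  proof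
    assume "cyc (a \<otimes> t) = cyc a"
    then have "a \<otimes> t \<in> cyc a" using cyc_self by blast
    then have "inv a \<otimes> (a \<otimes> t) \<in> cyc a"
      using cyc_mult_closed cyc_inv_closed cyc_self a by blast
    then show False using t_not a t by simp
  qed
  ultimately have "cyc (a \<otimes> t) = cyc b" using big [OF c] by blast
  then show "cyc y = cyc a \<or> cyc y = cyc (a \<otimes> t)" if "y \<in> carrier G" "totient (ord y) > 2" for y
    using big [OF that] by simp
qed

lemma three_involutions_8:
  assumes fin: "finite (carrier G)" and a: "a \<in> carrier G" "ord a = 8" and b: "b \<in> carrier G" "totient (ord b) = 4"
    and ne: "cyc a \<noteq> cyc b"
    and big: "\<And>y. y \<in> carrier G \<Longrightarrow> totient (ord y) > 2 \<Longrightarrow> cyc y = cyc a \<or> cyc y = cyc b"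
    and z: "z = a [^] (4::int)" and t: "t \<in> carrier G" "t' \<in> carrier G"
    and set: "{u \<in> carrier G. u \<noteq> \<one> \<and> u \<otimes> u = \<one>} = {z, t, t'}" and zt: "z \<noteq> t" "z \<noteq> t'" "t \<noteq> t'"
  shows "G \<cong> integer_mod_group 8 \<times>\<times> integer_mod_group 2 \<or> G \<cong> dbl 4 2 1 2 0 1 0 \<or>
    G \<cong> dbl 8 2 7 0 0 4 0 \<or> G \<cong> dbl 8 2 7 0 0 0 1 \<or> G \<cong> dbl 8 2 3 0 0 0 1 \<or> G \<cong> dbl 8 2 7 0 1 4 0"
proof -
  have zc: "z \<in> carrier G" using a by (simp add: z)
  have i: "z \<otimes> z = \<one>" "t \<otimes> t = \<one>" "z \<noteq> \<one>" "t \<noteq> \<one>" using set by auto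
  have az: "a \<otimes> z = z \<otimes> a" unfolding z by (rule conj_int_pow) (use a in simp_all)
  have z2: "z = (a \<otimes> a) [^] (2::int)"
    using a by (simp add: z int_pow_numeral eval_nat_numeral m_assoc)
  from centralizes_or_swaps [OF a(1) zc t set zt az z2]
  show ?thesis
  proof
    assume at: "a \<otimes> t = t \<otimes> a"
    interpret F: few_big G a t z "ord a"
      by (rule few_bigI [OF fin a(1) _ b(1) ne big _ t set zt at]) (use a z in simp_all)
    show ?thesis
      using F.three_involutions_iso [OF i(4), unfolded F.three_models_def] a(2) by auto
  next
    assume at: "a \<otimes> t = z \<otimes> t \<otimes> a \<and> t' = z \<otimes> t"
    have z_cyc: "z \<in> cyc a" using cyc_mem_iff [OF a(1)] z by blast
    have t_not: "t \<notin> cyc a"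
      using involution_in_cyc_unique [OF a(1) z_cyc i(1,3) _ i(2,4)] zt by blast
    have "G \<cong> dbl 4 2 1 2 0 1 0"
    proof (rule modular_case [OF fin a(1) t(1) b(1) a(2) b(2) z i(2) t_not _ _ big])
      show "a \<otimes> t = z \<otimes> t \<otimes> a" using at by simp
      show "u \<in> {\<one>, z, t, z \<otimes> t}" if "u \<in> carrier G" "u \<otimes> u = \<one>" for u
        using set that at by auto
    qed
    then show ?thesis by simp
  qed
qed

text \<open>Here \<open>t\<close> always centralises \<open>a\<close>, so no analogue of M_16
  occurs. It centralises a^4: otherwise it would invert it and produce too many involutions. It
  centralises f = a^3: otherwise f t = z t f, so f t is an involution, and each of the three
  possible values for it is contradictory.\<close>

lemma three_involutions_12:
  assumes fin: "finite (carrier G)" and a: "a \<in> carrier G" "ord a = 12" and b: "b \<in> carrier G" "totient (ord b) = 4"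
    and ne: "cyc a \<noteq> cyc b"
    and big: "\<And>y. y \<in> carrier G \<Longrightarrow> totient (ord y) > 2 \<Longrightarrow> cyc y = cyc a \<or> cyc y = cyc b"
    and z: "z = a [^] (6::int)" and t: "t \<in> carrier G" "t' \<in> carrier G"
    and set: "{u \<in> carrier G. u \<noteq> \<one> \<and> u \<otimes> u = \<one>} = {z, t, t'}" and zt: "z \<noteq> t" "z \<noteq> t'" "t \<noteq> t'"
  shows "G \<cong> integer_mod_group 12 \<times>\<times> integer_mod_group 2 \<or>
    G \<cong> dbl 12 2 11 0 0 6 0 \<or> G \<cong> dbl 12 2 11 0 0 0 1 \<or> G \<cong> dbl 12 2 5 0 0 0 1 \<or> G \<cong> dbl 12 2 11 0 1 6 1"
proof -
  have zc: "z \<in> carrier G" using a by (simp add: z)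
  have i: "z \<otimes> z = \<one>" "t \<otimes> t = \<one>" "z \<noteq> \<one>" "t \<noteq> \<one>" using set by auto
  have z_cyc: "z \<in> cyc a" using cyc_mem_iff [OF a(1)] z by blast
  have t_not: "t \<notin> cyc a"
    using involution_in_cyc_unique [OF a(1) z_cyc i(1,3) _ i(2,4)] zt by blast
  define y where "y = a [^] (4::int)"
  define f where "f = a [^] (3::int)"
  have c: "y \<in> carrier G" "f \<in> carrier G" using a by (simp_all add: y_def f_def)
  have y3: "ord y = 3" using a by (simp add: y_def int_pow_numeral ord_pow)
  have yty: "t \<otimes> y = y \<otimes> t"
  proof (rule ccontr)
    assume not: "t \<otimes> y \<noteq> y \<otimes> t"
    have "t \<otimes> y \<otimes> inv t \<in> cyc a"
      by (rule order_3_mem_cyc_if_12 [OF fin a(1) b(1) _ a(2) b(2) _ big])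
        (use t c y3 in \<open>simp_all add: ord_conj\<close>)
    then obtain k :: int where k: "t \<otimes> y \<otimes> inv t = a [^] k" using cyc_mem_iff [OF a(1)] by blast
    have "(a [^] k) [^] (3::int) = \<one>"
      using t c y3 pow_ord_eq_1 [OF c(1)] unfolding k [symmetric]
      by (simp add: int_pow_numeral conj_nat_pow)
    then have "12 dvd k * 3" using a by (simp add: int_pow_pow int_pow_eq_id)
    then have "4 dvd k" by presburger
    then obtain l where l: "k = 4 * l" by (elim dvdE)
    then have "a [^] k = y [^] l" using a by (simp add: y_def int_pow_pow)
    then have ty: "t \<otimes> y = y [^] l \<otimes> t" using k t c by (simp add: conj_eq_iff)
    have "t [^] (2::nat) \<otimes> y = y [^] (l ^ 2) \<otimes> t [^] (2::nat)"
      by (rule conj_int_pow_iterate [OF t(1) c(1) ty])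
    then have "y [^] (1::int) = y [^] (l ^ 2)" using t c i by (simp add: numeral_2_eq_2)
    then have l2: "3 dvd l ^ 2 - 1" using c y3 by (simp add: int_pow_eq del: int_pow_1)
    have "\<not> 3 dvd l - 1"
    proof
      assume "3 dvd l - 1"
      then have "y [^] (1::int) = y [^] l" using c y3 by (simp only: int_pow_eq) simp
      then show False using not ty c by simp
    qed
    moreover have "\<not> 3 dvd l"
    proof
      assume "3 dvd l"
      then have "3 dvd l ^ 2" by (simp add: power2_eq_square)
      then show False using l2 by presburger
    qed
    ultimately have "3 dvd - 1 - l" by presburger
    then have "y [^] l = y [^] (- 1 :: int)" using c y3 int_pow_eq [OF c(1), of l "-1"] by simp
    then have ty: "t \<otimes> y = inv y \<otimes> t" using ty c by (simp add: int_pow_neg)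
    have tyi: "t \<otimes> y [^] j = y [^] (- j) \<otimes> t" for j :: int
      using conj_int_pow [OF t(1) c(1) _ ty, of j] c by (simp add: int_pow_inv int_pow_neg)
    have inv: "y [^] j \<otimes> t \<in> {z, t, t'}" for j :: int
    proof -
      have "y [^] j \<otimes> t \<otimes> (y [^] j \<otimes> t) = y [^] j \<otimes> (t \<otimes> y [^] j) \<otimes> t" using t c by (simp add: m_assoc)
      also have "\<dots> = (y [^] j \<otimes> y [^] (- j)) \<otimes> (t \<otimes> t)" unfolding tyi using t c by (simp add: m_assoc)
      also have "\<dots> = \<one>" using c i by (simp add: int_pow_neg)
      finally have 1: "y [^] j \<otimes> t \<otimes> (y [^] j \<otimes> t) = \<one>" .
      have "y [^] j \<otimes> t \<noteq> \<one>"
      proof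
        assume "y [^] j \<otimes> t = \<one>"
        then have "inv (y [^] j) \<otimes> (y [^] j \<otimes> t) = inv (y [^] j)" using c by simp
        then have "t = y [^] (- j)" using c t by (simp add: int_pow_neg)
        then have "t = a [^] (4 * - j)" using a by (simp add: y_def int_pow_pow)
        then show False using t_not cyc_mem_iff [OF a(1)] by blast
      qed
      then show ?thesis using 1 t c set by blast
    qed
    have not_z: "y [^] j \<otimes> t \<noteq> z" for j :: int
    proof
      assume "y [^] j \<otimes> t = z"
      then have "inv (y [^] j) \<otimes> (y [^] j \<otimes> t) = inv (y [^] j) \<otimes> z" by simp
      then have "t = y [^] (- j) \<otimes> z" using c t by (simp add: int_pow_neg)
      also have "\<dots> = a [^] (4 * - j + 6)"
        using int_pow_mult [OF a(1), of "4 * - j" 6] a by (simp add: y_def z int_pow_pow)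
      finally show False using t_not cyc_mem_iff [OF a(1)] by blast
    qed
    have dist: "y [^] j \<otimes> t = y [^] k \<otimes> t \<Longrightarrow> 3 dvd k - j" for j k :: int
      using t c y3 by (simp add: int_pow_eq)
    have "y [^] (1::int) \<otimes> t \<noteq> y [^] (0::int) \<otimes> t" "y [^] (2::int) \<otimes> t \<noteq> y [^] (0::int) \<otimes> t"
      "y [^] (1::int) \<otimes> t \<noteq> y [^] (2::int) \<otimes> t"
      using dist [of 1 0] dist [of 2 0] dist [of 1 2] by auto
    \<comment> \<open>t, y t and y^2 t would be three distinct elements of {t, t'}.\<close>
    then show False
      using inv [of 1] inv [of 2] not_z [of 1] not_z [of 2] t by auto
  qed
  have fz: "f \<otimes> z = z \<otimes> f"
    using a by (simp add: f_def z flip: int_pow_mult)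
  have ff: "f \<otimes> f = z" using a by (simp add: f_def z flip: int_pow_mult)
  have z1: "z = (f \<otimes> f) [^] (1::int)" using ff zc by simp
  have fty: "f \<otimes> t = t \<otimes> f"
  proof (rule ccontr)
    assume not: "f \<otimes> t \<noteq> t \<otimes> f"
    then have ft: "f \<otimes> t = z \<otimes> t \<otimes> f" and t': "t' = z \<otimes> t"
      using centralizes_or_swaps [OF c(2) zc t set zt fz z1] by blast+
    have "f \<otimes> t \<otimes> (f \<otimes> t) = z \<otimes> t \<otimes> f \<otimes> (f \<otimes> t)" by (simp only: ft)
    also have "\<dots> = z \<otimes> t \<otimes> (f \<otimes> f) \<otimes> t" using c t zc by (simp add: m_assoc)
    also have "\<dots> = z \<otimes> (t \<otimes> z) \<otimes> t" unfolding ff using t zc by (simp add: m_assoc)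
    also have "t \<otimes> z = z \<otimes> t"
    proof -
      have "t' \<otimes> t' = \<one>" using set by auto
      then have "z \<otimes> (t \<otimes> (z \<otimes> t)) = \<one>" using t' t zc by (simp add: m_assoc)
      then have "z \<otimes> (z \<otimes> (t \<otimes> (z \<otimes> t))) \<otimes> t = z \<otimes> t" using t zc by simp
      then show ?thesis using i t zc mult_tail [of z z \<one>] by (simp add: m_assoc)
    qed
    also have "z \<otimes> (z \<otimes> t) \<otimes> t = \<one>" using i t zc mult_tail [of z z \<one> t] by simp
    finally have 1: "f \<otimes> t \<otimes> (f \<otimes> t) = \<one>" .
    have f: "f = f \<otimes> t \<otimes> t" using c t i by (simp add: m_assoc)
    have "f \<otimes> t \<noteq> \<one>"
    proof
      assume "f \<otimes> t = \<one>"
      then have "f = t" using f t by simp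
      then show False using not by simp
    qed
    then have "f \<otimes> t \<in> {u \<in> carrier G. u \<noteq> \<one> \<and> u \<otimes> u = \<one>}" using 1 c t by simp
    then have "f \<otimes> t \<in> {z, t, z \<otimes> t}" unfolding set t' .
    moreover have "f \<otimes> t \<noteq> t"
    proof
      assume "f \<otimes> t = t"
      then show False using not c t by simp
    qed
    ultimately consider "f \<otimes> t = z" | "f \<otimes> t = z \<otimes> t" by blast
    then show False
    proof cases
      case 1
      have "f \<otimes> t = f \<otimes> f" unfolding ff by (rule 1)
      then have "f = t" using c t by simp
      then show False using not by simp
    next
      case 2
      then have "f = z" using c t zc by simp
      then show False using ff i by simp
    qed
  qed
  have "a = inv f \<otimes> y"
  proof -
    have "inv f \<otimes> y = a [^] (- 3 :: int) \<otimes> a [^] (4::int)" using a by (simp add: f_def y_def int_pow_neg)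
    also have "\<dots> = a" using a by (simp flip: int_pow_mult)
    finally show ?thesis by simp
  qed
  moreover have "inv f \<otimes> t = t \<otimes> inv f"
    using conj_int_pow [OF t(1) c(2) c(2) fty [symmetric], of "- 1"] c(2) by (simp add: int_pow_neg)
  ultimately have at: "a \<otimes> t = t \<otimes> a"
  proof -
    assume a_eq: "a = inv f \<otimes> y" and ft: "inv f \<otimes> t = t \<otimes> inv f"
    have "a \<otimes> t = inv f \<otimes> (y \<otimes> t)" using c t by (simp add: a_eq m_assoc)
    also have "\<dots> = inv f \<otimes> t \<otimes> y" using c t by (simp add: yty m_assoc)
    also have "\<dots> = t \<otimes> a" unfolding ft using c t by (simp add: a_eq m_assoc)
    finally show ?thesis .
  qed
  interpret F: few_big G a t z "ord a"
    by (rule few_bigI [OF fin a(1) _ b(1) ne big _ t set zt at]) (use a z in simp_all)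
  show ?thesis
    using F.three_involutions_iso [OF i(4), unfolded F.three_models_def] a(2) by auto
qed

lemma three_involutions_classification:
  assumes fin: "finite (carrier G)" and half: "2 * card (cyclic_subgroups G) = order G"
    and inv: "involution_count G = 3"
  shows "G \<cong> integer_mod_group 8 \<times>\<times> integer_mod_group 2 \<or> G \<cong> dbl 4 2 1 2 0 1 0 \<or>
    G \<cong> dbl 8 2 7 0 0 4 0 \<or> G \<cong> dbl 8 2 7 0 0 0 1 \<or> G \<cong> dbl 8 2 3 0 0 0 1 \<or> G \<cong> dbl 8 2 7 0 1 4 0 \<or>
    G \<cong> integer_mod_group 12 \<times>\<times> integer_mod_group 2 \<or>
    G \<cong> dbl 12 2 11 0 0 6 0 \<or> G \<cong> dbl 12 2 11 0 0 0 1 \<or> G \<cong> dbl 12 2 5 0 0 0 1 \<or> G \<cong> dbl 12 2 11 0 1 6 1"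
proof -
  let ?I = "{u \<in> carrier G. u \<noteq> \<one> \<and> u \<otimes> u = \<one>}"
  have card_I: "card ?I = 3" using inv involution_count_eq by simp
  then obtain u v w where I: "?I = {u, v, w}" and uvw: "u \<noteq> v" "u \<noteq> w" "v \<noteq> w"
    by (auto simp: card_3_iff)
  have u: "u \<in> carrier G" "u \<otimes> u = \<one>" "u \<noteq> \<one>" and v: "v \<in> carrier G" "v \<otimes> v = \<one>" "v \<noteq> \<one>"
    using I by auto
  have few: "card ?I \<le> 3" using card_I by simp
  show ?thesis
  proof (rule three_involutions_big_cyclic [OF fin half inv])
    fix a assume a: "a \<in> carrier G" "totient (ord a) = 6"
      and big: "\<And>y. y \<in> carrier G \<Longrightarrow> totient (ord y) > 2 \<Longrightarrow> cyc y = cyc a"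
    have no: "ord c \<notin> {5, 7, 9}" if "c \<in> carrier G" for c
      using no_odd_one [OF fin that _ big u few] by blast
    have "ord a \<in> {7, 9, 14, 18}" by (rule totient_eq_6 [OF a(2)])
    \<comment> \<open>The square of \<open>a\<close> then has order 7 or 9, which is excluded as
      well.\<close>
    then have "ord a = 14 \<or> ord a = 18" using no [OF a(1)] by auto
    then have "ord (a [^] (2::nat)) \<in> {5, 7, 9}" using a by (auto simp: ord_pow)
    then show ?thesis using no [of "a [^] (2::nat)"] a by simp
  next
    fix a b assume a: "a \<in> carrier G" and b: "b \<in> carrier G" and tab: "totient (ord a) = 4" "totient (ord b) = 4"
      and ne: "cyc a \<noteq> cyc b"
      and big: "\<And>y. y \<in> carrier G \<Longrightarrow> totient (ord y) > 2 \<Longrightarrow> cyc y = cyc a \<or> cyc y = cyc b"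
    have no5: "ord c \<noteq> 5" if "c \<in> carrier G" for c
      using no_order_5_two [OF fin that _ big u v uvw(1) [symmetric] few] by blast
    have ord: "ord c = 8 \<or> ord c = 12" if c: "c \<in> carrier G" "totient (ord c) = 4" for c
    proof -
      have "ord c \<in> {5, 8, 10, 12}" by (rule totient_eq_4 [OF c(2)])
      moreover have "ord c \<noteq> 10"
      proof
        assume "ord c = 10"
        then have "ord (c [^] (2::nat)) = 5" using c by (simp add: ord_pow)
        then show False using no5 [of "c [^] (2::nat)"] c by simp
      qed
      ultimately show ?thesis using no5 [OF c(1)] by auto
    qed
    define z where "z = a [^] (int (ord a) div 2)"
    have zc: "z \<in> carrier G" using a by (simp add: z_def)
    have "z \<noteq> \<one>"
    proof -
      have "\<not> int (ord a) dvd int (ord a) div 2" using ord [OF a tab(1)] by auto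
      then show ?thesis using a by (simp add: z_def int_pow_eq_id)
    qed
    moreover have "z \<otimes> z = \<one>"
    proof -
      have "z \<otimes> z = a [^] (int (ord a) div 2 + int (ord a) div 2)"
        unfolding z_def by (rule int_pow_mult [symmetric, OF a])
      also have "\<dots> = \<one>" using ord [OF a tab(1)] a by (auto simp: int_pow_eq_id)
      finally show ?thesis .
    qed
    ultimately have "z \<in> {u, v, w}" using I zc by blast
    then obtain t t' where I': "?I = {z, t, t'}" and zt: "z \<noteq> t" "z \<noteq> t'" "t \<noteq> t'"
    proof -
      have "\<exists>t t'. {u, v, w} = {z, t, t'} \<and> z \<noteq> t \<and> z \<noteq> t' \<and> t \<noteq> t'"
        using \<open>z \<in> {u, v, w}\<close> uvw by (metis insert_commute insertE singletonD)
      then show thesis using that I by metis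
    qed
    have t: "t \<in> carrier G" "t' \<in> carrier G" using I' by auto
    from ord [OF a tab(1)] show ?thesis
    proof
      assume "ord a = 8"
      then show ?thesis
        using three_involutions_8 [OF fin a _ b tab(2) ne big _ t I' zt] by (auto simp: z_def)
    next
      assume "ord a = 12"
      then show ?thesis
        using three_involutions_12 [OF fin a _ b tab(2) ne big _ t I' zt] by (auto simp: z_def)
    qed
  qed
qed

section \<open>Groups with nearly half of the elements of order 2\<close>

lemma cyclic_iso_mod:
  assumes fin: "finite (carrier G)" and C: "C \<in> big_cyclic" "card C = order G"
  shows "G \<cong> integer_mod_group (order G)"
proof -
  obtain a where a: "a \<in> carrier G" "C = cyc a"
    using C(1) by (rule big_cyclic_memE)
  have "C = carrier G"
    using card_subset_eq [OF fin, of C] cyc_subset [OF a(1)] C(2) by (simp add: a(2) order_def)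
  moreover have "ord a = order G" using C(2) a generate_pow_card [OF a(1)] by simp
  moreover have "order G > 0" using fin order_gt_0_iff_finite by blast
  ultimately show ?thesis using iso_integer_mod_group [OF a(1)] a(2) by simp
qed

lemma big_cyclic_dvd:
  assumes C: "C \<in> big_cyclic"
  shows "card C dvd order G"
proof -
  obtain a where a: "a \<in> carrier G" "C = cyc a" using C by (rule big_cyclic_memE)
  then show ?thesis using ord_dvd_group_order [OF a(1)] generate_pow_card [OF a(1)] by simp
qed

text \<open>Let m = |C(G)|, let T count the subgroups with totient 2 and K the big ones. Then m = 1
  + O_2 + T + K, so the claims concern T + K >= 2 and the case of equality. There the totients of
  the big subgroups sum to m or m + 2, too much for proper subgroups.\<close>

lemma half_order_bounds:
  assumes fin: "finite (carrier G)" and half: "2 * card (cyclic_subgroups G) = order G"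
  shows "involution_count G + 3 \<le> card (cyclic_subgroups G)"
    and "involution_count G + 3 = card (cyclic_subgroups G) \<longleftrightarrow> G \<cong> integer_mod_group 8"
proof -
  define m where "m = card (cyclic_subgroups G)"
  define T where "T = card {C \<in> cyclic_subgroups G. totient (card C) = 2}"
  define S where "S = (\<Sum>C\<in>big_cyclic. totient (card C))"
  have n: "order G = 2 * m" using half by (simp add: m_def)
  have m: "m > 0" using n order_gt_0_iff_finite fin by simp
  have S: "S = 1 + involution_count G + 2 * card big_cyclic" and K: "card big_cyclic > 0"
    and S4: "4 * card big_cyclic \<le> S"
    using big_cyclic_cases [OF fin half] by (simp_all add: S_def)
  have sum: "2 * m = 1 + involution_count G + 2 * T + S"
    using order_eq_small_plus_rest [OF fin] n by (simp add: S_def T_def)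
  have gt: "totient (card C) > 2" if "C \<in> big_cyclic" for C
    using that by (simp add: big_cyclic_def)
  have even_tot: "even (totient (card C))" if "C \<in> big_cyclic" for C
    using gt [OF that] totient_le [of "card C"] by (intro totient_even) linarith
  \<comment> \<open>A big subgroup equal to G has even order 2 m, and a proper one has order at most
    m.\<close>
  have half_tot: "totient (card C) \<le> m" if C: "C \<in> big_cyclic" for C
  proof -
    obtain k where k: "2 * m = card C * k" using big_cyclic_dvd [OF C] n by auto
    show ?thesis
    proof (cases "k = 1")
      case True
      then have "card C = 2 * m" using k by simp
      then show ?thesis using totient_le_half [of "card C"] by simp
    next
      case False
      then have "k \<ge> 2" using k m by (cases k) auto
      then have "card C * 2 \<le> 2 * m" unfolding k by simp
      then show ?thesis using totient_le [of "card C"] by linarith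
    qed
  qed
  have full: "card C = 2 * m"
    if C: "C \<in> big_cyclic" and *: "totient (card C) = m \<or> 2 * totient (card C) > m \<and> even m" for C
  proof -
    obtain k where k: "2 * m = card C * k" using big_cyclic_dvd [OF C] n by auto
    have le: "totient (card C) \<le> card C" by (rule totient_le)
    have "totient (card C) < card C"
      using gt [OF C] totient_less [of "card C"] le by linarith
    show ?thesis
    proof (rule ccontr)
      assume "card C \<noteq> 2 * m"
      then have "k \<noteq> 1" using k by auto
      then have k2: "k \<ge> 2" using k m by (cases k) auto
      then have 2: "card C * 2 \<le> 2 * m" unfolding k by simp
      then have "totient (card C) \<noteq> m" using \<open>totient (card C) < card C\<close> by linarith
      then have m2: "2 * totient (card C) > m" "even m" using * by auto
      have "\<not> k \<ge> 4"
      proof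
        assume "k \<ge> 4"
        then have "card C * 4 \<le> 2 * m" unfolding k by simp
        then show False using le m2(1) by linarith
      qed
      \<comment> \<open>For index 2 or 3 and even m the order of C is even, so its totient is at
        most |C|/2, hence at most m/2.\<close>
      then have "k = 2 \<or> k = 3" using k2 by auto
      then have "m = card C \<or> 2 * m = card C * 3" using k by auto
      then have "even (card C)"
      proof
        assume "2 * m = card C * 3"
        then have "even (card C * 3)" by (metis dvd_triv_left)
        then show ?thesis by simp
      qed (use m2(2) in simp)
      then show False using totient_le_half [of "card C"] m2(1) 2 by linarith
    qed
  qed
  have TK: "involution_count G + 1 + T + card big_cyclic = m" using S sum by linarith
  \<comment> \<open>Otherwise a single big subgroup would have totient m + 1.\<close>
  have "T + card big_cyclic \<ge> 2"
  proof (rule ccontr)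
    assume "\<not> T + card big_cyclic \<ge> 2"
    then have 1: "card big_cyclic = 1" "T = 0" using K by auto
    then obtain C where C: "big_cyclic = {C}" by (auto simp: card_1_singleton_iff)
    then have "totient (card C) = m + 1" using S TK 1 by (simp add: S_def)
    then show False using half_tot [of C] C by simp
  qed
  then show le: "involution_count G + 3 \<le> card (cyclic_subgroups G)"
    using TK by (simp add: m_def)
  show "involution_count G + 3 = card (cyclic_subgroups G) \<longleftrightarrow> G \<cong> integer_mod_group 8"
  proof
    assume "involution_count G + 3 = card (cyclic_subgroups G)"
    then have O: "involution_count G + 3 = m" by (simp add: m_def)
    then have "card big_cyclic = 1 \<or> card big_cyclic = 2" using TK K by linarith
    then obtain C where C: "C \<in> big_cyclic" "card C = 2 * m"
    proof
      assume 1: "card big_cyclic = 1"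
      then obtain C where C: "big_cyclic = {C}" by (auto simp: card_1_singleton_iff)
      then have "totient (card C) = m" using S O 1 by (simp add: S_def)
      then show thesis using that [of C] full [of C] C by simp
    next
      assume 2: "card big_cyclic = 2"
      then obtain C D where CD: "big_cyclic = {C, D}" "C \<noteq> D" by (auto simp: card_2_iff)
      then have sum: "totient (card C) + totient (card D) = m + 2" using S O 2 by (simp add: S_def)
      \<comment> \<open>Totients above 2 are even, so m is even, and one of the two summands exceeds
        m/2.\<close>
      have "even (m + 2)" unfolding sum [symmetric] using even_tot CD by simp
      then have "even m" by simp
      moreover have "2 * totient (card C) > m \<or> 2 * totient (card D) > m" using sum by linarith
      moreover have mem: "C \<in> big_cyclic" "D \<in> big_cyclic" by (simp_all add: CD(1))
      ultimately have "card C = 2 * m \<or> card D = 2 * m"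
        using full [OF mem(1)] full [OF mem(2)] by blast
      then show thesis using mem that by blast
    qed
    have iso: "G \<cong> integer_mod_group (2 * m)" using cyclic_iso_mod [OF fin C(1)] C(2) n by simp
    \<comment> \<open>A cyclic group of even order has one involution, so m = 1 + 3 and the order is
      8.\<close>
    have "involution_count G = 1"
      using involution_count_iso [OF iso is_group group_integer_mod_group] involution_count_mod [OF m]
      by simp
    then show "G \<cong> integer_mod_group 8" using iso O by simp
  next
    assume iso: "G \<cong> integer_mod_group 8"
    have "involution_count G = 1"
      using involution_count_iso [OF iso is_group group_integer_mod_group] involution_count_mod [of 4]
      by simp
    moreover have "order G = 8"
      using iso_same_card [OF iso] by (simp add: order_def carrier_integer_mod_group)
    ultimately show "involution_count G + 3 = card (cyclic_subgroups G)" using half by simp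
  qed
qed

end

section \<open>From the models back to the named groups\<close>

lemma group_gen_quaternion: "group (gen_quaternion k)"
  unfolding gen_quaternion_def Let_def by (rule group_presented_group)

lemma quaternion_16_times_2: "gen_quaternion 4 \<times>\<times> integer_mod_group 2 \<cong> dbl 8 2 7 0 0 4 0"
proof -
  have "gen_quaternion 4 \<times>\<times> integer_mod_group 2 \<cong> integer_mod_group 2 \<times>\<times> gen_quaternion 4"
    by (rule DirProd_commute_iso)
  also have "\<dots> \<cong> integer_mod_group 2 \<times>\<times> dbl 8 1 7 0 0 4 0"
    by (rule group.DirProd_iso_trans [OF group_integer_mod_group iso_refl gen_quaternion_4])
  also have "\<dots> \<cong> dbl 8 2 7 0 0 4 0"
    by (rule direct_product_dbl [OF group_models(2)]) simp
  finally show ?thesis .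
qed

lemma iso_right_cong:
  fixes K :: "('a, 'b) monoid_scheme" and L :: "('c, 'd) monoid_scheme"
    and M :: "('e, 'f) monoid_scheme"
  assumes "L \<cong> M" "group L"
  shows "K \<cong> L \<longleftrightarrow> K \<cong> M"
  using iso_trans [of K L M] iso_trans [of K M L] group.iso_sym [OF assms(2,1)] assms(1) by blast

lemma semidirect_quaternion_times_2:
  assumes "\<phi> \<in> nontrivial_actions (gen_quaternion 3) (integer_mod_group 3)"
  shows "integer_mod_group 2 \<times>\<times> semidirect_product (integer_mod_group 3) (gen_quaternion 3) \<phi>
    \<cong> dbl 12 2 11 0 0 6 0"
proof -
  have "integer_mod_group 2 \<times>\<times> semidirect_product (integer_mod_group 3) (gen_quaternion 3) \<phi>
    \<cong> integer_mod_group 2 \<times>\<times> dbl 12 1 11 0 0 6 0"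
    by (rule group.DirProd_iso_trans [OF group_integer_mod_group iso_refl semidirect_quaternion [OF assms]])
  also have "\<dots> \<cong> dbl 12 2 11 0 0 6 0"
    by (rule direct_product_dbl [OF group_models(3)]) simp
  finally show ?thesis .
qed

lemma group_nontrivial_semidirect:
  assumes "group N" "group H" "\<phi> \<in> nontrivial_actions H N"
  shows "group (semidirect_product N H \<phi>)"
  using group_semidirect_product [OF assms(1,2)] assms(3) by (simp add: nontrivial_actions_def)

text \<open>All actions in \<open>A\<close> yield the same group \<open>M\<close> up to isomorphism,
  so the quantifier disappears; from right to left an action has to exist.\<close>

lemma ex_action_iso_cong:
  fixes K :: "('a, 'b) monoid_scheme" and L :: "'i \<Rightarrow> ('c, 'd) monoid_scheme"
    and M :: "('e, 'f) monoid_scheme"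
  assumes "A \<noteq> {}" "\<And>\<phi>. \<phi> \<in> A \<Longrightarrow> L \<phi> \<cong> M" "\<And>\<phi>. \<phi> \<in> A \<Longrightarrow> group (L \<phi>)"
  shows "(\<exists>\<phi>\<in>A. K \<cong> L \<phi>) \<longleftrightarrow> K \<cong> M"
proof -
  have "K \<cong> L \<phi> \<longleftrightarrow> K \<cong> M" if "\<phi> \<in> A" for \<phi>
    by (rule iso_right_cong [OF assms(2,3) [OF that]])
  then show ?thesis using assms(1) by blast
qed

lemma model_isos:
  fixes K :: "('a, 'b) monoid_scheme"
  shows "K \<cong> gen_quaternion 4 \<longleftrightarrow> K \<cong> dbl 8 1 7 0 0 4 0"
    and "(\<exists>\<phi> \<in> nontrivial_actions (gen_quaternion 3) (integer_mod_group 3).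
      K \<cong> semidirect_product (integer_mod_group 3) (gen_quaternion 3) \<phi>) \<longleftrightarrow> K \<cong> dbl 12 1 11 0 0 6 0"
    and "K \<cong> modular_max_cyclic 4 \<longleftrightarrow> K \<cong> dbl 4 2 1 2 0 1 0"
    and "K \<cong> SmallGroup_32_10 \<longleftrightarrow> K \<cong> dbl 8 2 7 0 1 4 0"
    and "K \<cong> SmallGroup_32_13 \<longleftrightarrow> K \<cong> dbl 8 2 3 0 0 0 1"
    and "K \<cong> SmallGroup_32_14 \<longleftrightarrow> K \<cong> dbl 8 2 7 0 0 0 1"
    and "K \<cong> gen_quaternion 4 \<times>\<times> integer_mod_group 2 \<longleftrightarrow> K \<cong> dbl 8 2 7 0 0 4 0"
    and "(\<exists>\<phi> \<in> nontrivial_actions (integer_mod_group 4) (integer_mod_group 3).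
      K \<cong> integer_mod_group 4 \<times>\<times>
        semidirect_product (integer_mod_group 3) (integer_mod_group 4) \<phi>) \<longleftrightarrow> K \<cong> dbl 12 2 5 0 0 0 1"
    and "K \<cong> SmallGroup_48_12 \<longleftrightarrow> K \<cong> dbl 12 2 11 0 1 6 1"
    and "K \<cong> SmallGroup_48_13 \<longleftrightarrow> K \<cong> dbl 12 2 11 0 0 0 1"
    and "(\<exists>\<phi> \<in> nontrivial_actions (gen_quaternion 3) (integer_mod_group 3).
      K \<cong> integer_mod_group 2 \<times>\<times>
        semidirect_product (integer_mod_group 3) (gen_quaternion 3) \<phi>) \<longleftrightarrow> K \<cong> dbl 12 2 11 0 0 6 0"
proof -
  show "K \<cong> gen_quaternion 4 \<longleftrightarrow> K \<cong> dbl 8 1 7 0 0 4 0"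
    by (rule iso_right_cong [OF gen_quaternion_4 group_gen_quaternion])
  show "(\<exists>\<phi> \<in> nontrivial_actions (gen_quaternion 3) (integer_mod_group 3).
      K \<cong> semidirect_product (integer_mod_group 3) (gen_quaternion 3) \<phi>) \<longleftrightarrow> K \<cong> dbl 12 1 11 0 0 6 0"
    by (intro ex_action_iso_cong ex_quaternion_action semidirect_quaternion
      group_nontrivial_semidirect group_integer_mod_group group_gen_quaternion)
  show "K \<cong> modular_max_cyclic 4 \<longleftrightarrow> K \<cong> dbl 4 2 1 2 0 1 0"
    by (rule iso_right_cong [OF modular_max_cyclic_4])
      (simp add: modular_max_cyclic_def Let_def group_presented_group)
  show "K \<cong> SmallGroup_32_10 \<longleftrightarrow> K \<cong> dbl 8 2 7 0 1 4 0"
    by (rule iso_right_cong [OF SmallGroup_32_10])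
      (simp add: SmallGroup_32_10_def Let_def group_presented_group)
  show "K \<cong> SmallGroup_32_13 \<longleftrightarrow> K \<cong> dbl 8 2 3 0 0 0 1"
    by (rule iso_right_cong [OF SmallGroup_32_13])
      (simp add: SmallGroup_32_13_def Let_def group_presented_group)
  show "K \<cong> SmallGroup_32_14 \<longleftrightarrow> K \<cong> dbl 8 2 7 0 0 0 1"
    by (rule iso_right_cong [OF SmallGroup_32_14])
      (simp add: SmallGroup_32_14_def Let_def group_presented_group)
  show "K \<cong> gen_quaternion 4 \<times>\<times> integer_mod_group 2 \<longleftrightarrow> K \<cong> dbl 8 2 7 0 0 4 0"
    by (intro iso_right_cong quaternion_16_times_2 DirProd_group group_gen_quaternion
      group_integer_mod_group)
  show "(\<exists>\<phi> \<in> nontrivial_actions (integer_mod_group 4) (integer_mod_group 3).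
      K \<cong> integer_mod_group 4 \<times>\<times>
        semidirect_product (integer_mod_group 3) (integer_mod_group 4) \<phi>) \<longleftrightarrow> K \<cong> dbl 12 2 5 0 0 0 1"
    by (intro ex_action_iso_cong ex_mod_4_action semidirect_mod_4 DirProd_group
      group_nontrivial_semidirect group_integer_mod_group)
  show "K \<cong> SmallGroup_48_12 \<longleftrightarrow> K \<cong> dbl 12 2 11 0 1 6 1"
    by (rule iso_right_cong [OF SmallGroup_48_12])
      (simp add: SmallGroup_48_12_def Let_def group_presented_group)
  show "K \<cong> SmallGroup_48_13 \<longleftrightarrow> K \<cong> dbl 12 2 11 0 0 0 1"
    by (rule iso_right_cong [OF SmallGroup_48_13])
      (simp add: SmallGroup_48_13_def Let_def group_presented_group)
  show "(\<exists>\<phi> \<in> nontrivial_actions (gen_quaternion 3) (integer_mod_group 3).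
      K \<cong> integer_mod_group 2 \<times>\<times>
        semidirect_product (integer_mod_group 3) (gen_quaternion 3) \<phi>) \<longleftrightarrow> K \<cong> dbl 12 2 11 0 0 6 0"
    by (intro ex_action_iso_cong ex_quaternion_action semidirect_quaternion_times_2 DirProd_group
      group_nontrivial_semidirect group_integer_mod_group group_gen_quaternion)
qed

lemma involution_count_models:
  "involution_count (dbl 8 1 7 0 0 4 0) = 1" "involution_count (dbl 12 1 11 0 0 6 0) = 1"
  "involution_count (dbl 4 2 1 2 0 1 0) = 3" "involution_count (dbl 8 2 7 0 0 4 0) = 3"
  "involution_count (dbl 8 2 7 0 0 0 1) = 3" "involution_count (dbl 8 2 3 0 0 0 1) = 3"
  "involution_count (dbl 8 2 7 0 1 4 0) = 3" "involution_count (dbl 12 2 11 0 0 6 0) = 3"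
  "involution_count (dbl 12 2 11 0 0 0 1) = 3" "involution_count (dbl 12 2 5 0 0 0 1) = 3"
  "involution_count (dbl 12 2 11 0 1 6 1) = 3"
proof -
  have "involution_count (dbl (2 * 4) 1 7 0 0 4 0) = 2 * 1 - 1"
    by (rule involution_count_dbl) (use group_models in \<open>simp_all del: One_nat_def\<close>, presburger?)
  then show "involution_count (dbl 8 1 7 0 0 4 0) = 1" by simp
  have "involution_count (dbl (2 * 6) 1 11 0 0 6 0) = 2 * 1 - 1"
    by (rule involution_count_dbl) (use group_models in \<open>simp_all del: One_nat_def\<close>, presburger?)
  then show "involution_count (dbl 12 1 11 0 0 6 0) = 1" by simp
  have "involution_count (dbl (2 * 2) 2 1 2 0 1 0) = 2 * 2 - 1"
    by (rule involution_count_dbl) (use group_models in \<open>simp_all del: One_nat_def\<close>, presburger?)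
  then show "involution_count (dbl 4 2 1 2 0 1 0) = 3" by simp
  have "involution_count (dbl (2 * 4) 2 7 0 0 4 0) = 2 * 2 - 1"
    by (rule involution_count_dbl) (use group_models in \<open>simp_all del: One_nat_def\<close>, presburger?)
  then show "involution_count (dbl 8 2 7 0 0 4 0) = 3" by simp
  have "involution_count (dbl (2 * 4) 2 7 0 0 0 1) = 2 * 2 - 1"
    by (rule involution_count_dbl) (use group_models in \<open>simp_all del: One_nat_def\<close>, presburger?)
  then show "involution_count (dbl 8 2 7 0 0 0 1) = 3" by simp
  have "involution_count (dbl (2 * 4) 2 3 0 0 0 1) = 2 * 2 - 1"
    by (rule involution_count_dbl) (use group_models in \<open>simp_all del: One_nat_def\<close>, presburger?)
  then show "involution_count (dbl 8 2 3 0 0 0 1) = 3" by simp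
  have "involution_count (dbl (2 * 4) 2 7 0 1 4 0) = 2 * 2 - 1"
    by (rule involution_count_dbl) (use group_models in \<open>simp_all del: One_nat_def\<close>, presburger?)
  then show "involution_count (dbl 8 2 7 0 1 4 0) = 3" by simp
  have "involution_count (dbl (2 * 6) 2 11 0 0 6 0) = 2 * 2 - 1"
    by (rule involution_count_dbl) (use group_models in \<open>simp_all del: One_nat_def\<close>, presburger?)
  then show "involution_count (dbl 12 2 11 0 0 6 0) = 3" by simp
  have "involution_count (dbl (2 * 6) 2 11 0 0 0 1) = 2 * 2 - 1"
    by (rule involution_count_dbl) (use group_models in \<open>simp_all del: One_nat_def\<close>, presburger?)
  then show "involution_count (dbl 12 2 11 0 0 0 1) = 3" by simp
  have "involution_count (dbl (2 * 6) 2 5 0 0 0 1) = 2 * 2 - 1"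
    by (rule involution_count_dbl) (use group_models in \<open>simp_all del: One_nat_def\<close>, presburger?)
  then show "involution_count (dbl 12 2 5 0 0 0 1) = 3" by simp
  have "involution_count (dbl (2 * 6) 2 11 0 1 6 1) = 2 * 2 - 1"
    by (rule involution_count_dbl) (use group_models in \<open>simp_all del: One_nat_def\<close>, presburger?)
  then show "involution_count (dbl 12 2 11 0 1 6 1) = 3" by simp
qed

theorem theorem1p2:
  fixes G :: "('a, 'b) monoid_scheme"
  assumes "group G" and "finite (carrier G)"
    and "real (card (cyclic_subgroups G)) = real (order G) / 2"
  shows
    "(involution_count G = 1 \<longleftrightarrow>
        G \<cong> integer_mod_group 8 \<or>
        G \<cong> integer_mod_group 12 \<or>
        G \<cong> gen_quaternion 4 \<or>
        (\<exists>\<phi> \<in> nontrivial_actions (gen_quaternion 3) (integer_mod_group 3).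
           G \<cong> semidirect_product (integer_mod_group 3) (gen_quaternion 3) \<phi>))
   \<and> (involution_count G = 3 \<longleftrightarrow>
        G \<cong> integer_mod_group 8 \<times>\<times> integer_mod_group 2 \<or>
        G \<cong> modular_max_cyclic 4 \<or>
        G \<cong> SmallGroup_32_10 \<or>
        G \<cong> SmallGroup_32_13 \<or>
        G \<cong> SmallGroup_32_14 \<or>
        G \<cong> gen_quaternion 4 \<times>\<times> integer_mod_group 2 \<or>
        G \<cong> integer_mod_group 12 \<times>\<times> integer_mod_group 2 \<or>
        (\<exists>\<phi> \<in> nontrivial_actions (integer_mod_group 4) (integer_mod_group 3).
           G \<cong> integer_mod_group 4 \<times>\<times>
               semidirect_product (integer_mod_group 3) (integer_mod_group 4) \<phi>) \<or>
        G \<cong> SmallGroup_48_12 \<or>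
        G \<cong> SmallGroup_48_13 \<or>
        (\<exists>\<phi> \<in> nontrivial_actions (gen_quaternion 3) (integer_mod_group 3).
           G \<cong> integer_mod_group 2 \<times>\<times>
               semidirect_product (integer_mod_group 3) (gen_quaternion 3) \<phi>))
   \<and> (real (involution_count G) \<noteq> real (order G) / 2 - 1 \<and>
      real (involution_count G) \<noteq> real (order G) / 2 - 2)
   \<and> (real (involution_count G) = real (order G) / 2 - 3 \<longleftrightarrow> G \<cong> integer_mod_group 8)"
proof -
  interpret group G by fact
  have "real (order G) = real (2 * card (cyclic_subgroups G))" using assms(3) by simp
  then have half: "2 * card (cyclic_subgroups G) = order G" unfolding of_nat_eq_iff by simp
  have one: "involution_count G = 1 \<longleftrightarrow>
      G \<cong> integer_mod_group 8 \<or> G \<cong> integer_mod_group 12 \<or> G \<cong> dbl 8 1 7 0 0 4 0 \<or>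
      G \<cong> dbl 12 1 11 0 0 6 0" (is "?O = 1 \<longleftrightarrow> ?R1")
  proof
    assume "?O = 1"
    then show ?R1 by (rule one_involution_classification [OF assms(2) half])
  next
    \<comment> \<open>As |C(G)| is given, this direction is only a count of involutions, an
      isomorphism invariant.\<close>
    assume ?R1
    then show "?O = 1"
      using involution_count_iso [OF _ is_group group_integer_mod_group, of 8]
        involution_count_iso [OF _ is_group group_integer_mod_group, of 12]
        involution_count_iso [OF _ is_group group_models(2)]
        involution_count_iso [OF _ is_group group_models(3)]
        involution_count_mod [of 4] involution_count_mod [of 6] involution_count_models(1,2)
      by (elim disjE) (simp_all del: One_nat_def)
  qed
  let ?R3 = "G \<cong> integer_mod_group 8 \<times>\<times> integer_mod_group 2 \<or> G \<cong> dbl 4 2 1 2 0 1 0 \<or>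
    G \<cong> dbl 8 2 7 0 0 4 0 \<or> G \<cong> dbl 8 2 7 0 0 0 1 \<or> G \<cong> dbl 8 2 3 0 0 0 1 \<or> G \<cong> dbl 8 2 7 0 1 4 0 \<or>
    G \<cong> integer_mod_group 12 \<times>\<times> integer_mod_group 2 \<or>
    G \<cong> dbl 12 2 11 0 0 6 0 \<or> G \<cong> dbl 12 2 11 0 0 0 1 \<or> G \<cong> dbl 12 2 5 0 0 0 1 \<or> G \<cong> dbl 12 2 11 0 1 6 1"
  have three: "involution_count G = 3 \<longleftrightarrow> ?R3"
  proof
    assume "involution_count G = 3"
    then show ?R3 by (rule three_involutions_classification [OF assms(2) half])
  next
    have dir: "group (integer_mod_group m \<times>\<times> integer_mod_group 2)" for m
      by (intro DirProd_group group_integer_mod_group)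
    note iso = involution_count_iso [OF _ is_group]
    assume ?R3
    then show "involution_count G = 3"
    proof (elim disjE)
      assume *: "G \<cong> integer_mod_group 8 \<times>\<times> integer_mod_group 2"
      show ?thesis using iso [OF * dir] involution_count_mod_times_2 [of 4] by simp
    next
      assume *: "G \<cong> integer_mod_group 12 \<times>\<times> integer_mod_group 2"
      show ?thesis using iso [OF * dir] involution_count_mod_times_2 [of 6] by simp
    qed (auto dest!: iso simp: group_models involution_count_models)
  qed
  have eq: "real (order G) = 2 * real (card (cyclic_subgroups G))" using assms(3) by simp
  note bounds = half_order_bounds [OF assms(2) half]
  have four: "real (involution_count G) = real (order G) / 2 - 3 \<longleftrightarrow> G \<cong> integer_mod_group 8"
  proof -
    have "real (involution_count G) = real (order G) / 2 - 3 \<longleftrightarrow>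
        involution_count G + 3 = card (cyclic_subgroups G)"
      unfolding eq by linarith
    then show ?thesis unfolding bounds(2) .
  qed
  have "real (involution_count G) \<noteq> real (order G) / 2 - 1 \<and>
      real (involution_count G) \<noteq> real (order G) / 2 - 2"
    unfolding eq using bounds(1) by linarith
  then show ?thesis unfolding model_isos four using one three by argo
qed

end
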